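(* Let $\mathbb{K}$ be a field and $\Delta$ a simplicial complex with Stanley-Reisner ring $R=\mathbb{K}[\Delta]$. Let $i,j\ge 0$ and $\ell$ be integers with $2\le\ell\le i+1$. If $R$ satisfies $(S_\ell^j)$, then the Stanley-Reisner ring over $\mathbb{K}$ of the $i$-skeleton $\Delta^{(i)}$ satisfies $(S_\ell^j)$.
   Context: A commutative Noetherian ring $A$ satisfies $(S_\ell^j)$ if $\operatorname{depth}A_{\mathfrak{p}}\ge\min\{\ell,\dim A_{\mathfrak{p}}-j\}$ for all $\mathfrak{p}\in\operatorname{Spec}A$. The $i$-skeleton of $\Delta$ is $\Delta^{(i)}=\{F\in\Delta : \dim F\le i\}$, with $\dim F=|F|-1$. The complex $\Delta$ is not assumed pure. *)

theory Defs
  imports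
    "HOL-Algebra.QuotRing"
    "HOL-Library.Poly_Mapping"
    "HOL-Library.Extended_Real"
begin

section \<open>Localization\<close>

definition fraction_rel :: "('a, 'm) ring_scheme \<Rightarrow> 'a set \<Rightarrow> (('a \<times> 'a) \<times> ('a \<times> 'a)) set" where
  "fraction_rel R S = {((a, s), (b, t)). a \<in> carrier R \<and> s \<in> S \<and> b \<in> carrier R \<and> t \<in> S \<and>
     (\<exists>u\<in>S. u \<otimes>\<^bsub>R\<^esub> (t \<otimes>\<^bsub>R\<^esub> a) = u \<otimes>\<^bsub>R\<^esub> (s \<otimes>\<^bsub>R\<^esub> b))}"

definition fraction :: "('a, 'm) ring_scheme \<Rightarrow> 'a set \<Rightarrow> 'a \<Rightarrow> 'a \<Rightarrow> ('a \<times> 'a) set" where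
  "fraction R S a s = fraction_rel R S `` {(a, s)}"

text \<open>Sum and product are unions over all representatives; each such union is a single
  fraction, see \<open>localization_add\<close> and \<open>localization_mult\<close> below.\<close>

definition localization :: "('a, 'm) ring_scheme \<Rightarrow> 'a set \<Rightarrow> ('a \<times> 'a) set ring" where
  "localization R S =
    \<lparr>carrier = (carrier R \<times> S) // fraction_rel R S,
     mult = (\<lambda>X Y. \<Union>(a, s)\<in>X. \<Union>(b, t)\<in>Y. fraction R S (a \<otimes>\<^bsub>R\<^esub> b) (s \<otimes>\<^bsub>R\<^esub> t)),
     one = fraction R S \<one>\<^bsub>R\<^esub> \<one>\<^bsub>R\<^esub>,
     zero = fraction R S \<zero>\<^bsub>R\<^esub> \<one>\<^bsub>R\<^esub>,
     add = (\<lambda>X Y. \<Union>(a, s)\<in>X. \<Union>(b, t)\<in>Y.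
       fraction R S (a \<otimes>\<^bsub>R\<^esub> t \<oplus>\<^bsub>R\<^esub> b \<otimes>\<^bsub>R\<^esub> s) (s \<otimes>\<^bsub>R\<^esub> t))\<rparr>"

definition localization_at :: "('a, 'm) ring_scheme \<Rightarrow> 'a set \<Rightarrow> ('a \<times> 'a) set ring" where
  "localization_at R P = localization R (carrier R - P)"

locale localization_setup = cring R for R (structure) +
  fixes S
  assumes S_sub: "S \<subseteq> carrier R" and S_one: "\<one> \<in> S"
    and S_mult: "\<And>s t. s \<in> S \<Longrightarrow> t \<in> S \<Longrightarrow> s \<otimes> t \<in> S"
begin

lemma S_carr[simp]: "s \<in> S \<Longrightarrow> s \<in> carrier R"
  using S_sub by blast

lemma fraction_equiv: "equiv (carrier R \<times> S) (fraction_rel R S)"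
proof (rule equivI)
  show "fraction_rel R S \<subseteq> (carrier R \<times> S) \<times> (carrier R \<times> S)"
    by (auto simp: fraction_rel_def)
  show "refl_on (carrier R \<times> S) (fraction_rel R S)"
    using S_one by (auto simp: fraction_rel_def refl_on_def)
  show "sym (fraction_rel R S)"
    by (auto simp: fraction_rel_def sym_def) metis
  show "trans (fraction_rel R S)"
  proof (rule transI, clarsimp simp: fraction_rel_def)
    fix a s b t c r u v
    assume c: "a \<in> carrier R" "s \<in> S" "b \<in> carrier R" "t \<in> S" "c \<in> carrier R" "r \<in> S"
      "u \<in> S" "v \<in> S" and 1: "u \<otimes> (t \<otimes> a) = u \<otimes> (s \<otimes> b)" and 2: "v \<otimes> (r \<otimes> b) = v \<otimes> (t \<otimes> c)"
    have "(u \<otimes> v \<otimes> t) \<otimes> (r \<otimes> a) = (v \<otimes> r) \<otimes> (u \<otimes> (t \<otimes> a))" using c by (simp add: m_ac)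
    also have "\<dots> = (u \<otimes> s) \<otimes> (v \<otimes> (r \<otimes> b))" using c unfolding 1 by (simp add: m_ac)
    also have "\<dots> = (u \<otimes> v \<otimes> t) \<otimes> (s \<otimes> c)" using c unfolding 2 by (simp add: m_ac)
    finally show "\<exists>u\<in>S. u \<otimes> (r \<otimes> a) = u \<otimes> (s \<otimes> c)" using c S_mult by blast
  qed
qed

lemma fraction_eqI:
  assumes "a \<in> carrier R" "s \<in> S" "b \<in> carrier R" "t \<in> S" "u \<in> S"
    and "u \<otimes> (t \<otimes> a) = u \<otimes> (s \<otimes> b)"
  shows "fraction R S a s = fraction R S b t"
  unfolding fraction_def using assms
  by (intro equiv_class_eq[OF fraction_equiv]) (auto simp: fraction_rel_def)

lemma fraction_eqI1:
  assumes "a \<in> carrier R" "s \<in> S" "b \<in> carrier R" "t \<in> S" "t \<otimes> a = s \<otimes> b"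
  shows "fraction R S a s = fraction R S b t"
  using assms S_one by (intro fraction_eqI[where u = \<one>]) auto

lemma fraction_carrier: "a \<in> carrier R \<Longrightarrow> s \<in> S \<Longrightarrow> fraction R S a s \<in> carrier (localization R S)"
  by (auto simp: localization_def fraction_def intro: quotientI)

lemma fraction_cases:
  assumes "X \<in> carrier (localization R S)"
  obtains a s where "a \<in> carrier R" "s \<in> S" "X = fraction R S a s"
  using assms by (auto simp: localization_def fraction_def elim: quotientE)

lemma fraction_self: "a \<in> carrier R \<Longrightarrow> s \<in> S \<Longrightarrow> (a, s) \<in> fraction R S a s"
  using S_one by (auto simp: fraction_def fraction_rel_def)

lemma UN_UN_const:
  assumes "p \<in> X" "q \<in> Y" and "\<And>a s b t. (a, s) \<in> X \<Longrightarrow> (b, t) \<in> Y \<Longrightarrow> f a s b t = C"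
  shows "(\<Union>(a, s)\<in>X. \<Union>(b, t)\<in>Y. f a s b t) = C"
proof -
  have "(\<Union>(a, s)\<in>X. \<Union>(b, t)\<in>Y. f a s b t) = (\<Union>p\<in>X. \<Union>q\<in>Y. C)"
    using assms(3) by (intro SUP_cong) auto
  then show ?thesis using assms(1,2) by auto
qed

lemma fraction_memD:
  assumes "(b, t) \<in> fraction R S a s"
  shows "b \<in> carrier R" "t \<in> S" "\<exists>u\<in>S. u \<otimes> (t \<otimes> a) = u \<otimes> (s \<otimes> b)"
  using assms by (auto simp: fraction_def fraction_rel_def)

lemma localization_mult:
  assumes c: "a \<in> carrier R" "s \<in> S" "b \<in> carrier R" "t \<in> S"
  shows "fraction R S a s \<otimes>\<^bsub>localization R S\<^esub> fraction R S b t = fraction R S (a \<otimes> b) (s \<otimes> t)"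
proof -
  have "fraction R S (a' \<otimes> b') (s' \<otimes> t') = fraction R S (a \<otimes> b) (s \<otimes> t)"
    if m: "(a', s') \<in> fraction R S a s" "(b', t') \<in> fraction R S b t" for a' b' s' t'
  proof -
    obtain u v where uv: "u \<in> S" "v \<in> S" "u \<otimes> (s' \<otimes> a) = u \<otimes> (s \<otimes> a')" "v \<otimes> (t' \<otimes> b) = v \<otimes> (t \<otimes> b')"
      using fraction_memD(3)[OF m(1)] fraction_memD(3)[OF m(2)] by blast
    note c' = fraction_memD(1,2)[OF m(1)] fraction_memD(1,2)[OF m(2)] c
    have "(u \<otimes> v) \<otimes> ((s \<otimes> t) \<otimes> (a' \<otimes> b')) = (u \<otimes> (s \<otimes> a')) \<otimes> (v \<otimes> (t \<otimes> b'))"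
      using c' uv(1,2) by (simp add: m_ac)
    also have "\<dots> = (u \<otimes> v) \<otimes> ((s' \<otimes> t') \<otimes> (a \<otimes> b))"
      unfolding uv(3,4)[symmetric] using c' uv(1,2) by (simp add: m_ac)
    finally show ?thesis using c' uv(1,2) S_mult by (intro fraction_eqI[of _ _ _ _ "u \<otimes> v"]) auto
  qed
  note key = this
  show ?thesis
    by (simp add: localization_def)
      (rule UN_UN_const[OF fraction_self[OF c(1,2)] fraction_self[OF c(3,4)]], erule (1) key)
qed

lemma localization_add:
  assumes c: "a \<in> carrier R" "s \<in> S" "b \<in> carrier R" "t \<in> S"
  shows "fraction R S a s \<oplus>\<^bsub>localization R S\<^esub> fraction R S b t = fraction R S (a \<otimes> t \<oplus> b \<otimes> s) (s \<otimes> t)"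
proof -
  have "fraction R S (a' \<otimes> t' \<oplus> b' \<otimes> s') (s' \<otimes> t') = fraction R S (a \<otimes> t \<oplus> b \<otimes> s) (s \<otimes> t)"
    if m: "(a', s') \<in> fraction R S a s" "(b', t') \<in> fraction R S b t" for a' b' s' t'
  proof -
    obtain u v where uv: "u \<in> S" "v \<in> S" "u \<otimes> (s' \<otimes> a) = u \<otimes> (s \<otimes> a')" "v \<otimes> (t' \<otimes> b) = v \<otimes> (t \<otimes> b')"
      using fraction_memD(3)[OF m(1)] fraction_memD(3)[OF m(2)] by blast
    note c' = fraction_memD(1,2)[OF m(1)] fraction_memD(1,2)[OF m(2)] c
    have "(u \<otimes> v) \<otimes> ((s \<otimes> t) \<otimes> (a' \<otimes> t' \<oplus> b' \<otimes> s'))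
        = (u \<otimes> (s \<otimes> a')) \<otimes> (v \<otimes> (t \<otimes> t')) \<oplus> (v \<otimes> (t \<otimes> b')) \<otimes> (u \<otimes> (s \<otimes> s'))"
      using c' uv(1,2) by (simp add: m_ac r_distr)
    also have "\<dots> = (u \<otimes> v) \<otimes> ((s' \<otimes> t') \<otimes> (a \<otimes> t \<oplus> b \<otimes> s))"
      unfolding uv(3,4)[symmetric] using c' uv(1,2) by (simp add: m_ac r_distr)
    finally show ?thesis using c' uv(1,2) S_mult by (intro fraction_eqI[of _ _ _ _ "u \<otimes> v"]) auto
  qed
  note key = this
  show ?thesis
    by (simp add: localization_def)
      (rule UN_UN_const[OF fraction_self[OF c(1,2)] fraction_self[OF c(3,4)]], erule (1) key)
qed

lemma localization_one: "\<one>\<^bsub>localization R S\<^esub> = fraction R S \<one> \<one>"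
  and localization_zero: "\<zero>\<^bsub>localization R S\<^esub> = fraction R S \<zero> \<one>"
  by (simp_all add: localization_def)

lemmas localization_simps = localization_add localization_mult localization_one localization_zero

lemma localization_cring: "cring (localization R S)"
proof (rule cringI)
  let ?L = "localization R S"
  note [simp] = localization_simps S_mult S_one fraction_carrier
  show "abelian_group ?L"
  proof (rule abelian_groupI)
    fix X Y assume "X \<in> carrier ?L" "Y \<in> carrier ?L"
    then show "X \<oplus>\<^bsub>?L\<^esub> Y \<in> carrier ?L" by (elim fraction_cases) simp
  next
    show "\<zero>\<^bsub>?L\<^esub> \<in> carrier ?L" by simp
  next
    fix X Y Z assume "X \<in> carrier ?L" "Y \<in> carrier ?L" "Z \<in> carrier ?L"
    then show "X \<oplus>\<^bsub>?L\<^esub> Y \<oplus>\<^bsub>?L\<^esub> Z = X \<oplus>\<^bsub>?L\<^esub> (Y \<oplus>\<^bsub>?L\<^esub> Z)"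
      by (elim fraction_cases) (simp, intro fraction_eqI1, simp_all add: l_distr r_distr m_ac a_ac)
  next
    fix X Y assume "X \<in> carrier ?L" "Y \<in> carrier ?L"
    then show "X \<oplus>\<^bsub>?L\<^esub> Y = Y \<oplus>\<^bsub>?L\<^esub> X"
      by (elim fraction_cases) (simp, intro fraction_eqI1, simp_all add: l_distr r_distr m_ac a_ac)
  next
    fix X assume "X \<in> carrier ?L"
    then show "\<zero>\<^bsub>?L\<^esub> \<oplus>\<^bsub>?L\<^esub> X = X" by (elim fraction_cases) simp
  next
    fix X assume "X \<in> carrier ?L"
    then obtain a s where X: "a \<in> carrier R" "s \<in> S" "X = fraction R S a s" by (rule fraction_cases)
    have "fraction R S (\<ominus> a) s \<oplus>\<^bsub>?L\<^esub> X = \<zero>\<^bsub>?L\<^esub>"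
      using X by (simp, intro fraction_eqI1) (simp_all add: l_minus l_neg)
    then show "\<exists>Y\<in>carrier ?L. Y \<oplus>\<^bsub>?L\<^esub> X = \<zero>\<^bsub>?L\<^esub>" using X by (meson a_inv_closed fraction_carrier)
  qed
  show "comm_monoid ?L"
  proof (rule comm_monoidI)
    fix X Y assume "X \<in> carrier ?L" "Y \<in> carrier ?L"
    then show "X \<otimes>\<^bsub>?L\<^esub> Y \<in> carrier ?L" by (elim fraction_cases) simp
  next
    show "\<one>\<^bsub>?L\<^esub> \<in> carrier ?L" by simp
  next
    fix X Y Z assume "X \<in> carrier ?L" "Y \<in> carrier ?L" "Z \<in> carrier ?L"
    then show "X \<otimes>\<^bsub>?L\<^esub> Y \<otimes>\<^bsub>?L\<^esub> Z = X \<otimes>\<^bsub>?L\<^esub> (Y \<otimes>\<^bsub>?L\<^esub> Z)"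
      by (elim fraction_cases) (simp add: m_ac)
  next
    fix X assume "X \<in> carrier ?L"
    then show "\<one>\<^bsub>?L\<^esub> \<otimes>\<^bsub>?L\<^esub> X = X" by (elim fraction_cases) simp
  next
    fix X Y assume "X \<in> carrier ?L" "Y \<in> carrier ?L"
    then show "X \<otimes>\<^bsub>?L\<^esub> Y = Y \<otimes>\<^bsub>?L\<^esub> X" by (elim fraction_cases) (simp add: m_ac)
  qed
  fix X Y Z assume "X \<in> carrier ?L" "Y \<in> carrier ?L" "Z \<in> carrier ?L"
  then show "(X \<oplus>\<^bsub>?L\<^esub> Y) \<otimes>\<^bsub>?L\<^esub> Z = X \<otimes>\<^bsub>?L\<^esub> Z \<oplus>\<^bsub>?L\<^esub> Y \<otimes>\<^bsub>?L\<^esub> Z"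
    by (elim fraction_cases) (simp, intro fraction_eqI1, simp_all add: l_distr r_distr m_ac a_ac)
qed

end

lemma localization_at_cring:
  assumes "primeideal P R"
  shows "cring (localization_at R P)"
proof -
  interpret primeideal P R by fact
  interpret localization_setup R "carrier R - P"
  proof
    show "\<one>\<^bsub>R\<^esub> \<in> carrier R - P" using I_notcarr one_imp_carrier by auto
    show "s \<otimes>\<^bsub>R\<^esub> t \<in> carrier R - P" if "s \<in> carrier R - P" "t \<in> carrier R - P" for s t
      using that I_prime by auto
  qed auto
  show ?thesis unfolding localization_at_def by (rule localization_cring)
qed


section \<open>Krull dimension, depth and the Serre-type conditions\<close>

text \<open>Supremum of the lengths of strict chains of prime ideals. In \<^typ>\<open>enat\<close> the supremum of the
  empty set is \<open>0\<close>, so the zero ring gets dimension \<open>0\<close>; localizations at primes are nonzero.\<close>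

definition krull_dim :: "('a, 'm) ring_scheme \<Rightarrow> enat" where
  "krull_dim R = Sup {enat n | n. \<exists>P :: nat \<Rightarrow> 'a set.
     (\<forall>k\<le>n. primeideal (P k) R) \<and> (\<forall>k<n. P k \<subset> P (Suc k))}"

text \<open>\<open>x\<^sub>k\<close> is a nonzerodivisor on \<open>R/(x\<^sub>0, \<dots>, x\<^sub>k\<^sub>-\<^sub>1)\<close> for each \<open>k\<close>, and
  \<open>R/(x\<^sub>0, \<dots>, x\<^sub>n\<^sub>-\<^sub>1) \<noteq> 0\<close>.\<close>

definition regular_sequence :: "('a, 'm) ring_scheme \<Rightarrow> 'a list \<Rightarrow> bool" where
  "regular_sequence R xs \<longleftrightarrow>
     set xs \<subseteq> carrier R \<and>
     (\<forall>k<length xs. \<forall>a\<in>carrier R.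
        xs ! k \<otimes>\<^bsub>R\<^esub> a \<in> Idl\<^bsub>R\<^esub> (set (take k xs)) \<longrightarrow> a \<in> Idl\<^bsub>R\<^esub> (set (take k xs))) \<and>
     Idl\<^bsub>R\<^esub> (set xs) \<noteq> carrier R"

text \<open>Only meant for a local ring \<open>R\<close>, where \<open>M\<close> is the unique maximal ideal.\<close>

definition depth :: "('a, 'm) ring_scheme \<Rightarrow> enat" where
  "depth R = Sup {enat (length xs) | xs M.
     maximalideal M R \<and> set xs \<subseteq> M \<and> regular_sequence R xs}"

text \<open>The condition \<open>(S\<^sub>l\<^sup>j)\<close>, meant for commutative Noetherian rings. The comparison takes place in
  \<^typ>\<open>ereal\<close> since \<open>dim A\<^sub>P - j\<close> may be negative.\<close>

definition serre_condition :: "int \<Rightarrow> int \<Rightarrow> ('a, 'm) ring_scheme \<Rightarrow> bool" where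
  "serre_condition l j A \<longleftrightarrow> (\<forall>P. primeideal P A \<longrightarrow>
     ereal_of_enat (depth (localization_at A P))
       \<ge> min (ereal (of_int l)) (ereal_of_enat (krull_dim (localization_at A P)) - ereal (of_int j)))"


section \<open>Simplicial complexes and Stanley-Reisner rings\<close>

text \<open>Elements of \<open>V\<close> need not be vertices of \<open>\<Delta>\<close>; the variable of a non-vertex is killed in the
  Stanley-Reisner ring. The void complex \<open>\<Delta> = {}\<close> is allowed; its ring is the zero ring.\<close>

definition simplicial_complex :: "'v set \<Rightarrow> 'v set set \<Rightarrow> bool" where
  "simplicial_complex V \<Delta> \<longleftrightarrow>
     finite V \<and> \<Delta> \<subseteq> Pow V \<and> (\<forall>F\<in>\<Delta>. \<forall>G. G \<subseteq> F \<longrightarrow> G \<in> \<Delta>)"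

definition face_dim :: "'v set \<Rightarrow> int" where
  "face_dim F = int (card F) - 1"

definition skeleton :: "int \<Rightarrow> 'v set set \<Rightarrow> 'v set set" where
  "skeleton i \<Delta> = {F \<in> \<Delta>. face_dim F \<le> i}"

text \<open>An exponent vector is a finitely supported function \<open>'v \<Rightarrow>\<^sub>0 nat\<close>, a polynomial a finitely
  supported map from exponent vectors to coefficients.\<close>

definition poly_ring :: "'k::field itself \<Rightarrow> 'v set \<Rightarrow> (('v \<Rightarrow>\<^sub>0 nat) \<Rightarrow>\<^sub>0 'k) ring" where
  "poly_ring _ V =
    \<lparr>carrier = {p. \<forall>m\<in>Poly_Mapping.keys p. Poly_Mapping.keys m \<subseteq> V},
     mult = (*), one = 1, zero = 0, add = (+)\<rparr>"

definition face_monomial :: "'v set \<Rightarrow> (('v \<Rightarrow>\<^sub>0 nat) \<Rightarrow>\<^sub>0 'k::field)" where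
  "face_monomial F = Poly_Mapping.single (\<Sum>v\<in>F. Poly_Mapping.single v 1) 1"

definition stanley_reisner_ideal ::
    "'k::field itself \<Rightarrow> 'v set \<Rightarrow> 'v set set \<Rightarrow> (('v \<Rightarrow>\<^sub>0 nat) \<Rightarrow>\<^sub>0 'k) set" where
  "stanley_reisner_ideal K V \<Delta> =
     Idl\<^bsub>poly_ring K V\<^esub> (face_monomial ` {F. F \<subseteq> V \<and> F \<notin> \<Delta>})"

definition stanley_reisner_ring ::
    "'k::field itself \<Rightarrow> 'v set \<Rightarrow> 'v set set \<Rightarrow> (('v \<Rightarrow>\<^sub>0 nat) \<Rightarrow>\<^sub>0 'k) set ring" where
  "stanley_reisner_ring K V \<Delta> = poly_ring K V Quot stanley_reisner_ideal K V \<Delta>"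

lemma poly_ring_cring:
  fixes K :: "'k::field itself" and V :: "'v set"
  shows "cring (poly_ring K V)"
proof -
  define C :: "(('v \<Rightarrow>\<^sub>0 nat) \<Rightarrow>\<^sub>0 'k) set" where "C = carrier (poly_ring K V)"
  have C: "p \<in> C \<longleftrightarrow> (\<forall>m\<in>Poly_Mapping.keys p. Poly_Mapping.keys m \<subseteq> V)" for p
    by (simp add: C_def poly_ring_def)
  have zero: "0 \<in> C" and one: "1 \<in> C" by (auto simp: C)
  have add: "p + q \<in> C" if "p \<in> C" "q \<in> C" for p q
    using that Poly_Mapping.keys_add[of p q] unfolding C by blast
  have neg: "- p \<in> C" if "p \<in> C" for p
    using that unfolding C by (simp add: in_keys_iff)
  have times: "p * q \<in> C" if pq: "p \<in> C" "q \<in> C" for p q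
    unfolding C
  proof
    fix m assume "m \<in> Poly_Mapping.keys (p * q)"
    then obtain a b where ab: "m = a + b" "a \<in> Poly_Mapping.keys p" "b \<in> Poly_Mapping.keys q"
      using keys_mult[of p q] by blast
    then show "Poly_Mapping.keys m \<subseteq> V"
      using pq Poly_Mapping.keys_add[of a b] unfolding C by blast
  qed
  have eq: "poly_ring K V = \<lparr>carrier = C, mult = (*), one = 1, zero = 0, add = (+)\<rparr>"
    by (simp add: C_def poly_ring_def)
  show ?thesis
  proof (rule cringI)
    show "abelian_group (poly_ring K V)"
      unfolding eq
    proof (rule abelian_groupI, goal_cases)
      case (6 p)
      then show ?case by (intro bexI[of _ "- p"]) (simp_all add: neg)
    qed (simp_all add: add zero ac_simps)
    show "comm_monoid (poly_ring K V)"
      unfolding eq by (rule comm_monoidI) (simp_all add: times one ac_simps)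
  qed (simp add: eq distrib_right)
qed

lemma face_monomial_carrier:
  assumes "F \<subseteq> V"
  shows "face_monomial F \<in> carrier (poly_ring K V)"
proof -
  have "Poly_Mapping.keys (\<Sum>v\<in>F. Poly_Mapping.single v (1::nat)) \<subseteq> F"
  proof (induction F rule: infinite_finite_induct)
    case (insert x A)
    then show ?case
      using Poly_Mapping.keys_add[of "Poly_Mapping.single x (1::nat)"
          "\<Sum>v\<in>A. Poly_Mapping.single v 1"] by auto
  qed auto
  then show ?thesis using assms by (auto simp: poly_ring_def face_monomial_def)
qed

lemma stanley_reisner_ideal_ideal: "ideal (stanley_reisner_ideal K V \<Delta>) (poly_ring K V)"
proof -
  interpret cring "poly_ring K V" by (rule poly_ring_cring)
  show ?thesis unfolding stanley_reisner_ideal_def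
    by (rule genideal_ideal) (auto intro: face_monomial_carrier)
qed

lemma stanley_reisner_ring_cring: "cring (stanley_reisner_ring K V \<Delta>)"
  unfolding stanley_reisner_ring_def
  using ideal.quotient_is_cring[OF stanley_reisner_ideal_ideal poly_ring_cring] .

end

theory Submission
  imports Defs
begin

text \<open>Fix a prime \<open>p\<close> containing the ideal of the skeleton and remove from \<open>\<Delta>\<close>, one after the other,
  maximal faces \<open>F\<close> of dimension greater than \<open>i\<close>. Each removal gives an exact sequence
  \<open>0 \<rightarrow> K[F] \<rightarrow> K[\<Delta>] \<rightarrow> K[\<Delta> - F] \<rightarrow> 0\<close>, whose first map is multiplication by the monomial of \<open>F\<close>. After
  localization at \<open>p\<close> either the first term vanishes or its depth exceeds the dimension of the localized
  skeleton ring, because every face of the skeleton has fewer vertices than \<open>F\<close>. The depth lemma thus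
  gives \<open>depth K[\<Delta>']\<^sub>p \<ge> min (depth K[\<Delta>]\<^sub>p) (dim K[\<Delta>']\<^sub>p)\<close> for the skeleton \<open>\<Delta>'\<close>, and this suffices
  since \<open>j \<ge> 0\<close> and \<open>dim K[\<Delta>']\<^sub>p \<le> dim K[\<Delta>]\<^sub>p\<close>.

  The comparison of depth and dimension goes through the transcendence degree \<open>t\<close> of the residue field at
  \<open>p\<close>: the localization of \<open>K[F]\<close> has a regular sequence of length \<open>|F| - t\<close>, and a chain of \<open>n + 1\<close>
  primes above the ideal of the skeleton satisfies \<open>n \<le> |G| - t\<close> for some face \<open>G\<close>.\<close>


section \<open>Ideals of a commutative ring and prime avoidance\<close>

text \<open>No dimension theory enters, because only one inequality is needed on each side: a lower
  bound for the depth of K[F] at \<open>p\<close> and an upper bound for chains of primes. Both are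
  measured against the same set \<open>T\<close> of variables, maximal among those independent
  modulo \<open>p\<close>: the first by one algebraic equation for each vertex in F - T, the second
  by counting linearly independent products. The depth lemma is proved without homological algebra.
  The obstacle is that grade is defined by the existence of some sequence, whereas the modules of an
  exact sequence must be divided by a common element. Prime avoidance supplies such an element as
  soon as p kills no nonzero element of any of the modules, and whether this holds for M / xM does
  not depend on the choice of the M-regular element x in p. The depth lemma asks one more of the
  first term than of the conclusion; this is the one vertex, at least, by which F exceeds every face
  of the skeleton.\<close>

definition is_ideal :: "'a::comm_ring_1 set \<Rightarrow> bool" where
  "is_ideal I \<longleftrightarrow> 0 \<in> I \<and> (\<forall>a\<in>I. \<forall>b\<in>I. a + b \<in> I) \<and> (\<forall>a\<in>I. \<forall>r. r * a \<in> I)"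

definition is_prime :: "'a::comm_ring_1 set \<Rightarrow> bool" where
  "is_prime P \<longleftrightarrow> is_ideal P \<and> 1 \<notin> P \<and> (\<forall>a b. a * b \<in> P \<longrightarrow> a \<in> P \<or> b \<in> P)"

text \<open>For ideals the modular law gives I \<inter> (J + x I) = (I \<inter> J) + x I, so
  replacing the pair \<open>(I, J)\<close> by \<open>(I, adjoin J x I)\<close> divides the module I
  / (I \<inter> J) by x. With \<open>I = UNIV\<close> it adds the generator x to J.\<close>

definition adjoin :: "'a::comm_ring_1 set \<Rightarrow> 'a \<Rightarrow> 'a set \<Rightarrow> 'a set" where
  "adjoin J x I = {j + x * i | j i. j \<in> J \<and> i \<in> I}"

text \<open>The type of variables may be infinite, and then the full polynomial ring is not
  Noetherian. Chains are therefore required to stop only above a fixed \<open>J0\<close>, later the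
  ideal that contains every variable outside a finite vertex set.\<close>

definition noetherian_above :: "'a::comm_ring_1 set \<Rightarrow> bool" where
  "noetherian_above J0 \<longleftrightarrow> (\<forall>I :: nat \<Rightarrow> 'a set.
     (\<forall>n. is_ideal (I n) \<and> J0 \<subseteq> I n \<and> I n \<subseteq> I (Suc n)) \<longrightarrow> (\<exists>n. \<forall>m\<ge>n. I m = I n))"

lemma is_ideal_zero: "is_ideal I \<Longrightarrow> 0 \<in> I"
  and is_ideal_add: "is_ideal I \<Longrightarrow> a \<in> I \<Longrightarrow> b \<in> I \<Longrightarrow> a + b \<in> I"
  and is_ideal_mult: "is_ideal I \<Longrightarrow> a \<in> I \<Longrightarrow> r * a \<in> I"
  by (auto simp: is_ideal_def)

lemma is_ideal_mult2: "is_ideal I \<Longrightarrow> a \<in> I \<Longrightarrow> a * r \<in> I"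
  using is_ideal_mult[of I a r] by (simp add: mult.commute)

lemma is_ideal_uminus: "is_ideal I \<Longrightarrow> a \<in> I \<Longrightarrow> - a \<in> I"
  using is_ideal_mult[of I a "-1"] by simp

lemma is_ideal_diff: "is_ideal I \<Longrightarrow> a \<in> I \<Longrightarrow> b \<in> I \<Longrightarrow> a - b \<in> I"
  using is_ideal_add[of I a "- b"] is_ideal_uminus[of I b] by simp

lemma is_ideal_sum: "is_ideal I \<Longrightarrow> (\<And>a. a \<in> A \<Longrightarrow> f a \<in> I) \<Longrightarrow> sum f A \<in> I"
  by (induction A rule: infinite_finite_induct) (auto intro: is_ideal_zero is_ideal_add)

lemma is_ideal_lincomb: "is_ideal I \<Longrightarrow> a \<in> I \<Longrightarrow> b \<in> I \<Longrightarrow> r * a + s * b \<in> I"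
  and is_ideal_lincomb_diff: "is_ideal I \<Longrightarrow> a \<in> I \<Longrightarrow> b \<in> I \<Longrightarrow> r * a - s * b \<in> I"
  by (simp_all add: is_ideal_add is_ideal_diff is_ideal_mult)

lemmas is_ideal_intros = is_ideal_zero is_ideal_add is_ideal_mult is_ideal_mult2 is_ideal_diff
  is_ideal_uminus

lemma is_ideal_UNIV: "is_ideal UNIV" by (simp add: is_ideal_def)

lemma is_ideal_adjoin:
  assumes "is_ideal J" "is_ideal I"
  shows "is_ideal (adjoin J x I)"
  unfolding is_ideal_def
proof (intro conjI ballI allI)
  show "0 \<in> adjoin J x I" using assms is_ideal_zero unfolding adjoin_def by force
next
  fix a b assume "a \<in> adjoin J x I" "b \<in> adjoin J x I"
  then obtain j i j' i' where *: "a = j + x * i" "b = j' + x * i'" "j \<in> J" "i \<in> I" "j' \<in> J" "i' \<in> I"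
    unfolding adjoin_def by blast
  then have "a + b = (j + j') + x * (i + i')" by (simp add: algebra_simps)
  then show "a + b \<in> adjoin J x I" unfolding adjoin_def using * assms is_ideal_add by blast
next
  fix a r assume "a \<in> adjoin J x I"
  then obtain j i where *: "a = j + x * i" "j \<in> J" "i \<in> I" unfolding adjoin_def by blast
  then have "r * a = r * j + x * (r * i)" by (simp add: algebra_simps)
  then show "r * a \<in> adjoin J x I" unfolding adjoin_def using * assms is_ideal_mult by blast
qed

lemma adjoin_superset: "is_ideal I \<Longrightarrow> J \<subseteq> adjoin J x I"
  unfolding adjoin_def using is_ideal_zero by force

lemma adjoin_memI: "is_ideal J \<Longrightarrow> a - x * i \<in> J \<Longrightarrow> i \<in> I \<Longrightarrow> a \<in> adjoin J x I"
  unfolding adjoin_def by (smt (verit, best) diff_add_cancel mem_Collect_eq)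

lemma adjoin_commute: "adjoin (adjoin J x I) y I = adjoin (adjoin J y I) x I"
  unfolding adjoin_def by (auto simp: add.assoc) (metis add.assoc add.commute)+

lemma noetherian_above_wf:
  assumes "noetherian_above J0"
  shows "wf {(I', I). is_ideal I \<and> is_ideal I' \<and> J0 \<subseteq> I \<and> I \<subset> I'}"
  unfolding wf_iff_no_infinite_down_chain
proof
  assume "\<exists>f. \<forall>i. (f (Suc i), f i) \<in> {(I', I). is_ideal I \<and> is_ideal I' \<and> J0 \<subseteq> I \<and> I \<subset> I'}"
  then obtain f where *: "\<forall>i. is_ideal (f i) \<and> is_ideal (f (Suc i)) \<and> J0 \<subseteq> f i \<and> f i \<subset> f (Suc i)"
    by auto
  have "\<forall>n. is_ideal (f n) \<and> J0 \<subseteq> f n \<and> f n \<subseteq> f (Suc n)" using * by blast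
  then obtain n where n: "\<forall>m\<ge>n. f m = f n" using assms unfolding noetherian_above_def by blast
  from n[rule_format, of "Suc n"] have "f (Suc n) = f n" by simp
  then show False using * by blast
qed

lemma noetherian_above_maximal:
  assumes "noetherian_above J0" "X \<in> \<A>" "\<And>I. I \<in> \<A> \<Longrightarrow> is_ideal I \<and> J0 \<subseteq> I"
  obtains M where "M \<in> \<A>" "X \<subseteq> M" "\<And>I. I \<in> \<A> \<Longrightarrow> M \<subseteq> I \<Longrightarrow> I = M"
proof -
  have "X \<in> {I \<in> \<A>. X \<subseteq> I}" using assms by auto
  from wfE_min[OF noetherian_above_wf[OF assms(1)] this] obtain M where
    M: "M \<in> {I \<in> \<A>. X \<subseteq> I}" "\<And>Y. (Y, M) \<in> {(I', I). is_ideal I \<and> is_ideal I' \<and> J0 \<subseteq> I \<and> I \<subset> I'}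
      \<Longrightarrow> Y \<notin> {I \<in> \<A>. X \<subseteq> I}" by blast
  have "I = M" if "I \<in> \<A>" "M \<subseteq> I" for I
    using M(2)[of I] M(1) assms(3) that by auto
  then show ?thesis using that M(1) by blast
qed

lemma prime_avoidance:
  fixes I :: "'a::comm_ring_1 set"
  assumes "finite \<P>" "is_ideal I" "\<And>P. P \<in> \<P> \<Longrightarrow> is_prime P \<and> \<not> I \<subseteq> P"
  shows "\<exists>z\<in>I. \<forall>P\<in>\<P>. z \<notin> P"
  using assms(1,3)
proof (induction \<P> rule: finite_psubset_induct)
  case (psubset \<P>)
  show ?case
  proof (cases "\<P> = {}")
    case True
    then show ?thesis using is_ideal_zero[OF assms(2)] by auto
  next
    case False
    have "\<exists>z\<in>I. \<forall>Q\<in>\<P> - {P}. z \<notin> Q" if "P \<in> \<P>" for P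
      using psubset.IH[of "\<P> - {P}"] psubset.prems that by blast
    then obtain f where f: "\<And>P. P \<in> \<P> \<Longrightarrow> f P \<in> I \<and> (\<forall>Q\<in>\<P> - {P}. f P \<notin> Q)" by metis
    show ?thesis
    proof (cases "\<exists>P\<in>\<P>. f P \<notin> P")
      case True
      then show ?thesis using f by blast
    next
      case all: False
      obtain P where P: "P \<in> \<P>" using False by blast
      have pr: "is_prime Q" if "Q \<in> \<P>" for Q using psubset.prems that by blast
      have prodn: "prod f A \<notin> Q" if "A \<subseteq> \<P> - {Q}" "Q \<in> \<P>" for A Q
        using finite_subset[OF that(1)] psubset.hyps that
      proof (induction A rule: infinite_finite_induct)
        case empty then show ?case using pr by (simp add: is_prime_def)
      next
        case (insert x A)
        then show ?case using f[of x] pr[of Q] unfolding is_prime_def by auto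
      qed auto
      \<comment> \<open>If each \<open>f P\<close> lies in its own prime P, then
        \<open>f P + g\<close> avoids all of them: modulo P the first summand vanishes and
        \<open>g\<close> does not, modulo any other prime it is the reverse.\<close>
      define g where "g = prod f (\<P> - {P})"
      have prodi: "prod f A \<in> Q" if "finite A" "Q \<in> A" "Q \<in> \<P>" for A Q
        using that all pr[OF that(3)] is_ideal_mult2[of Q "f Q"] unfolding is_prime_def
        by (auto simp: prod.remove[OF that(1,2)])
      have a: "g \<notin> P" unfolding g_def using prodn P by blast
      have b: "g \<in> Q" if "Q \<in> \<P> - {P}" for Q
        unfolding g_def using prodi[of "\<P> - {P}" Q] that psubset.hyps by blast
      show ?thesis
      \<comment> \<open>For a single prime, \<open>g\<close> is the empty product 1, which need not
        lie in \<open>I\<close>.\<close>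
      proof (cases "\<P> = {P}")
        case True
        then show ?thesis using psubset.prems by blast
      next
        case ne: False
        then obtain Q where Q: "Q \<in> \<P> - {P}" using P by blast
        have gI: "g \<in> I" unfolding g_def using f Q psubset.hyps is_ideal_mult2[OF assms(2)]
          by (subst prod.remove[of _ Q]) auto
        have "f P + g \<notin> R" if R: "R \<in> \<P>" for R
        proof
          assume s: "f P + g \<in> R"
          have I: "is_ideal R" using pr[OF R] by (simp add: is_prime_def)
          show False
          proof (cases "R = P")
            case True
            have "f P \<in> P" using all P by blast
            then show False using is_ideal_diff[OF I s, of "f P"] a True by simp
          next
            case False
            then show False using is_ideal_diff[OF I s, of g] b R f P by auto
          qed
        qed
        then show ?thesis using is_ideal_add[OF assms(2)] f P gI by blast
      qed
    qed
  qed
qed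

section \<open>Grade of localized modules and the depth lemma\<close>

locale prime_ideal_at =
  fixes p :: "'a::comm_ring_1 set"
  assumes prime: "is_prime p"
begin

lemma ideal_p: "is_ideal p" and one_p: "1 \<notin> p" and mult_p: "a \<notin> p \<Longrightarrow> b \<notin> p \<Longrightarrow> a * b \<notin> p"
  using prime by (auto simp: is_prime_def)

text \<open>\<open>sat J\<close> is the contraction of the localization of \<open>J\<close> at \<open>p\<close>. In this locale a pair of ideals
  \<open>(I, J)\<close> stands for the localized module \<open>(I / (I \<inter> J))\<^sub>p\<close>, and \<open>grade_ge r I J\<close> says that this module
  has a (weakly) regular sequence of length \<open>r\<close> in \<open>p\<close>. The zero module has every grade.\<close>

definition sat :: "'a set \<Rightarrow> 'a set" where
  "sat J = {a. \<exists>u. u \<notin> p \<and> u * a \<in> J}"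

lemma sat_superset: "J \<subseteq> sat J"
  unfolding sat_def using one_p by force

lemma sat_mono: "J \<subseteq> J' \<Longrightarrow> sat J \<subseteq> sat J'"
  unfolding sat_def by blast

lemma satD: "u * a \<in> sat J \<Longrightarrow> u \<notin> p \<Longrightarrow> a \<in> sat J"
  unfolding sat_def using mult_p by (fastforce simp: mult.assoc[symmetric])

lemma is_ideal_sat: assumes "is_ideal J" shows "is_ideal (sat J)"
  unfolding is_ideal_def
proof (intro conjI ballI allI)
  show "0 \<in> sat J" using sat_superset is_ideal_zero[OF assms] by blast
next
  fix a b assume "a \<in> sat J" "b \<in> sat J"
  then obtain u v where *: "u \<notin> p" "v \<notin> p" "u * a \<in> J" "v * b \<in> J" unfolding sat_def by blast
  have "(u * v) * (a + b) = v * (u * a) + u * (v * b)" by (simp add: algebra_simps)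
  also have "\<dots> \<in> J" using * assms by (intro is_ideal_lincomb)
  finally show "a + b \<in> sat J" unfolding sat_def using * mult_p by blast
next
  fix a r assume "a \<in> sat J"
  then obtain u where *: "u \<notin> p" "u * a \<in> J" unfolding sat_def by blast
  have "u * (r * a) = r * (u * a)" by (simp add: algebra_simps)
  also have "\<dots> \<in> J" by (rule is_ideal_mult[OF assms *(2)])
  finally show "r * a \<in> sat J" unfolding sat_def using * by blast
qed

lemma sat_adjoinE:
  assumes "a \<in> sat (adjoin J x I)" "is_ideal J"
  obtains u i where "u \<notin> p" "i \<in> I" "u * a - x * i \<in> J"
proof -
  obtain u j i where "u \<notin> p" "u * a = j + x * i" "j \<in> J" "i \<in> I"
    using assms unfolding sat_def adjoin_def by blast
  then show thesis using that[of u i] by simp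
qed

lemma sat_adjoinI:
  assumes "u * a - x * i \<in> sat J" "u \<notin> p" "i \<in> I" "is_ideal J" "is_ideal I"
  shows "a \<in> sat (adjoin J x I)"
proof -
  obtain v where v: "v \<notin> p" "v * (u * a - x * i) \<in> J" using assms(1) unfolding sat_def by blast
  then have "(v * u) * a - x * (v * i) \<in> J" by (simp add: algebra_simps)
  moreover have "v * i \<in> I" using assms by (auto intro: is_ideal_intros)
  ultimately have "(v * u) * a \<in> adjoin J x I" by (rule adjoin_memI[OF assms(4)])
  then show ?thesis unfolding sat_def using v assms(2) mult_p by blast
qed

definition regular_on :: "'a \<Rightarrow> 'a set \<Rightarrow> 'a set \<Rightarrow> bool" where
  "regular_on x I J \<longleftrightarrow> (\<forall>a\<in>I. x * a \<in> sat J \<longrightarrow> a \<in> sat J)"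

primrec grade_ge :: "nat \<Rightarrow> 'a set \<Rightarrow> 'a set \<Rightarrow> bool" where
  "grade_ge 0 I J = True"
| "grade_ge (Suc r) I J = (\<exists>x\<in>p. regular_on x I J \<and> grade_ge r I (adjoin J x I))"

text \<open>This is Hom(k(p), M) = 0 for the localized module M. Unlike regularity of a particular
  element, it can be carried over from M / yM to M / xM.\<close>

definition socle_free :: "'a set \<Rightarrow> 'a set \<Rightarrow> bool" where
  "socle_free I J \<longleftrightarrow> (\<forall>a\<in>I. (\<forall>c\<in>p. c * a \<in> sat J) \<longrightarrow> a \<in> sat J)"

lemma grade_ge_mono: "grade_ge r I J \<Longrightarrow> s \<le> r \<Longrightarrow> grade_ge s I J"
proof (induction r arbitrary: s J)
  case (Suc r)
  then show ?case by (cases s) auto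
qed simp

lemma grade_ge_socle_free: "grade_ge (Suc r) I J \<Longrightarrow> socle_free I J"
  by (auto simp: socle_free_def regular_on_def)

lemma regular_on_socle_free: "regular_on x I J \<Longrightarrow> x \<in> p \<Longrightarrow> socle_free I J"
  by (auto simp: socle_free_def regular_on_def)

text \<open>Multiplication by \<open>c\<close> is an isomorphism between the localized modules of \<open>(I, J)\<close> and \<open>(I', J')\<close>.\<close>

lemma grade_ge_iso:
  assumes "grade_ge r I J" "is_ideal I" "is_ideal J" "is_ideal I'" "is_ideal J'"
    and "\<And>a. a \<in> I \<Longrightarrow> c * a \<in> sat J' \<Longrightarrow> a \<in> sat J"
    and "\<And>a. a \<in> J \<Longrightarrow> c * a \<in> sat J'"
    and "\<And>b. b \<in> I' \<Longrightarrow> \<exists>u a. u \<notin> p \<and> a \<in> I \<and> u * b - c * a \<in> sat J'"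
    and "\<And>a. a \<in> I \<Longrightarrow> c * a \<in> I'"
  shows "grade_ge r I' J'"
  using assms(1,3,5-8)
proof (induction r arbitrary: J J')
  case (Suc r)
  note inj = Suc.prems(4) and map = Suc.prems(5) and surj = Suc.prems(6)
  note idl = Suc.prems(2,3) assms(2,4)
  obtain x where x: "x \<in> p" "regular_on x I J" "grade_ge r I (adjoin J x I)" using Suc.prems(1) by auto
  have satmap: "c * a \<in> sat J'" if "a \<in> sat J" for a
  proof -
    from that obtain u where u: "u \<notin> p" "u * a \<in> J" unfolding sat_def by blast
    have "u * (c * a) \<in> sat J'" using map[OF u(2)] by (simp add: algebra_simps)
    then show ?thesis using u(1) by (rule satD)
  qed
  note si = is_ideal_sat[OF idl(2)] is_ideal_sat[OF idl(1)]
  have "regular_on x I' J'"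
    unfolding regular_on_def
  proof (intro ballI impI)
    fix b assume b: "b \<in> I'" "x * b \<in> sat J'"
    obtain u a where u: "u \<notin> p" "a \<in> I" "u * b - c * a \<in> sat J'" using surj[OF b(1)] by blast
    have "c * (x * a) = u * (x * b) - x * (u * b - c * a)" by (simp add: algebra_simps)
    also have "\<dots> \<in> sat J'" by (rule is_ideal_lincomb_diff[OF si(1) b(2) u(3)])
    finally have "x * a \<in> sat J" using inj u idl by (auto intro: is_ideal_intros)
    then have "a \<in> sat J" using x(2) u by (auto simp: regular_on_def)
    then have "c * a \<in> sat J'" by (rule satmap)
    then have "(u * b - c * a) + c * a \<in> sat J'" by (rule is_ideal_add[OF si(1) u(3)])
    then show "b \<in> sat J'" using u(1) by (auto intro: satD)
  qed
  moreover have "grade_ge r I' (adjoin J' x I')"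
  proof (rule Suc.IH[OF x(3)])
    show "is_ideal (adjoin J x I)" "is_ideal (adjoin J' x I')" using idl by (auto intro: is_ideal_adjoin)
  next
    fix a assume a: "a \<in> I" "c * a \<in> sat (adjoin J' x I')"
    obtain u b where u: "u \<notin> p" "b \<in> I'" "u * (c * a) - x * b \<in> J'" using sat_adjoinE[OF a(2) idl(2)] .
    obtain v d where v: "v \<notin> p" "d \<in> I" "v * b - c * d \<in> sat J'" using surj[OF u(2)] by blast
    have "c * ((v * u) * a - x * d) = v * (u * (c * a) - x * b) + x * (v * b - c * d)"
      by (simp add: algebra_simps)
    also have "\<dots> \<in> sat J'"
      by (rule is_ideal_lincomb[OF si(1) subsetD[OF sat_superset u(3)] v(3)])
    finally have "(v * u) * a - x * d \<in> sat J"
      by (rule inj[OF is_ideal_lincomb_diff[OF idl(3) a(1) v(2)]])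
    then show "a \<in> sat (adjoin J x I)" using v u idl mult_p by (blast intro: sat_adjoinI)
  next
    fix a assume "a \<in> adjoin J x I"
    then obtain j i where *: "a = j + x * i" "j \<in> J" "i \<in> I" unfolding adjoin_def by blast
    have "1 * (c * a) - x * (c * i) = c * j" by (simp add: * algebra_simps)
    then show "c * a \<in> sat (adjoin J' x I')" using map[OF *(2)] assms(9)[OF *(3)] idl one_p
      by (intro sat_adjoinI[of 1 "c * a" x "c * i"]) auto
  next
    fix b assume "b \<in> I'"
    from surj[OF this] show "\<exists>u a. u \<notin> p \<and> a \<in> I \<and> u * b - c * a \<in> sat (adjoin J' x I')"
      using sat_mono[OF adjoin_superset[OF idl(4), of J' x]] by blast
  qed
  ultimately show ?case using x(1) by auto
qed simp

text \<open>The primes are the maximal annihilators. If there were infinitely many, then by the chain condition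
  some generator \<open>a n\<close> would be a combination of earlier ones, so that the annihilator of \<open>a n\<close> would
  contain the product of the earlier annihilators, hence one of them.\<close>

lemma finite_zero_divisor_primes:
  assumes "noetherian_above J0" "is_ideal I" "is_ideal J" "J0 \<subseteq> J"
  shows "\<exists>\<P>. finite \<P> \<and> (\<forall>P\<in>\<P>. is_prime P \<and> (\<exists>a\<in>I. a \<notin> sat J \<and> P = {f. f * a \<in> sat J})) \<and>
     (\<forall>z. z \<notin> \<Union>\<P> \<longrightarrow> regular_on z I J)"
proof -
  define An where "An a = {f. f * a \<in> sat J}" for a
  define \<A> where "\<A> = An ` {a \<in> I. a \<notin> sat J}"
  define \<P> where "\<P> = {P \<in> \<A>. \<forall>Q\<in>\<A>. P \<subseteq> Q \<longrightarrow> Q = P}"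
  note sJ = is_ideal_sat[OF assms(3)]
  have An_ideal: "is_ideal (An a) \<and> J0 \<subseteq> An a" for a
    unfolding is_ideal_def An_def using sJ sat_superset assms(4)
    by (auto simp: distrib_right mult.assoc intro: is_ideal_intros)
  have below: "\<exists>P\<in>\<P>. X \<subseteq> P" if "X \<in> \<A>" for X
  proof -
    have \<A>: "is_ideal I \<and> J0 \<subseteq> I" if "I \<in> \<A>" for I using that An_ideal unfolding \<A>_def by auto
    show ?thesis
    proof (rule noetherian_above_maximal[OF assms(1) \<open>X \<in> \<A>\<close> \<A>])
      fix M assume "M \<in> \<A>" "X \<subseteq> M" "\<And>I. I \<in> \<A> \<Longrightarrow> M \<subseteq> I \<Longrightarrow> I = M"
      then show ?thesis unfolding \<P>_def by auto
    qed
  qed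
  have prm: "is_prime P" if "P \<in> \<P>" for P
    unfolding is_prime_def
  proof (intro conjI allI impI)
    from that obtain a where a: "a \<in> I" "a \<notin> sat J" "P = An a" unfolding \<P>_def \<A>_def by auto
    show "is_ideal P" using a An_ideal by blast
    show "1 \<notin> P" using a by (auto simp: An_def)
    fix f g assume fg: "f * g \<in> P"
    show "f \<in> P \<or> g \<in> P"
    proof (rule disjCI)
      assume "g \<notin> P"
      then have "g * a \<notin> sat J" "g * a \<in> I" using a assms(2) by (auto simp: An_def intro: is_ideal_intros)
      \<comment> \<open>By maximality \<open>An a\<close> equals the annihilator of
        \<open>g * a\<close>, which contains f.\<close>
      then have "An (g * a) \<in> \<A>" unfolding \<A>_def by blast
      moreover have "An a \<subseteq> An (g * a)"
        unfolding An_def using is_ideal_mult[OF sJ, of _ g] by (auto simp: mult.left_commute[of _ g])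
      ultimately have "An (g * a) = P" using that a unfolding \<P>_def by blast
      then show "f \<in> P" using fg a by (auto simp: An_def mult.assoc)
    qed
  qed
  have reg: "regular_on z I J" if "z \<notin> \<Union>\<P>" for z
    unfolding regular_on_def
  proof (intro ballI impI, rule ccontr)
    fix a assume a: "a \<in> I" "z * a \<in> sat J" "a \<notin> sat J"
    then have "An a \<in> \<A>" "z \<in> An a" unfolding \<A>_def An_def by auto
    then show False using below that by blast
  qed
  have "finite \<P>"
  proof (rule ccontr)
    assume "infinite \<P>"
    then obtain h :: "nat \<Rightarrow> 'a set" where h: "inj h" "range h \<subseteq> \<P>"
      using infinite_countable_subset by blast
    have "\<exists>a. a \<in> I \<and> a \<notin> sat J \<and> h k = An a" for k using h(2) unfolding \<P>_def \<A>_def by blast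
    then obtain a where a: "\<And>k. a k \<in> I \<and> a k \<notin> sat J \<and> h k = An (a k)" by metis
    define S where "S n = rec_nat J (\<lambda>k X. adjoin X (a k) UNIV) n" for n
    have S0: "S 0 = J" and SS: "S (Suc n) = adjoin (S n) (a n) UNIV" for n by (auto simp: S_def)
    have Sid: "is_ideal (S n) \<and> J \<subseteq> S n" for n
      by (induction n) (use assms(3) SS S0 is_ideal_adjoin[OF _ is_ideal_UNIV]
          adjoin_superset[OF is_ideal_UNIV] in \<open>auto, blast\<close>)
    have "\<forall>n. is_ideal (S n) \<and> J0 \<subseteq> S n \<and> S n \<subseteq> S (Suc n)"
      using Sid assms(4) SS adjoin_superset[OF is_ideal_UNIV] by blast
    then obtain n where n: "\<forall>m\<ge>n. S m = S n"
      using assms(1) unfolding noetherian_above_def by blast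
    have "a n \<in> S (Suc n)" unfolding SS
      by (rule adjoin_memI[of _ _ _ 1]) (use Sid is_ideal_zero in auto)
    then have an: "a n \<in> S n" using n[rule_format, of "Suc n"] by simp
    have S_An: "f * b \<in> sat J" if "b \<in> S m" "\<And>k. k < m \<Longrightarrow> f \<in> An (a k)" for m b f
      using that
    proof (induction m arbitrary: b)
      case 0
      then show ?case using S0 sat_superset sJ by (auto intro: is_ideal_intros)
    next
      case (Suc m)
      then obtain j i where j: "b = j + a m * i" "j \<in> S m" unfolding SS adjoin_def by blast
      have "f * b = f * j + i * (f * a m)" by (simp add: j algebra_simps)
      moreover have "f * a m \<in> sat J" using Suc.prems(2)[of m] by (simp add: An_def)
      ultimately show ?case using Suc.IH[OF j(2)] Suc.prems sJ by (auto intro: is_ideal_intros)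
    qed
    have "\<exists>k<n. h k \<subseteq> h n"
    proof (rule ccontr)
      assume "\<not> ?thesis"
      then have "\<forall>k<n. \<exists>f. f \<in> h k \<and> f \<notin> h n" by blast
      then obtain f where f: "\<And>k. k < n \<Longrightarrow> f k \<in> h k \<and> f k \<notin> h n" by metis
      have hn: "is_prime (h n)" using prm h(2) by blast
      have "prod f A \<notin> h n" if "A \<subseteq> {..<n}" for A
        using finite_subset[OF that] that
        by (induction A rule: infinite_finite_induct)
          (use f hn in \<open>auto simp: is_prime_def\<close>)
      then have no: "prod f {..<n} \<notin> h n" by blast
      have "prod f {..<n} \<in> An (a k)" if "k < n" for k
        using that f[OF that] a An_ideal is_ideal_mult2[of "An (a k)" "f k"]
        by (subst prod.remove[of _ k]) auto
      then have "prod f {..<n} * a n \<in> sat J" using S_An[OF an] by blast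
      then show False using no a by (simp add: An_def)
    qed
    then obtain k where k: "k < n" "h k \<subseteq> h n" by blast
    moreover have "h k \<in> \<P>" "h n \<in> \<P>" using h by auto
    ultimately have "h n = h k" unfolding \<P>_def by blast
    then show False using h(1) k by (auto dest: injD)
  qed
  moreover have "\<exists>a\<in>I. a \<notin> sat J \<and> P = {f. f * a \<in> sat J}" if "P \<in> \<P>" for P
    using that unfolding \<P>_def \<A>_def An_def by blast
  ultimately show ?thesis using prm reg by blast
qed

text \<open>Every prime that \<open>finite_zero_divisor_primes\<close> attaches to a pair is the
  annihilator of a nonzero class, so \<open>socle_free\<close> keeps it from containing p. Prime
  avoidance over the finite union of these families then serves all pairs with one z.\<close>

lemma common_regular_element:
  assumes "noetherian_above J0" "finite M"
    and "\<And>I J. (I, J) \<in> M \<Longrightarrow> is_ideal I \<and> is_ideal J \<and> J0 \<subseteq> J \<and> socle_free I J"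
  shows "\<exists>z\<in>p. \<forall>(I, J)\<in>M. regular_on z I J"
proof -
  have "\<exists>\<P>. finite \<P> \<and> (\<forall>P\<in>\<P>. is_prime P \<and> \<not> p \<subseteq> P) \<and> (\<forall>z. z \<notin> \<Union>\<P> \<longrightarrow> regular_on z I J)"
    if m: "(I, J) \<in> M" for I J
  proof -
    have c: "is_ideal I" "is_ideal J" "J0 \<subseteq> J" "socle_free I J" using assms(3)[OF m] by auto
    from finite_zero_divisor_primes[OF assms(1) c(1-3)] obtain \<P> where P: "finite \<P> \<and>
      (\<forall>P\<in>\<P>. is_prime P \<and> (\<exists>a\<in>I. a \<notin> sat J \<and> P = {f. f * a \<in> sat J})) \<and>
      (\<forall>z. z \<notin> \<Union>\<P> \<longrightarrow> regular_on z I J)" ..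
    have "\<not> p \<subseteq> P" if "P \<in> \<P>" for P
    proof -
      from P that obtain a where "a \<in> I" "a \<notin> sat J" "P = {f. f * a \<in> sat J}" by blast
      then show ?thesis using c(4) unfolding socle_free_def by blast
    qed
    then show ?thesis using P by (intro exI[of _ \<P>]) simp
  qed
  then have "\<forall>m\<in>M. \<exists>\<P>. finite \<P> \<and> (\<forall>P\<in>\<P>. is_prime P \<and> \<not> p \<subseteq> P) \<and>
      (\<forall>z. z \<notin> \<Union>\<P> \<longrightarrow> regular_on z (fst m) (snd m))"
    by (metis prod.collapse)
  then obtain F where F: "\<forall>m\<in>M. finite (F m) \<and> (\<forall>P\<in>F m. is_prime P \<and> \<not> p \<subseteq> P) \<and>
      (\<forall>z. z \<notin> \<Union>(F m) \<longrightarrow> regular_on z (fst m) (snd m))"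
    by (rule bchoice[THEN exE])
  have "\<exists>z\<in>p. \<forall>P\<in>\<Union>(F ` M). z \<notin> P"
  proof (rule prime_avoidance[OF _ ideal_p])
    show "finite (\<Union>(F ` M))" using F assms(2) by blast
    show "is_prime P \<and> \<not> p \<subseteq> P" if "P \<in> \<Union>(F ` M)" for P using F that by blast
  qed
  then show ?thesis using F by fastforce
qed

text \<open>For M the localized module, both Hom(k(p), M / xM) and Hom(k(p), M / yM) are Ext^1(k(p),
  M). In elements, up to units at p: if p kills a modulo x, write y a = x b; then p kills b modulo
  y, and b = y e gives a = x e.\<close>

lemma socle_free_exchange:
  assumes idl: "is_ideal I" "is_ideal J" and p: "x \<in> p" "y \<in> p"
    and reg: "regular_on x I J" "regular_on y I J" and sf: "socle_free I (adjoin J y I)"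
  shows "socle_free I (adjoin J x I)"
  unfolding socle_free_def
proof (intro ballI impI)
  fix a assume a: "a \<in> I" "\<forall>c\<in>p. c * a \<in> sat (adjoin J x I)"
  note sJ = is_ideal_sat[OF idl(2)]
  note J_sat = subsetD[OF sat_superset[of J]]
  have "y * a \<in> sat (adjoin J x I)" using a p by blast
  then obtain u b where u: "u \<notin> p" "b \<in> I" "u * (y * a) - x * b \<in> J" using idl by (auto elim: sat_adjoinE)
  have "c * b \<in> sat (adjoin J y I)" if c: "c \<in> p" for c
  proof -
    have "c * a \<in> sat (adjoin J x I)" using a c by blast
    then obtain v d where v: "v \<notin> p" "d \<in> I" "v * (c * a) - x * d \<in> J" using idl by (auto elim: sat_adjoinE)
    have "x * (v * (c * b) - y * (u * d))
        = (u * y) * (v * (c * a) - x * d) - (v * c) * (u * (y * a) - x * b)"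
      by (simp add: algebra_simps)
    also have "\<dots> \<in> sat J" by (rule is_ideal_lincomb_diff[OF sJ J_sat[OF v(3)] J_sat[OF u(3)]])
    finally have "v * (c * b) - y * (u * d) \<in> sat J"
      using reg(1) idl u v unfolding regular_on_def by (auto intro: is_ideal_intros)
    then show ?thesis using v u idl by (intro sat_adjoinI[of v _ y "u * d"]) (auto intro: is_ideal_intros)
  qed
  then have "b \<in> sat (adjoin J y I)" using sf u unfolding socle_free_def by blast
  then obtain w e where w: "w \<notin> p" "e \<in> I" "w * b - y * e \<in> J" using idl by (auto elim: sat_adjoinE)
  have "y * ((w * u) * a - x * e) = w * (u * (y * a) - x * b) + x * (w * b - y * e)"
    by (simp add: algebra_simps)
  also have "\<dots> \<in> sat J" by (rule is_ideal_lincomb[OF sJ J_sat[OF u(3)] J_sat[OF w(3)]])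
  finally have "(w * u) * a - x * e \<in> sat J"
    using reg(2) idl a w unfolding regular_on_def by (auto intro: is_ideal_intros)
  then show "a \<in> sat (adjoin J x I)" using mult_p[OF w(1) u(1)] w idl by (intro sat_adjoinI)
qed

text \<open>From x a = z b, regularity of z modulo x gives b = x d, and cancelling x leaves a = z
  d.\<close>

lemma regular_on_swap:
  assumes idl: "is_ideal I" "is_ideal J" and reg: "regular_on z I J" "regular_on z I (adjoin J x I)" "regular_on x I J"
  shows "regular_on x I (adjoin J z I)"
  unfolding regular_on_def
proof (intro ballI impI)
  fix a assume a: "a \<in> I" "x * a \<in> sat (adjoin J z I)"
  note sJ = is_ideal_sat[OF idl(2)]
  note J_sat = subsetD[OF sat_superset[of J]]
  obtain u b where u: "u \<notin> p" "b \<in> I" "u * (x * a) - z * b \<in> J" using a idl by (auto elim: sat_adjoinE)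
  have "- (z * b - x * (u * a)) \<in> J" using u by (simp add: algebra_simps)
  then have "1 * (z * b) - x * (u * a) \<in> sat J" using sJ is_ideal_uminus[OF sJ] J_sat by fastforce
  then have "z * b \<in> sat (adjoin J x I)"
    by (rule sat_adjoinI) (use one_p idl a in \<open>auto intro: is_ideal_intros\<close>)
  then have "b \<in> sat (adjoin J x I)" using reg(2) u by (auto simp: regular_on_def)
  then obtain v d where v: "v \<notin> p" "d \<in> I" "v * b - x * d \<in> J" using idl by (auto elim: sat_adjoinE)
  have "x * ((v * u) * a - z * d) = v * (u * (x * a) - z * b) + z * (v * b - x * d)"
    by (simp add: algebra_simps)
  also have "\<dots> \<in> sat J" by (rule is_ideal_lincomb[OF sJ J_sat[OF u(3)] J_sat[OF v(3)]])
  finally have "(v * u) * a - z * d \<in> sat J"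
    using reg(3) idl a v unfolding regular_on_def by (auto intro: is_ideal_intros)
  then show "a \<in> sat (adjoin J z I)" using mult_p[OF v(1) u(1)] v idl by (intro sat_adjoinI)
qed

text \<open>The grade drops by at most one modulo any regular element, not just modulo the first element of a
  given sequence: given \<open>x\<close> and \<open>y\<close>, pass through an element that is regular modulo both of them.\<close>

lemma grade_ge_exchange:
  assumes "noetherian_above J0" "is_ideal I"
  shows "is_ideal J \<Longrightarrow> J0 \<subseteq> J \<Longrightarrow> grade_ge (Suc r) I J \<Longrightarrow> x \<in> p \<Longrightarrow> regular_on x I J \<Longrightarrow> grade_ge r I (adjoin J x I)"
proof (induction r arbitrary: J x)
  case (Suc r)
  obtain y where y: "y \<in> p" "regular_on y I J" "grade_ge (Suc r) I (adjoin J y I)" using Suc.prems(3) by auto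
  note J = Suc.prems(1,2)
  have adjoinJ: "is_ideal (adjoin J t I) \<and> J0 \<subseteq> adjoin J t I" for t
    using is_ideal_adjoin[OF J(1) assms(2)] adjoin_superset[OF assms(2)] J(2) by blast
  have sfy: "socle_free I (adjoin J y I)" using y(3) by (rule grade_ge_socle_free)
  have sfx: "socle_free I (adjoin J x I)"
    by (rule socle_free_exchange[OF assms(2) J(1) Suc.prems(4) y(1) Suc.prems(5) y(2) sfy])
  have "\<exists>z\<in>p. \<forall>(I, J)\<in>{(I, J), (I, adjoin J x I), (I, adjoin J y I)}. regular_on z I J"
    using sfx sfy J adjoinJ assms(2) regular_on_socle_free[OF y(2,1)]
    by (intro common_regular_element[OF assms(1)]) auto
  then obtain z where z: "z \<in> p" "regular_on z I J" "regular_on z I (adjoin J x I)" "regular_on z I (adjoin J y I)" by auto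
  \<comment> \<open>The induction hypothesis takes M / yM to M / (y, z)M. Since y is regular on M /
    zM, this gives M / zM grade \<open>Suc r\<close>. The same detour leads from M / zM through M /
    (x, z)M to M / xM.\<close>
  have "grade_ge r I (adjoin (adjoin J y I) z I)" using Suc.IH[of "adjoin J y I" z] adjoinJ y z by blast
  then have "grade_ge (Suc r) I (adjoin J z I)"
    using regular_on_swap[OF assms(2) J(1) z(2,4) y(2)] y(1) adjoin_commute[of J y I z] by auto
  moreover have "regular_on x I (adjoin J z I)" by (rule regular_on_swap[OF assms(2) J(1) z(2,3) Suc.prems(5)])
  ultimately have "grade_ge r I (adjoin (adjoin J z I) x I)" using Suc.IH[of "adjoin J z I" x] adjoinJ Suc.prems by blast
  then show ?case using z adjoin_commute[of J x I z] by auto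
qed simp

text \<open>The depth lemma for \<open>0 \<rightarrow> I/J \<rightarrow> H/J \<rightarrow> H/I \<rightarrow> 0\<close>.\<close>

lemma grade_ge_quotient:
  assumes noeth: "noetherian_above J0" and idl: "is_ideal H"
  shows "is_ideal I \<Longrightarrow> is_ideal J \<Longrightarrow> J0 \<subseteq> J \<Longrightarrow> J \<subseteq> I \<Longrightarrow> I \<subseteq> H \<Longrightarrow> grade_ge r H J \<Longrightarrow> grade_ge (Suc r) I J
    \<Longrightarrow> grade_ge r H I"
proof (induction r arbitrary: I J)
  case (Suc r)
  note I = Suc.prems(1-5)
  obtain x where x: "x \<in> p" "regular_on x H J" using Suc.prems(6) by auto
  have xI: "regular_on x I J" using x(2) I(5) by (auto simp: regular_on_def)
  have "grade_ge (Suc r) I (adjoin J x I)"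
    by (rule grade_ge_exchange[OF noeth I(1) I(2,3) Suc.prems(7) x(1) xI])
  then have sf: "socle_free I (adjoin J x I)" by (rule grade_ge_socle_free)
  note sJ = is_ideal_sat[OF I(2)]
  \<comment> \<open>The extra 1 in the grade of I / J is used here. If p b lies in I, then so does x
    b, and p kills its class modulo x I. As I / J has grade at least 2, that class is zero: x b = x
    e modulo J with e in I. Since x is regular on H / J, b lies in I.\<close>
  have "socle_free H I"
    unfolding socle_free_def
  proof (intro ballI impI)
    fix b assume b: "b \<in> H" "\<forall>c\<in>p. c * b \<in> sat I"
    then obtain u where u: "u \<notin> p" "u * (x * b) \<in> I" using x(1) unfolding sat_def by blast
    have "c * (u * (x * b)) \<in> sat (adjoin J x I)" if c: "c \<in> p" for c
    proof -
      obtain v where v: "v \<notin> p" "v * (c * b) \<in> I" using b c unfolding sat_def by blast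
      have "v * (c * (u * (x * b))) - x * (u * (v * (c * b))) = 0" by (simp add: algebra_simps)
      then show ?thesis using v I sJ
        by (intro sat_adjoinI[of v _ x "u * (v * (c * b))"]) (auto intro: is_ideal_intros)
    qed
    then have "u * (x * b) \<in> sat (adjoin J x I)" using sf u unfolding socle_free_def by blast
    then obtain v e where v: "v \<notin> p" "e \<in> I" "v * (u * (x * b)) - x * e \<in> J" using I by (auto elim: sat_adjoinE)
    have "x * ((v * u) * b - e) \<in> J" using v by (simp add: algebra_simps)
    then have "(v * u) * b - e \<in> sat J" using x(2) sat_superset idl b v I(5)
      unfolding regular_on_def by (blast intro: is_ideal_intros)
    then have "(v * u) * b - e \<in> sat I" using sat_mono[OF I(4)] by blast
    then have "((v * u) * b - e) + e \<in> sat I" using v is_ideal_sat[OF I(1)] sat_superset[of I]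
      by (blast intro: is_ideal_intros)
    then show "b \<in> sat I" using mult_p[OF v(1) u(1)] by (auto intro: satD)
  qed
  then have "\<exists>z\<in>p. \<forall>(I, J)\<in>{(H, J), (H, I)}. regular_on z I J"
    using I idl regular_on_socle_free[OF x(2,1)] by (intro common_regular_element[OF noeth]) auto
  then obtain z where z: "z \<in> p" "regular_on z H J" "regular_on z H I" by auto
  have zI: "regular_on z I J" using z(2) I(5) by (auto simp: regular_on_def)
  have A: "grade_ge r H (adjoin J z H)" using grade_ge_exchange[OF noeth idl I(2,3) Suc.prems(6) z(1,2)] .
  have N: "grade_ge (Suc r) I (adjoin J z I)" using grade_ge_exchange[OF noeth I(1) I(2,3) Suc.prems(7) z(1) zI] .
  \<comment> \<open>Regularity of z on H / I keeps the sequence exact modulo z: if z h lies in I,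
    then so does h after localization, so I \<inter> (J + z H) becomes J + z I.\<close>
  have N': "grade_ge (Suc r) (adjoin I z H) (adjoin J z H)"
  proof (rule grade_ge_iso[OF N, of _ _ 1])
    show "is_ideal I" "is_ideal (adjoin J z I)" "is_ideal (adjoin I z H)" "is_ideal (adjoin J z H)"
      using I idl is_ideal_adjoin by auto
  next
    fix a assume a: "a \<in> I" "1 * a \<in> sat (adjoin J z H)"
    then obtain u h where u: "u \<notin> p" "h \<in> H" "u * a - z * h \<in> J" using I by (auto elim: sat_adjoinE)
    have "z * h = u * a - (u * a - z * h)" by simp
    also have "\<dots> \<in> I" using a u I by (blast intro: is_ideal_intros)
    finally have "h \<in> sat I" using z(3) u sat_superset by (auto simp: regular_on_def)
    then obtain v where v: "v \<notin> p" "v * h \<in> I" unfolding sat_def by blast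
    have "(v * u) * a - z * (v * h) = v * (u * a - z * h)" by (simp add: algebra_simps)
    also have "\<dots> \<in> sat J" using u sJ sat_superset by (blast intro: is_ideal_intros)
    finally show "a \<in> sat (adjoin J z I)" using mult_p[OF v(1) u(1)] v I by (intro sat_adjoinI)
  next
    fix a assume "a \<in> adjoin J z I"
    then show "1 * a \<in> sat (adjoin J z H)" using I(5) sat_superset[of "adjoin J z H"] unfolding adjoin_def by auto
  next
    fix b assume "b \<in> adjoin I z H"
    then obtain a h where a: "b = a + z * h" "a \<in> I" "h \<in> H" unfolding adjoin_def by blast
    have "1 * (1 * b - 1 * a) - z * h = 0" using a by simp
    then have "1 * b - 1 * a \<in> sat (adjoin J z H)" using one_p a(3) I(2) idl sJ
      by (intro sat_adjoinI[of 1 _ z h]) (auto intro: is_ideal_intros)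
    then show "\<exists>u a. u \<notin> p \<and> a \<in> I \<and> u * b - 1 * a \<in> sat (adjoin J z H)" using a one_p by blast
  next
    fix a assume "a \<in> I"
    then show "1 * a \<in> adjoin I z H" using adjoin_superset[OF idl, of I z] by auto
  qed
  have "grade_ge r H (adjoin I z H)"
  proof (rule Suc.IH[OF _ _ _ _ _ A N'])
    show "is_ideal (adjoin I z H)" "is_ideal (adjoin J z H)" using I idl by (simp_all add: is_ideal_adjoin)
    show "J0 \<subseteq> adjoin J z H" using I adjoin_superset[OF idl] by blast
    show "adjoin J z H \<subseteq> adjoin I z H" using I unfolding adjoin_def by blast
    show "adjoin I z H \<subseteq> H" using I idl unfolding adjoin_def by (auto intro: is_ideal_intros)
  qed
  then show ?case using z by auto
qed simp

end


section \<open>Localization\<close>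

lemma idealI_closed:
  assumes "cring R" "I \<subseteq> carrier R" "\<zero>\<^bsub>R\<^esub> \<in> I"
    and "\<And>a b. a \<in> I \<Longrightarrow> b \<in> I \<Longrightarrow> a \<oplus>\<^bsub>R\<^esub> b \<in> I"
    and "\<And>a x. a \<in> I \<Longrightarrow> x \<in> carrier R \<Longrightarrow> x \<otimes>\<^bsub>R\<^esub> a \<in> I"
  shows "ideal I R"
proof -
  interpret cring R by fact
  show ?thesis
  proof (rule idealI)
    show "ring R" by (rule ring_axioms)
    show "subgroup I (add_monoid R)"
    proof (rule add.subgroupI)
      show "I \<subseteq> carrier R" "I \<noteq> {}" using assms by auto
      show "\<ominus>\<^bsub>R\<^esub> a \<in> I" if "a \<in> I" for a
      proof -
        have "(\<ominus>\<^bsub>R\<^esub> \<one>\<^bsub>R\<^esub>) \<otimes>\<^bsub>R\<^esub> a \<in> I" using assms(5) that by simp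
        then show ?thesis using that assms(2) l_minus[of "\<one>\<^bsub>R\<^esub>" a] by auto
      qed
    qed (use assms(4) in auto)
    show "x \<otimes>\<^bsub>R\<^esub> a \<in> I" if "a \<in> I" "x \<in> carrier R" for a x using assms(5) that by blast
    then show "a \<otimes>\<^bsub>R\<^esub> x \<in> I" if "a \<in> I" "x \<in> carrier R" for a x
      using that assms(2) m_comm by (metis subsetD)
  qed
qed

text \<open>The recursion is unrolled into the indexed form that \<open>regular_sequence\<close>
  has.\<close>

lemma (in prime_ideal_at) grade_ge_iff_regular_list:
  "grade_ge r I J \<longleftrightarrow> (\<exists>fs. length fs = r \<and> set fs \<subseteq> p \<and>
     (\<forall>k<r. regular_on (fs ! k) I (foldl (\<lambda>J f. adjoin J f I) J (take k fs))))"
proof (induction r arbitrary: J)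
  case (Suc r)
  show ?case
  proof
    assume "grade_ge (Suc r) I J"
    then obtain x fs where x: "x \<in> p" "regular_on x I J" "length fs = r" "set fs \<subseteq> p"
      "\<forall>k<r. regular_on (fs ! k) I (foldl (\<lambda>J f. adjoin J f I) (adjoin J x I) (take k fs))"
      using Suc.IH by auto
    then have "regular_on ((x # fs) ! k) I (foldl (\<lambda>J f. adjoin J f I) J (take k (x # fs)))" if "k < Suc r" for k
      using that by (cases k) auto
    then show "\<exists>fs. length fs = Suc r \<and> set fs \<subseteq> p \<and>
      (\<forall>k<Suc r. regular_on (fs ! k) I (foldl (\<lambda>J f. adjoin J f I) J (take k fs)))"
      using x by (intro exI[of _ "x # fs"]) auto
  next
    assume "\<exists>fs. length fs = Suc r \<and> set fs \<subseteq> p \<and>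
      (\<forall>k<Suc r. regular_on (fs ! k) I (foldl (\<lambda>J f. adjoin J f I) J (take k fs)))"
    then obtain x fs where x: "length fs = r" "x \<in> p" "set fs \<subseteq> p"
      "\<forall>k<Suc r. regular_on ((x # fs) ! k) I (foldl (\<lambda>J f. adjoin J f I) J (take k (x # fs)))"
      by (auto simp: length_Suc_conv)
    have "regular_on x I J" using x(4)[rule_format, of 0] by simp
    moreover have "grade_ge r I (adjoin J x I)"
      unfolding Suc.IH
    proof (intro exI[of _ fs] conjI allI impI)
      fix k assume "k < r"
      then show "regular_on (fs ! k) I (foldl (\<lambda>J f. adjoin J f I) (adjoin J x I) (take k fs))"
        using x(4)[rule_format, of "Suc k"] by simp
    qed (use x in auto)
    ultimately show "grade_ge (Suc r) I J" using x(2) by auto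
  qed
qed simp

text \<open>\<open>\<phi>\<close> exhibits \<open>L\<close> as the localization of the quotient by \<open>K\<close> at the image of \<open>p\<close>.\<close>

locale localization_map = prime_ideal_at p + cring L
  for p :: "'a::comm_ring_1 set" and L :: "('b, 'm) ring_scheme" (structure) +
  fixes \<phi> :: "'a \<Rightarrow> 'b" and K :: "'a set"
  assumes phi_carr[simp]: "\<phi> f \<in> carrier L"
    and phi_add: "\<phi> (f + g) = \<phi> f \<oplus> \<phi> g"
    and phi_mult: "\<phi> (f * g) = \<phi> f \<otimes> \<phi> g"
    and phi_one: "\<phi> 1 = \<one>"
    and phi_fraction: "X \<in> carrier L \<Longrightarrow> \<exists>s f. s \<notin> p \<and> \<phi> s \<otimes> X = \<phi> f"
    and phi_unit: "s \<notin> p \<Longrightarrow> \<exists>Y\<in>carrier L. \<phi> s \<otimes> Y = \<one>"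
    and phi_zero_iff: "\<phi> f = \<zero> \<longleftrightarrow> f \<in> sat K"
    and ideal_K: "is_ideal K" and K_p: "K \<subseteq> p"
begin

lemma sat_subset_p: "J \<subseteq> p \<Longrightarrow> sat J \<subseteq> p"
  unfolding sat_def using mult_p by blast

lemma phi_zero: "\<phi> 0 = \<zero>"
  using phi_zero_iff[of 0] is_ideal_zero[OF is_ideal_sat[OF ideal_K]] by simp

lemma phi_uminus: "\<phi> (- f) = \<ominus> \<phi> f"
  using phi_add[of f "- f"] by (intro minus_equality[symmetric]) (simp_all add: phi_zero a_comm)

lemma phi_eq_iff: "\<phi> f = \<phi> g \<longleftrightarrow> f - g \<in> sat K"
proof -
  have "\<phi> (f - g) = \<phi> f \<ominus> \<phi> g" using phi_add[of f "- g"] by (simp add: phi_uminus a_minus_def)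
  then have "\<phi> (f - g) = \<zero> \<longleftrightarrow> \<phi> f = \<phi> g"
    by (metis a_minus_def add.inv_solve_right' l_zero phi_carr r_neg zero_closed)
  then show ?thesis using phi_zero_iff[of "f - g"] by simp
qed

section \<open>Extension and contraction of ideals, depth and dimension of the localization\<close>

definition ext :: "'a set \<Rightarrow> 'b set" where
  "ext J = {X \<in> carrier L. \<exists>s f. s \<notin> p \<and> f \<in> J \<and> \<phi> s \<otimes> X = \<phi> f}"

definition con :: "'b set \<Rightarrow> 'a set" where
  "con I = {f. \<phi> f \<in> I}"

lemma ext_mono: "J \<subseteq> J' \<Longrightarrow> ext J \<subseteq> ext J'"
  unfolding ext_def by blast

lemma phi_ext_iff:
  assumes "is_ideal J" "K \<subseteq> J"
  shows "\<phi> f \<in> ext J \<longleftrightarrow> f \<in> sat J"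
proof
  assume "\<phi> f \<in> ext J"
  then obtain s g where s: "s \<notin> p" "g \<in> J" "\<phi> s \<otimes> \<phi> f = \<phi> g" unfolding ext_def by blast
  then have "s * f - g \<in> sat K" by (simp flip: phi_mult add: phi_eq_iff)
  then have "s * f - g + g \<in> sat J"
    using sat_mono[OF assms(2)] s(2) sat_superset is_ideal_add[OF is_ideal_sat[OF assms(1)]] by blast
  then show "f \<in> sat J" using s(1) by (auto intro: satD)
next
  assume "f \<in> sat J"
  then obtain u where "u \<notin> p" "u * f \<in> J" unfolding sat_def by blast
  then show "\<phi> f \<in> ext J" unfolding ext_def
    by (intro CollectI conjI exI[of _ u] exI[of _ "u * f"]) (auto simp: phi_mult)
qed

lemma ideal_ext:
  assumes "is_ideal J"
  shows "ideal (ext J) L"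
proof (rule idealI_closed)
  show "cring L" by (rule is_cring)
  show "ext J \<subseteq> carrier L" by (auto simp: ext_def)
  show "\<zero> \<in> ext J" unfolding ext_def using one_p is_ideal_zero[OF assms] phi_zero
    by (intro CollectI conjI exI[of _ 1] exI[of _ 0]) auto
next
  fix X Y assume "X \<in> ext J" "Y \<in> ext J"
  then obtain s f t g where *: "X \<in> carrier L" "Y \<in> carrier L" "s \<notin> p" "t \<notin> p" "f \<in> J" "g \<in> J"
    "\<phi> s \<otimes> X = \<phi> f" "\<phi> t \<otimes> Y = \<phi> g" unfolding ext_def by blast
  have "\<phi> (s * t) \<otimes> (X \<oplus> Y) = \<phi> t \<otimes> (\<phi> s \<otimes> X) \<oplus> \<phi> s \<otimes> (\<phi> t \<otimes> Y)"
    using *(1,2) by (simp add: phi_mult r_distr m_ac)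
  also have "\<dots> = \<phi> (t * f + s * g)" by (simp add: * phi_add phi_mult)
  finally show "X \<oplus> Y \<in> ext J" unfolding ext_def
    using mult_p[OF *(3,4)] *(1,2) is_ideal_lincomb[OF assms *(5,6)] by blast
next
  fix X Y assume "X \<in> ext J" "Y \<in> carrier L"
  then obtain s f t g where *: "X \<in> carrier L" "Y \<in> carrier L" "s \<notin> p" "t \<notin> p" "f \<in> J"
    "\<phi> s \<otimes> X = \<phi> f" "\<phi> t \<otimes> Y = \<phi> g" unfolding ext_def using phi_fraction[of Y] by blast
  have "\<phi> (s * t) \<otimes> (Y \<otimes> X) = (\<phi> t \<otimes> Y) \<otimes> (\<phi> s \<otimes> X)"
    using *(1,2) by (simp add: phi_mult m_ac)
  also have "\<dots> = \<phi> (g * f)" by (simp add: * phi_mult)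
  finally show "Y \<otimes> X \<in> ext J" unfolding ext_def
    using mult_p[OF *(3,4)] *(1,2) is_ideal_mult[OF assms *(5)] by blast
qed

lemma is_ideal_con:
  assumes "ideal I L"
  shows "is_ideal (con I)" "sat (con I) = con I" "K \<subseteq> con I"
proof -
  interpret I: ideal I L by fact
  show "is_ideal (con I)"
    unfolding is_ideal_def con_def
    by (auto simp: phi_zero phi_add phi_mult intro: I.I_l_closed)
  have "f \<in> con I" if f: "f \<in> sat (con I)" for f
  proof -
    obtain u where u: "u \<notin> p" "\<phi> u \<otimes> \<phi> f \<in> I" using f unfolding sat_def con_def by (auto simp: phi_mult)
    obtain Y where Y: "Y \<in> carrier L" "\<phi> u \<otimes> Y = \<one>" using phi_unit[OF u(1)] by blast
    have "\<phi> f = Y \<otimes> (\<phi> u \<otimes> \<phi> f)" using Y by (metis l_one m_assoc m_comm phi_carr)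
    then show ?thesis using I.I_l_closed[OF u(2) Y(1)] by (simp add: con_def)
  qed
  then show "sat (con I) = con I" using sat_superset by blast
  have "\<phi> f = \<zero>" if "f \<in> K" for f using that phi_zero_iff sat_superset by blast
  then show "K \<subseteq> con I" by (auto simp: con_def)
qed

lemma ext_con:
  assumes "ideal I L"
  shows "ext (con I) = I"
proof -
  interpret I: ideal I L by fact
  show ?thesis
  proof (intro equalityI subsetI)
    fix X assume "X \<in> ext (con I)"
    then obtain s where s: "X \<in> carrier L" "s \<notin> p" "\<phi> s \<otimes> X \<in> I" unfolding ext_def con_def by force
    obtain Y where Y: "Y \<in> carrier L" "\<phi> s \<otimes> Y = \<one>" using phi_unit[OF s(2)] by blast
    have "X = Y \<otimes> (\<phi> s \<otimes> X)" using Y s by (metis l_one m_assoc m_comm phi_carr)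
    then show "X \<in> I" using I.I_l_closed[OF s(3) Y(1)] by simp
  next
    fix X assume X: "X \<in> I"
    then obtain s f where "s \<notin> p" "\<phi> s \<otimes> X = \<phi> f" using phi_fraction I.Icarr by blast
    moreover from this have "\<phi> f \<in> I" using I.I_l_closed[OF X, of "\<phi> s"] by simp
    ultimately show "X \<in> ext (con I)" using X I.Icarr unfolding ext_def con_def by blast
  qed
qed

lemma con_ext: "is_ideal J \<Longrightarrow> K \<subseteq> J \<Longrightarrow> con (ext J) = sat J"
  by (auto simp: con_def phi_ext_iff)

lemma con_subset_p:
  assumes "ideal I L" "I \<noteq> carrier L"
  shows "con I \<subseteq> p"
proof
  interpret I: ideal I L by fact
  fix f assume "f \<in> con I"
  then have f: "\<phi> f \<in> I" by (simp add: con_def)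
  show "f \<in> p"
  proof (rule ccontr)
    assume "f \<notin> p"
    then obtain Y where "Y \<in> carrier L" "\<phi> f \<otimes> Y = \<one>" using phi_unit by blast
    then have "\<one> \<in> I" using I.I_r_closed[OF f] by metis
    then show False using I.one_imp_carrier assms(2) by blast
  qed
qed

lemma ext_proper:
  assumes "is_ideal J" "K \<subseteq> J" "J \<subseteq> p"
  shows "ext J \<noteq> carrier L"
proof
  assume "ext J = carrier L"
  then have "\<phi> 1 \<in> ext J" by simp
  then show False using phi_ext_iff[OF assms(1,2)] sat_subset_p[OF assms(3)] one_p by blast
qed

text \<open>Elements outside p become units, so every proper ideal of \<open>L\<close> contracts
  into p and \<open>L\<close> is local. This pins down the bound variable \<open>M\<close> in the
  definition of \<open>depth\<close>.\<close>

lemma maximalideal_iff: "maximalideal M L \<longleftrightarrow> M = ext p"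
proof
  have id: "ideal (ext p) L" using ideal_ext[OF ideal_p] .
  have ep: "ext p \<noteq> carrier L" using ext_proper[OF ideal_p K_p] by simp
  have le: "I \<subseteq> ext p" if I: "ideal I L" "I \<noteq> carrier L" for I
    using ext_con[OF I(1)] con_subset_p[OF I] unfolding ext_def by blast
  show "M = ext p" if "maximalideal M L"
  proof -
    interpret M: maximalideal M L by fact
    show ?thesis using M.I_maximal[OF id] le[OF M.is_ideal] M.I_notcarr ep by (auto simp: ext_def)
  qed
  show "maximalideal M L" if "M = ext p"
    unfolding that
  proof (rule maximalidealI[OF id])
    show "carrier L \<noteq> ext p" using ep by simp
    show "J = ext p \<or> J = carrier L" if "ideal J L" "ext p \<subseteq> J" for J
      using le[OF that(1)] that(2) by blast
  qed
qed

text \<open>Folding in the order of the list makes the ideals of initial segments exactly those that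
  occur in \<open>grade_ge_iff_regular_list\<close> for \<open>I = UNIV\<close>.\<close>

abbreviation gen :: "'a list \<Rightarrow> 'a set" where
  "gen fs \<equiv> foldl (\<lambda>J f. adjoin J f UNIV) K fs"

lemma ideal_gen: "is_ideal (gen fs)" and K_gen: "K \<subseteq> gen fs"
  by (induction fs rule: rev_induct)
    (use ideal_K is_ideal_adjoin[OF _ is_ideal_UNIV] adjoin_superset[OF is_ideal_UNIV] in \<open>auto, blast+\<close>)

lemma gen_mem: "f \<in> set fs \<Longrightarrow> f \<in> gen fs"
proof (induction fs rule: rev_induct)
  case (snoc x fs)
  have "x \<in> adjoin (gen fs) x UNIV"
    by (rule adjoin_memI[of _ _ _ 1]) (use ideal_gen is_ideal_zero in auto)
  then show ?case using snoc adjoin_superset[OF is_ideal_UNIV, of "gen fs" x] by auto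
qed simp

lemma gen_minimal:
  assumes "is_ideal J" "K \<subseteq> J" "set fs \<subseteq> J"
  shows "gen fs \<subseteq> J"
  using assms(3)
proof (induction fs rule: rev_induct)
  case (snoc x fs)
  then show ?case using assms(1) unfolding adjoin_def
    by (auto intro!: is_ideal_add is_ideal_mult2)
qed (use assms in auto)

text \<open>Each X equals the image of its numerator f up to the unit \<open>\<phi> s\<close>, so
  numerators may replace fractions as generators.\<close>

lemma con_genideal:
  assumes "set xs \<subseteq> carrier L" "list_all2 (\<lambda>X f. \<exists>s. s \<notin> p \<and> \<phi> s \<otimes> X = \<phi> f) xs fs"
  shows "con (Idl (set xs)) = sat (gen fs)"
proof (intro equalityI)
  have len: "length xs = length fs" using assms(2) by (rule list_all2_lengthD)
  have nth: "\<exists>s. s \<notin> p \<and> \<phi> s \<otimes> xs ! k = \<phi> (fs ! k)" if "k < length fs" for k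
    using assms(2) that len by (simp add: list_all2_conv_all_nth)
  have "set xs \<subseteq> ext (gen fs)"
  proof
    fix X assume X: "X \<in> set xs"
    then obtain k where k: "k < length fs" "X = xs ! k" using len by (metis in_set_conv_nth)
    then obtain s where "s \<notin> p" "\<phi> s \<otimes> X = \<phi> (fs ! k)" using nth by blast
    moreover have "fs ! k \<in> gen fs" using k by (intro gen_mem) auto
    ultimately show "X \<in> ext (gen fs)" unfolding ext_def using assms(1) X by blast
  qed
  then have "Idl (set xs) \<subseteq> ext (gen fs)" by (intro genideal_minimal ideal_ext ideal_gen)
  then have "con (Idl (set xs)) \<subseteq> con (ext (gen fs))" by (auto simp: con_def)
  then show "con (Idl (set xs)) \<subseteq> sat (gen fs)" by (simp add: con_ext[OF ideal_gen K_gen])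
next
  have I: "ideal (Idl (set xs)) L" using assms(1) by (rule genideal_ideal)
  interpret I: ideal "Idl (set xs)" L by fact
  have "set fs \<subseteq> con (Idl (set xs))"
  proof
    fix f assume "f \<in> set fs"
    then obtain k where k: "k < length fs" "f = fs ! k" by (metis in_set_conv_nth)
    then obtain s where s: "\<phi> s \<otimes> xs ! k = \<phi> f"
      using assms(2) by (auto simp: list_all2_conv_all_nth)
    have "xs ! k \<in> Idl (set xs)"
      using genideal_self[OF assms(1)] k list_all2_lengthD[OF assms(2)] by auto
    then show "f \<in> con (Idl (set xs))" using I.I_l_closed[of "xs ! k" "\<phi> s"] s by (simp add: con_def)
  qed
  then have "gen fs \<subseteq> con (Idl (set xs))" using is_ideal_con[OF I] by (intro gen_minimal) auto
  then show "sat (gen fs) \<subseteq> con (Idl (set xs))" using is_ideal_con(2)[OF I] sat_mono by blast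
qed

lemma regular_sequence_imp_grade_ge:
  assumes "set xs \<subseteq> ext p" "regular_sequence L xs"
  shows "grade_ge (length xs) UNIV K"
proof -
  have carr: "set xs \<subseteq> carrier L" using assms(1) by (auto simp: ext_def)
  have "\<forall>X\<in>set xs. \<exists>f. f \<in> p \<and> (\<exists>s. s \<notin> p \<and> \<phi> s \<otimes> X = \<phi> f)"
    using assms(1) unfolding ext_def by blast
  then obtain F where F: "\<forall>X\<in>set xs. F X \<in> p \<and> (\<exists>s. s \<notin> p \<and> \<phi> s \<otimes> X = \<phi> (F X))"
    by (rule bchoice[THEN exE])
  define fs where "fs = map F xs"
  have la: "list_all2 (\<lambda>X f. \<exists>s. s \<notin> p \<and> \<phi> s \<otimes> X = \<phi> f) (take k xs) (take k fs)" for k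
    using F by (auto simp: fs_def list_all2_conv_all_nth)
  have con: "con (Idl (set (take k xs))) = sat (gen (take k fs))" for k
    using con_genideal[OF _ la] carr set_take_subset[of k xs] by (meson order_trans)
  have "regular_on (fs ! k) UNIV (gen (take k fs))" if k: "k < length xs" for k
    unfolding regular_on_def
  proof (intro ballI impI)
    fix a assume a: "fs ! k * a \<in> sat (gen (take k fs))"
    have I: "ideal (Idl (set (take k xs))) L"
      using carr set_take_subset[of k xs] by (intro genideal_ideal) auto
    obtain s where s: "s \<notin> p" "\<phi> s \<otimes> xs ! k = \<phi> (fs ! k)"
      using F[rule_format, of "xs ! k"] k by (auto simp: fs_def)
    have xk: "xs ! k \<in> carrier L" using carr k by auto
    have "\<phi> (fs ! k * a) \<in> Idl (set (take k xs))" using a con unfolding con_def by blast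
    also have "\<phi> (fs ! k * a) = xs ! k \<otimes> \<phi> (s * a)"
      using xk by (simp add: phi_mult m_ac flip: s(2))
    finally have "\<phi> (s * a) \<in> Idl (set (take k xs))"
      using assms(2) k unfolding regular_sequence_def by auto
    then have "s * a \<in> sat (gen (take k fs))" using con unfolding con_def by blast
    then show "a \<in> sat (gen (take k fs))" using s(1) by (rule satD)
  qed
  then show ?thesis unfolding grade_ge_iff_regular_list using F by (intro exI[of _ fs]) (auto simp: fs_def)
qed

lemma grade_ge_imp_regular_sequence:
  assumes "grade_ge r UNIV K"
  obtains xs where "length xs = r" "set xs \<subseteq> ext p" "regular_sequence L xs"
proof -
  obtain fs where fs: "length fs = r" "set fs \<subseteq> p" "\<forall>k<r. regular_on (fs ! k) UNIV (gen (take k fs))"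
    using assms unfolding grade_ge_iff_regular_list by blast
  define xs where "xs = map \<phi> fs"
  have la: "list_all2 (\<lambda>X f. \<exists>s. s \<notin> p \<and> \<phi> s \<otimes> X = \<phi> f) (take k xs) (take k fs)" for k
    unfolding xs_def list_all2_conv_all_nth using one_p phi_one by (auto intro!: exI[of _ 1])
  have carr: "set xs \<subseteq> carrier L" by (auto simp: xs_def)
  have con: "con (Idl (set (take k xs))) = sat (gen (take k fs))" for k
    using con_genideal[OF _ la] carr set_take_subset[of k xs] by (meson order_trans)
  have ep: "set xs \<subseteq> ext p"
    using fs(2) sat_superset[of p] by (auto simp: xs_def phi_ext_iff[OF ideal_p K_p])
  have "regular_sequence L xs"
    unfolding regular_sequence_def
  proof (intro conjI allI impI ballI)
    show "set xs \<subseteq> carrier L" by fact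
    have "Idl (set xs) \<subseteq> ext p" by (intro genideal_minimal ideal_ext ideal_p ep)
    then show "Idl (set xs) \<noteq> carrier L" using ext_proper[OF ideal_p K_p] by (auto simp: ext_def)
  next
    fix k X assume k: "k < length xs" "X \<in> carrier L" "xs ! k \<otimes> X \<in> Idl (set (take k xs))"
    have I: "ideal (Idl (set (take k xs))) L"
      using carr set_take_subset[of k xs] by (intro genideal_ideal) auto
    interpret I: ideal "Idl (set (take k xs))" L by fact
    obtain s f where s: "s \<notin> p" "\<phi> s \<otimes> X = \<phi> f" using phi_fraction[OF k(2)] by blast
    have "\<phi> (fs ! k * f) = \<phi> s \<otimes> (xs ! k \<otimes> X)"
      using k by (simp add: phi_mult xs_def m_ac flip: s(2))
    also have "\<dots> \<in> Idl (set (take k xs))" using I.I_l_closed[OF k(3)] by simp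
    finally have "fs ! k * f \<in> sat (gen (take k fs))" using con unfolding con_def by blast
    then have "f \<in> sat (gen (take k fs))" using fs(1,3) k(1) unfolding regular_on_def xs_def by auto
    then have "f \<in> con (Idl (set (take k xs)))" using con by blast
    then have "X \<in> ext (con (Idl (set (take k xs))))" unfolding ext_def using s k by blast
    then show "X \<in> Idl (set (take k xs))" using ext_con[OF I] by simp
  qed
  then show thesis using that[of xs] ep fs(1) by (simp add: xs_def)
qed

lemma enat_le_depth_iff: "enat r \<le> depth L \<longleftrightarrow> grade_ge r UNIV K"
proof
  assume r: "enat r \<le> depth L"
  show "grade_ge r UNIV K"
  proof (cases r)
    case (Suc q)
    \<comment> \<open>\<open>depth\<close> is a supremum, so a sequence of length at least
      \<open>r\<close> is obtained from a strict inequality below it.\<close>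
    then have "enat q < depth L" using r by (metis Suc_ile_eq)
    then obtain xs M where "maximalideal M L" "set xs \<subseteq> M" "regular_sequence L xs" "q < length xs"
      unfolding depth_def less_Sup_iff by auto
    then have "grade_ge (length xs) UNIV K" "r \<le> length xs"
      using regular_sequence_imp_grade_ge Suc by (auto simp: maximalideal_iff)
    then show ?thesis by (rule grade_ge_mono)
  qed simp
next
  assume "grade_ge r UNIV K"
  then obtain xs where "length xs = r" "set xs \<subseteq> ext p" "regular_sequence L xs"
    by (rule grade_ge_imp_regular_sequence)
  then show "enat r \<le> depth L" unfolding depth_def
    by (intro Sup_upper) (auto simp: maximalideal_iff)
qed

lemma is_prime_con:
  assumes "primeideal P L"
  shows "is_prime (con P)" "con P \<subseteq> p"
proof -
  interpret P: primeideal P L by fact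
  show "con P \<subseteq> p" using con_subset_p[OF P.is_ideal] P.I_notcarr by blast
  then show "is_prime (con P)" unfolding is_prime_def
    using is_ideal_con(1)[OF P.is_ideal] one_p P.I_prime by (auto simp: con_def phi_mult)
qed

lemma primeideal_ext:
  assumes "is_prime Q" "K \<subseteq> Q" "Q \<subseteq> p"
  shows "primeideal (ext Q) L" "con (ext Q) = Q"
proof -
  have Q: "is_ideal Q" using assms(1) by (simp add: is_prime_def)
  have "sat Q = Q" using assms(1,3) sat_superset unfolding sat_def is_prime_def by blast
  then show con: "con (ext Q) = Q" using con_ext[OF Q assms(2)] by simp
  show "primeideal (ext Q) L"
  proof (rule primeidealI[OF ideal_ext[OF Q] is_cring])
    show "carrier L \<noteq> ext Q" using ext_proper[OF Q assms(2,3)] by simp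
    fix X Y assume XY: "X \<in> carrier L" "Y \<in> carrier L" "X \<otimes> Y \<in> ext Q"
    obtain s f t g where *: "s \<notin> p" "\<phi> s \<otimes> X = \<phi> f" "t \<notin> p" "\<phi> t \<otimes> Y = \<phi> g"
      using phi_fraction XY by meson
    interpret e: ideal "ext Q" L by (rule ideal_ext[OF Q])
    have "\<phi> (f * g) = \<phi> (s * t) \<otimes> (X \<otimes> Y)"
      using XY by (simp add: phi_mult m_ac flip: *(2,4))
    also have "\<dots> \<in> ext Q" using e.I_l_closed[OF XY(3)] by simp
    finally have "f * g \<in> Q" using con by (auto simp: con_def)
    then have "f \<in> Q \<or> g \<in> Q" using assms(1) by (simp add: is_prime_def)
    then show "X \<in> ext Q \<or> Y \<in> ext Q" unfolding ext_def using XY * by blast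
  qed
qed

lemma enat_le_krull_dim_iff:
  "enat n \<le> krull_dim L \<longleftrightarrow>
     (\<exists>Q. (\<forall>k\<le>n. is_prime (Q k) \<and> K \<subseteq> Q k \<and> Q k \<subseteq> p) \<and> (\<forall>k<n. Q k \<subset> Q (Suc k)))"
proof
  assume n: "enat n \<le> krull_dim L"
  have "\<exists>P. (\<forall>k\<le>n. primeideal (P k) L) \<and> (\<forall>k<n. P k \<subset> P (Suc k))"
  proof (cases n)
    case 0
    \<comment> \<open>The empty supremum is 0 as well, so a chain of length 0 has to be exhibited:
      the extension of p.\<close>
    show ?thesis using 0 primeideal_ext(1)[OF prime K_p] by auto
  next
    case (Suc q)
    then have "enat q < krull_dim L" using n by (metis Suc_ile_eq)
    then obtain m P where P: "\<forall>k\<le>m. primeideal (P k) L" "\<forall>k<m. P k \<subset> P (Suc k)" "q < m"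
      unfolding krull_dim_def less_Sup_iff by auto
    then show ?thesis using Suc by (intro exI[of _ P]) auto
  qed
  then obtain P where P: "\<forall>k\<le>n. primeideal (P k) L" "\<forall>k<n. P k \<subset> P (Suc k)" by blast
  have id: "ideal (P k) L" if "k \<le> n" for k using P(1) that by (auto simp: primeideal_def)
  show "\<exists>Q. (\<forall>k\<le>n. is_prime (Q k) \<and> K \<subseteq> Q k \<and> Q k \<subseteq> p) \<and> (\<forall>k<n. Q k \<subset> Q (Suc k))"
  proof (intro exI[of _ "\<lambda>k. con (P k)"] conjI allI impI)
    fix k assume "k \<le> n"
    then show "is_prime (con (P k))" "K \<subseteq> con (P k)" "con (P k) \<subseteq> p"
      using is_prime_con P(1) is_ideal_con(3) id by auto
  next
    fix k assume k: "k < n"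
    then have "ext (con (P k)) \<noteq> ext (con (P (Suc k)))" "P k \<subseteq> P (Suc k)"
      using P(2) ext_con[OF id] by auto
    then show "con (P k) \<subset> con (P (Suc k))" by (auto simp: con_def)
  qed
next
  assume "\<exists>Q. (\<forall>k\<le>n. is_prime (Q k) \<and> K \<subseteq> Q k \<and> Q k \<subseteq> p) \<and> (\<forall>k<n. Q k \<subset> Q (Suc k))"
  then obtain Q where Q: "\<forall>k\<le>n. is_prime (Q k) \<and> K \<subseteq> Q k \<and> Q k \<subseteq> p" "\<forall>k<n. Q k \<subset> Q (Suc k)" by blast
  have q: "is_prime (Q k)" "K \<subseteq> Q k" "Q k \<subseteq> p" if "k \<le> n" for k using Q(1) that by auto
  have "\<forall>k\<le>n. primeideal (ext (Q k)) L" using primeideal_ext(1)[OF q] by blast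
  moreover have "ext (Q k) \<subset> ext (Q (Suc k))" if k: "k < n" for k
  proof -
    have lt: "Q k \<subset> Q (Suc k)" using Q(2) k by blast
    have "ext (Q k) \<noteq> ext (Q (Suc k))"
    proof
      assume "ext (Q k) = ext (Q (Suc k))"
      then have "con (ext (Q k)) = con (ext (Q (Suc k)))" by (rule arg_cong)
      then have "Q k = Q (Suc k)"
        unfolding primeideal_ext(2)[OF q[of k, OF less_imp_le[OF k]]]
          primeideal_ext(2)[OF q[of "Suc k", OF Suc_leI[OF k]]] .
      then show False using lt by (simp only: less_irrefl)
    qed
    then show ?thesis using ext_mono[OF psubset_imp_subset[OF lt]] by (simp only: psubset_eq simp_thms)
  qed
  ultimately show "enat n \<le> krull_dim L" unfolding krull_dim_def
    by (intro Sup_upper CollectI exI[of _ n] conjI refl exI[of _ "\<lambda>k. ext (Q k)"]) auto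
qed

end

text \<open>A fraction f/1 vanishes exactly if some element outside the prime kills f, so the kernel
  of the map into the localization is the saturation of the kernel of \<open>\<psi>\<close>. Depth
  and dimension of localized quotient rings can thus be read off from ideals of the type
  \<open>'a\<close>.\<close>

lemma localization_map_fraction:
  fixes R :: "('b, 'm) ring_scheme" and \<psi> :: "'a::comm_ring_1 \<Rightarrow> 'b"
  assumes R: "primeideal P R"
    and range: "carrier R = range \<psi>" and add: "\<And>f g. \<psi> (f + g) = \<psi> f \<oplus>\<^bsub>R\<^esub> \<psi> g"
    and mult: "\<And>f g. \<psi> (f * g) = \<psi> f \<otimes>\<^bsub>R\<^esub> \<psi> g" and one: "\<psi> 1 = \<one>\<^bsub>R\<^esub>"
  shows "localization_map {f. \<psi> f \<in> P} (localization_at R P)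
    (\<lambda>f. fraction R (carrier R - P) (\<psi> f) \<one>\<^bsub>R\<^esub>) {f. \<psi> f = \<zero>\<^bsub>R\<^esub>}"
proof -
  interpret P: primeideal P R by fact
  interpret S: localization_setup R "carrier R - P"
  proof
    show "\<one>\<^bsub>R\<^esub> \<in> carrier R - P" using P.I_notcarr P.one_imp_carrier by auto
    show "s \<otimes>\<^bsub>R\<^esub> t \<in> carrier R - P" if "s \<in> carrier R - P" "t \<in> carrier R - P" for s t
      using that P.I_prime by auto
  qed auto
  have c[simp]: "\<psi> f \<in> carrier R" for f using range by blast
  have zero: "\<psi> 0 = \<zero>\<^bsub>R\<^esub>" using add[of 0 0] by simp
  have kernel: "is_ideal {f. \<psi> f = \<zero>\<^bsub>R\<^esub>}" unfolding is_ideal_def by (auto simp: zero add mult)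
  have pr: "is_prime {f. \<psi> f \<in> P}"
    unfolding is_prime_def is_ideal_def
    using P.I_prime P.I_l_closed S.S_one by (auto simp: zero add mult one)
  interpret p: prime_ideal_at "{f. \<psi> f \<in> P}" by standard (rule pr)
  have unit1: "\<one>\<^bsub>R\<^esub> \<notin> P" using S.S_one by simp
  show ?thesis
    unfolding localization_at_def
  proof (intro localization_map.intro localization_map_axioms.intro)
    show "prime_ideal_at {f. \<psi> f \<in> P}" by unfold_locales
    show "cring (localization R (carrier R - P))" by (rule S.localization_cring)
  next
    fix f g
    show "fraction R (carrier R - P) (\<psi> f) \<one>\<^bsub>R\<^esub> \<in> carrier (localization R (carrier R - P))"
      by (rule S.fraction_carrier) (use unit1 in auto)
    show "fraction R (carrier R - P) (\<psi> (f + g)) \<one>\<^bsub>R\<^esub> =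
      fraction R (carrier R - P) (\<psi> f) \<one>\<^bsub>R\<^esub> \<oplus>\<^bsub>localization R (carrier R - P)\<^esub>
      fraction R (carrier R - P) (\<psi> g) \<one>\<^bsub>R\<^esub>"
      using unit1 by (simp add: S.localization_add add)
    show "fraction R (carrier R - P) (\<psi> (f * g)) \<one>\<^bsub>R\<^esub> =
      fraction R (carrier R - P) (\<psi> f) \<one>\<^bsub>R\<^esub> \<otimes>\<^bsub>localization R (carrier R - P)\<^esub>
      fraction R (carrier R - P) (\<psi> g) \<one>\<^bsub>R\<^esub>"
      using unit1 by (simp add: S.localization_mult mult)
    show "fraction R (carrier R - P) (\<psi> 1) \<one>\<^bsub>R\<^esub> = \<one>\<^bsub>localization R (carrier R - P)\<^esub>"
      by (simp add: S.localization_one one)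
  next
    fix X assume "X \<in> carrier (localization R (carrier R - P))"
    then obtain a s where X: "a \<in> carrier R" "s \<in> carrier R - P" "X = fraction R (carrier R - P) a s"
      by (rule S.fraction_cases)
    then obtain f g where fg: "a = \<psi> f" "s = \<psi> g" using range by auto
    have "fraction R (carrier R - P) (\<psi> g) \<one>\<^bsub>R\<^esub> \<otimes>\<^bsub>localization R (carrier R - P)\<^esub> X
        = fraction R (carrier R - P) (\<psi> g \<otimes>\<^bsub>R\<^esub> \<psi> f) (\<psi> g)"
      using X fg unit1 by (simp add: S.localization_mult)
    also have "\<dots> = fraction R (carrier R - P) (\<psi> f) \<one>\<^bsub>R\<^esub>"
      by (rule S.fraction_eqI1) (use X fg unit1 in auto)
    finally show "\<exists>s f. s \<notin> {f. \<psi> f \<in> P} \<and>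
        fraction R (carrier R - P) (\<psi> s) \<one>\<^bsub>R\<^esub> \<otimes>\<^bsub>localization R (carrier R - P)\<^esub> X =
        fraction R (carrier R - P) (\<psi> f) \<one>\<^bsub>R\<^esub>"
      using X fg by blast
  next
    fix s assume s: "s \<notin> {f. \<psi> f \<in> P}"
    have "fraction R (carrier R - P) (\<psi> s) \<one>\<^bsub>R\<^esub> \<otimes>\<^bsub>localization R (carrier R - P)\<^esub>
        fraction R (carrier R - P) \<one>\<^bsub>R\<^esub> (\<psi> s) = fraction R (carrier R - P) (\<psi> s) (\<psi> s)"
      using s unit1 by (simp add: S.localization_mult)
    also have "\<dots> = \<one>\<^bsub>localization R (carrier R - P)\<^esub>"
      unfolding S.localization_one by (rule S.fraction_eqI1) (use s unit1 in auto)
    finally show "\<exists>Y\<in>carrier (localization R (carrier R - P)).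
        fraction R (carrier R - P) (\<psi> s) \<one>\<^bsub>R\<^esub> \<otimes>\<^bsub>localization R (carrier R - P)\<^esub> Y =
        \<one>\<^bsub>localization R (carrier R - P)\<^esub>"
      using s S.fraction_carrier[of "\<one>\<^bsub>R\<^esub>" "\<psi> s"] by auto
  next
    fix f
    have "fraction R (carrier R - P) (\<psi> f) \<one>\<^bsub>R\<^esub> = \<zero>\<^bsub>localization R (carrier R - P)\<^esub> \<longleftrightarrow>
        (\<exists>u\<in>carrier R - P. u \<otimes>\<^bsub>R\<^esub> \<psi> f = \<zero>\<^bsub>R\<^esub>)"
    proof
      assume "fraction R (carrier R - P) (\<psi> f) \<one>\<^bsub>R\<^esub> = \<zero>\<^bsub>localization R (carrier R - P)\<^esub>"
      then have "(\<zero>\<^bsub>R\<^esub>, \<one>\<^bsub>R\<^esub>) \<in> fraction R (carrier R - P) (\<psi> f) \<one>\<^bsub>R\<^esub>"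
        using S.fraction_self[of "\<zero>\<^bsub>R\<^esub>" "\<one>\<^bsub>R\<^esub>"] unit1 by (simp add: S.localization_zero)
      from S.fraction_memD(3)[OF this] show "\<exists>u\<in>carrier R - P. u \<otimes>\<^bsub>R\<^esub> \<psi> f = \<zero>\<^bsub>R\<^esub>" by auto
    next
      assume "\<exists>u\<in>carrier R - P. u \<otimes>\<^bsub>R\<^esub> \<psi> f = \<zero>\<^bsub>R\<^esub>"
      then obtain u where "u \<in> carrier R - P" "u \<otimes>\<^bsub>R\<^esub> \<psi> f = \<zero>\<^bsub>R\<^esub>" by blast
      then show "fraction R (carrier R - P) (\<psi> f) \<one>\<^bsub>R\<^esub> = \<zero>\<^bsub>localization R (carrier R - P)\<^esub>"
        unfolding S.localization_zero by (intro S.fraction_eqI[of _ _ _ _ u]) (use unit1 in auto)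
    qed
    also have "\<dots> \<longleftrightarrow> f \<in> p.sat {f. \<psi> f = \<zero>\<^bsub>R\<^esub>}"
      unfolding p.sat_def range by (auto simp: mult)
    finally show "fraction R (carrier R - P) (\<psi> f) \<one>\<^bsub>R\<^esub> = \<zero>\<^bsub>localization R (carrier R - P)\<^esub>
        \<longleftrightarrow> f \<in> p.sat {f. \<psi> f = \<zero>\<^bsub>R\<^esub>}" .
  qed (use kernel in auto)
qed


section \<open>Polynomials and monomials\<close>

lemma keys_add_nat: "Poly_Mapping.keys (a + b) = Poly_Mapping.keys a \<union> Poly_Mapping.keys (b :: 'v \<Rightarrow>\<^sub>0 nat)"
  by (auto simp: in_keys_iff lookup_add)

lemma sum_monomials: "(\<Sum>m\<in>Poly_Mapping.keys f. Poly_Mapping.single m (Poly_Mapping.lookup f m)) = f"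
  by (rule poly_mapping_eqI)
    (auto simp: lookup_sum lookup_single in_keys_iff when_def if_distrib sum.delta' cong: if_cong)

lemma monomial_induct [case_names single add]:
  fixes f :: "'a \<Rightarrow>\<^sub>0 'b::comm_monoid_add"
  assumes "\<And>m c. P (Poly_Mapping.single m c)" "\<And>f g. P f \<Longrightarrow> P g \<Longrightarrow> P (f + g)"
  shows "P f"
proof -
  have "P (\<Sum>m\<in>A. Poly_Mapping.single m (Poly_Mapping.lookup f m))" for A
    \<comment> \<open>The instance with coefficient 0 supplies the zero polynomial for the empty
      sum.\<close>
    by (induction A rule: infinite_finite_induct) (use assms(1)[of undefined 0] assms in auto)
  then show ?thesis using sum_monomials[of f] by metis
qed

definition filter_keys :: "('a \<Rightarrow> bool) \<Rightarrow> ('a \<Rightarrow>\<^sub>0 'b::zero) \<Rightarrow> ('a \<Rightarrow>\<^sub>0 'b)" where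
  "filter_keys P f = Poly_Mapping.mapp (\<lambda>m c. c when P m) f"

lemma lookup_filter_keys: "Poly_Mapping.lookup (filter_keys P f) m = (Poly_Mapping.lookup f m when P m)"
  by (auto simp: filter_keys_def lookup_mapp when_def in_keys_iff)

lemma keys_filter_keys: "Poly_Mapping.keys (filter_keys P f) = {m \<in> Poly_Mapping.keys f. P m}"
  by (auto simp: in_keys_iff lookup_filter_keys when_def split: if_splits)

lemma filter_keys_add: "filter_keys P (f + g) = filter_keys P f + filter_keys P g"
  by (rule poly_mapping_eqI) (simp add: lookup_filter_keys lookup_add when_add_distrib)

text \<open>The coefficient of \<open>v\<^sup>k\<close> when \<open>f\<close> is read as a polynomial in the single variable \<open>v\<close>.\<close>

definition coef :: "'v \<Rightarrow> nat \<Rightarrow> (('v \<Rightarrow>\<^sub>0 nat) \<Rightarrow>\<^sub>0 'k::zero) \<Rightarrow> (('v \<Rightarrow>\<^sub>0 nat) \<Rightarrow>\<^sub>0 'k)" where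
  "coef v k f = filter_keys (\<lambda>m. Poly_Mapping.lookup m v = 0)
     (Poly_Mapping.map_key (\<lambda>m. m + Poly_Mapping.single v k) f)"

definition vfree :: "'v \<Rightarrow> (('v \<Rightarrow>\<^sub>0 nat) \<Rightarrow>\<^sub>0 'k::zero) \<Rightarrow> bool" where
  "vfree v f \<longleftrightarrow> (\<forall>m\<in>Poly_Mapping.keys f. Poly_Mapping.lookup m v = 0)"

definition var :: "'v \<Rightarrow> (('v \<Rightarrow>\<^sub>0 nat) \<Rightarrow>\<^sub>0 'k::comm_ring_1)" where
  "var v = Poly_Mapping.single (Poly_Mapping.single v 1) 1"

lemma lookup_coef:
  "Poly_Mapping.lookup (coef v k f) m =
     (Poly_Mapping.lookup f (m + Poly_Mapping.single v k) when Poly_Mapping.lookup m v = 0)"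
  by (simp add: coef_def lookup_filter_keys map_key.rep_eq inj_def)

lemma coef_add: "coef v k (f + g) = coef v k f + coef v k g"
  by (rule poly_mapping_eqI) (simp add: lookup_coef lookup_add when_add_distrib)

lemma coef_uminus: "coef v k (- f) = - coef v k (f :: _ \<Rightarrow>\<^sub>0 'k::ab_group_add)"
  by (rule poly_mapping_eqI) (simp add: lookup_coef when_uminus_distrib)

lemma coef_diff: "coef v k (f - g) = coef v k f - coef v k (g :: _ \<Rightarrow>\<^sub>0 'k::ab_group_add)"
  using coef_add[of v k f "- g"] by (simp add: coef_uminus)

lemma coef_zero[simp]: "coef v k 0 = 0"
  by (rule poly_mapping_eqI) (simp add: lookup_coef)

lemma coef_sum: "coef v k (sum f A) = (\<Sum>a\<in>A. coef v k (f a))"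
  by (induction A rule: infinite_finite_induct) (auto simp: coef_add)

lemma single_split:
  "Poly_Mapping.lookup m v = k \<Longrightarrow> (m - Poly_Mapping.single v k) + Poly_Mapping.single v k = (m :: 'v \<Rightarrow>\<^sub>0 nat)"
  by (rule poly_mapping_eqI) (auto simp: lookup_add lookup_minus lookup_single when_def)

lemma coef_single:
  "coef v k (Poly_Mapping.single m c) =
     (if Poly_Mapping.lookup m v = k then Poly_Mapping.single (m - Poly_Mapping.single v k) c else 0)"
proof (rule poly_mapping_eqI)
  fix n
  have "Poly_Mapping.lookup m v = k \<and> m - Poly_Mapping.single v k = n \<longleftrightarrow>
      Poly_Mapping.lookup n v = 0 \<and> m = n + Poly_Mapping.single v k"
    using single_split[of m v k] by (auto simp: lookup_add lookup_minus lookup_single)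
  then show "Poly_Mapping.lookup (coef v k (Poly_Mapping.single m c)) n = Poly_Mapping.lookup
      (if Poly_Mapping.lookup m v = k then Poly_Mapping.single (m - Poly_Mapping.single v k) c else 0) n"
    by (auto simp: lookup_coef lookup_single when_def)
qed

lemma vfree_coef: "vfree v (coef v k f)"
  by (auto simp: vfree_def in_keys_iff lookup_coef when_def split: if_splits)

lemma coef_mult_vfree:
  fixes a :: "('v \<Rightarrow>\<^sub>0 nat) \<Rightarrow>\<^sub>0 'k::comm_ring_1"
  assumes "vfree v a"
  shows "coef v k (a * f) = a * coef v k f"
proof -
  have mono: "coef v k (Poly_Mapping.single n c * f) = Poly_Mapping.single n c * coef v k f"
    if n: "Poly_Mapping.lookup n v = 0" for n c
  proof (induction f rule: monomial_induct)
    case (single m d)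
    have "n + m - Poly_Mapping.single v (Poly_Mapping.lookup m v)
        = n + (m - Poly_Mapping.single v (Poly_Mapping.lookup m v))"
      by (rule poly_mapping_eqI) (auto simp: lookup_add lookup_minus lookup_single when_def)
    then show ?case using n by (auto simp: mult_single coef_single lookup_add)
  qed (simp add: distrib_left coef_add)
  have "coef v k (\<Sum>n\<in>Poly_Mapping.keys a. Poly_Mapping.single n (Poly_Mapping.lookup a n) * f)
      = (\<Sum>n\<in>Poly_Mapping.keys a. Poly_Mapping.single n (Poly_Mapping.lookup a n) * coef v k f)"
    unfolding coef_sum by (intro sum.cong refl mono) (use assms in \<open>auto simp: vfree_def\<close>)
  then show ?thesis unfolding sum_distrib_right[symmetric] sum_monomials .
qed

lemma coef_var_mult:
  "coef v k (var v * f) = (if k = 0 then 0 else coef v (k - 1) f)"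
proof (induction f rule: monomial_induct)
  case (single m d)
  have "Poly_Mapping.single v 1 + m - Poly_Mapping.single v (Suc (Poly_Mapping.lookup m v))
      = m - Poly_Mapping.single v (Poly_Mapping.lookup m v)"
    by (rule poly_mapping_eqI) (auto simp: lookup_add lookup_minus lookup_single when_def)
  then show ?case by (cases k) (auto simp: var_def mult_single coef_single lookup_add)
qed (simp add: distrib_left coef_add)

lemma coef_var_power_mult:
  "coef v k (var v ^ j * f) = (if k < j then 0 else coef v (k - j) f)"
  by (induction j arbitrary: k) (auto simp: coef_var_mult mult.assoc)

lemma coef_vfree:
  fixes a :: "('v \<Rightarrow>\<^sub>0 nat) \<Rightarrow>\<^sub>0 'k::comm_ring_1"
  shows "vfree v a \<Longrightarrow> coef v k a = (if k = 0 then a else 0)"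
proof -
  assume a: "vfree v a"
  have "coef v k (Poly_Mapping.single 0 (1::'k)) = (if k = 0 then 1 else 0)"
    by (subst coef_single) auto
  then show ?thesis using coef_mult_vfree[OF a, of k 1] by auto
qed

lemma coef_var_power_vfree:
  "vfree v a \<Longrightarrow> coef v k (var v ^ j * a) = (if k = j then a else 0)"
  by (auto simp: coef_var_power_mult coef_vfree)

lemma coef_eventually_zero: "\<exists>n. \<forall>k\<ge>n. coef v k f = 0"
proof -
  define S where "S = (\<lambda>m. Poly_Mapping.lookup m v) ` Poly_Mapping.keys f"
  have "finite S" by (simp add: S_def)
  then obtain n where n: "\<forall>s\<in>S. s < n" by (meson finite_nat_set_iff_bounded)
  have "coef v k f = 0" if "k \<ge> n" for k
  proof (rule poly_mapping_eqI)
    fix m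
    have "m + Poly_Mapping.single v k \<notin> Poly_Mapping.keys f"
    proof
      assume "m + Poly_Mapping.single v k \<in> Poly_Mapping.keys f"
      then have "Poly_Mapping.lookup (m + Poly_Mapping.single v k) v \<in> S" by (simp add: S_def)
      then show False using n that by (auto simp: lookup_add)
    qed
    then show "Poly_Mapping.lookup (coef v k f) m = Poly_Mapping.lookup 0 m"
      by (simp add: lookup_coef in_keys_iff)
  qed
  then show ?thesis by blast
qed

lemma coef_expansion:
  fixes f :: "('v \<Rightarrow>\<^sub>0 nat) \<Rightarrow>\<^sub>0 'k::comm_ring_1"
  assumes "\<forall>k\<ge>n. coef v k f = 0"
  shows "f = (\<Sum>k<n. coef v k f * var v ^ k)"
proof -
  \<comment> \<open>Asking for the identity at all large bounds lets the bounds of two summands be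
    merged by \<open>max\<close>.\<close>
  have ex: "\<exists>N. \<forall>n\<ge>N. f = (\<Sum>k<n. coef v k f * var v ^ k)"
  proof (induction f rule: monomial_induct)
    case (single m c)
    define d where "d = Poly_Mapping.lookup m v"
    have pow: "var v ^ k = Poly_Mapping.single (Poly_Mapping.single v k) (1::'k)" for k
      by (induction k) (auto simp: var_def mult_single simp flip: single_add)
    have "(\<Sum>k<n. coef v k (Poly_Mapping.single m c) * var v ^ k) = Poly_Mapping.single m c" if "n > d" for n
    proof -
      have "(\<Sum>k<n. coef v k (Poly_Mapping.single m c) * var v ^ k)
          = (\<Sum>k<n. if k = d then Poly_Mapping.single m c else 0)"
        by (intro sum.cong refl)
          (auto simp: coef_single pow mult_single single_split d_def)
      then show ?thesis using that by simp
    qed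
    then show ?case by (intro exI[of _ "Suc d"]) auto
  next
    case (add f g)
    then obtain N M where NM: "\<And>n. n \<ge> N \<Longrightarrow> f = (\<Sum>k<n. coef v k f * var v ^ k)"
      "\<And>n. n \<ge> M \<Longrightarrow> g = (\<Sum>k<n. coef v k g * var v ^ k)" by blast
    have "f + g = (\<Sum>k<n. coef v k (f + g) * var v ^ k)" if "n \<ge> max N M" for n
      using NM[of n] that by (simp add: coef_add distrib_right sum.distrib)
    then show ?case by blast
  qed
  then obtain N where N: "\<forall>n\<ge>N. f = (\<Sum>k<n. coef v k f * var v ^ k)" by blast
  have "(\<Sum>k<max n N. coef v k f * var v ^ k) = (\<Sum>k<n. coef v k f * var v ^ k)"
    by (rule sum.mono_neutral_right) (use assms in \<open>auto simp: not_less\<close>)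
  then show ?thesis using N[rule_format, of "max n N"] by simp
qed

lemma coef_all_zero:
  fixes f :: "('v \<Rightarrow>\<^sub>0 nat) \<Rightarrow>\<^sub>0 'k::comm_ring_1"
  shows "\<forall>k. coef v k f = 0 \<Longrightarrow> f = 0"
  using coef_expansion[of 0 v f] by simp

lemma keys_coef_subset:
  assumes "\<forall>m\<in>Poly_Mapping.keys f. Poly_Mapping.keys m \<subseteq> insert v U"
    "m \<in> Poly_Mapping.keys (coef v k f)"
  shows "Poly_Mapping.keys m \<subseteq> U"
proof -
  have "m + Poly_Mapping.single v k \<in> Poly_Mapping.keys f" "Poly_Mapping.lookup m v = 0"
    using assms(2) by (auto simp: in_keys_iff lookup_coef when_def split: if_splits)
  then have "Poly_Mapping.keys m \<subseteq> insert v U" "v \<notin> Poly_Mapping.keys m"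
    using assms(1) by (fastforce simp: keys_add_nat, simp add: in_keys_iff)
  then show ?thesis by blast
qed

text \<open>This is an ideal of the polynomial ring in all variables from \<open>'v\<close>. It contains the variables outside
  the vertex set, so its quotient is still the Stanley-Reisner ring; working with the full type avoids
  carrier sets.\<close>

definition nonface_ideal :: "'v set set \<Rightarrow> (('v \<Rightarrow>\<^sub>0 nat) \<Rightarrow>\<^sub>0 'k::comm_ring_1) set" where
  "nonface_ideal \<Delta> = {f. \<forall>m\<in>Poly_Mapping.keys f. Poly_Mapping.keys m \<notin> \<Delta>}"

lemma is_ideal_nonface_ideal:
  assumes "\<forall>F\<in>\<Delta>. \<forall>G. G \<subseteq> F \<longrightarrow> G \<in> \<Delta>"
  shows "is_ideal (nonface_ideal \<Delta>)"
  unfolding is_ideal_def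
proof (intro conjI ballI allI)
  show "0 \<in> nonface_ideal \<Delta>" by (simp add: nonface_ideal_def)
next
  fix a b :: "('a \<Rightarrow>\<^sub>0 nat) \<Rightarrow>\<^sub>0 'b" assume "a \<in> nonface_ideal \<Delta>" "b \<in> nonface_ideal \<Delta>"
  then show "a + b \<in> nonface_ideal \<Delta>" using Poly_Mapping.keys_add[of a b] unfolding nonface_ideal_def by blast
next
  fix a r :: "('a \<Rightarrow>\<^sub>0 nat) \<Rightarrow>\<^sub>0 'b" assume a: "a \<in> nonface_ideal \<Delta>"
  show "r * a \<in> nonface_ideal \<Delta>" unfolding nonface_ideal_def
  proof (intro CollectI ballI)
    fix m assume "m \<in> Poly_Mapping.keys (r * a)"
    then obtain x y where xy: "m = x + y" "y \<in> Poly_Mapping.keys a"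
      using keys_mult[of r a] by blast
    then have "Poly_Mapping.keys y \<notin> \<Delta>" using a unfolding nonface_ideal_def by blast
    then show "Poly_Mapping.keys m \<notin> \<Delta>" using assms xy by (auto simp: keys_add_nat)
  qed
qed

lemma is_ideal_nonface_ideal_Pow: "is_ideal (nonface_ideal (Pow V))"
  by (rule is_ideal_nonface_ideal) auto

lemma nonface_ideal_antimono: "\<Delta> \<subseteq> \<Delta>' \<Longrightarrow> nonface_ideal \<Delta>' \<subseteq> nonface_ideal \<Delta>"
  by (auto simp: nonface_ideal_def)

section \<open>Stanley-Reisner rings as quotients of the full polynomial type\<close>

abbreviation restrict_vars :: "'v set \<Rightarrow> (('v \<Rightarrow>\<^sub>0 nat) \<Rightarrow>\<^sub>0 'k::comm_ring_1) \<Rightarrow> (('v \<Rightarrow>\<^sub>0 nat) \<Rightarrow>\<^sub>0 'k)" where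
  "restrict_vars V \<equiv> filter_keys (\<lambda>m. Poly_Mapping.keys m \<subseteq> V)"

lemma diff_restrict_vars: "f - restrict_vars V f \<in> nonface_ideal (Pow V)"
  by (auto simp: nonface_ideal_def in_keys_iff lookup_minus lookup_filter_keys when_def)

text \<open>The polynomials in the variables of V and \<open>nonface_ideal (Pow V)\<close> are
  spanned by complementary sets of monomials. As the second space is an ideal, the projection
  \<open>restrict_vars V\<close> is multiplicative.\<close>

lemma restrict_vars_unique:
  assumes "f - g \<in> nonface_ideal (Pow V)" "\<forall>m\<in>Poly_Mapping.keys g. Poly_Mapping.keys m \<subseteq> V"
  shows "restrict_vars V f = g"
proof (rule poly_mapping_eqI)
  fix m
  show "Poly_Mapping.lookup (restrict_vars V f) m = Poly_Mapping.lookup g m"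
    using assms unfolding nonface_ideal_def by (auto simp: lookup_filter_keys when_def in_keys_iff lookup_minus)
qed

lemma restrict_vars_carrier: "restrict_vars V f \<in> carrier (poly_ring K V)"
  by (auto simp: poly_ring_def keys_filter_keys)

lemma restrict_vars_mult: "restrict_vars V (f * g) = restrict_vars V f * restrict_vars V (g :: ('v \<Rightarrow>\<^sub>0 nat) \<Rightarrow>\<^sub>0 'k::comm_ring_1)"
proof (rule restrict_vars_unique)
  have "f * g - restrict_vars V f * restrict_vars V g = f * (g - restrict_vars V g) + restrict_vars V g * (f - restrict_vars V f)"
    by (simp add: algebra_simps)
  then show "f * g - restrict_vars V f * restrict_vars V g \<in> nonface_ideal (Pow V)"
    using is_ideal_lincomb[OF is_ideal_nonface_ideal_Pow diff_restrict_vars diff_restrict_vars] by metis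
  show "\<forall>m\<in>Poly_Mapping.keys (restrict_vars V f * restrict_vars V g). Poly_Mapping.keys m \<subseteq> V"
  proof
    fix m assume "m \<in> Poly_Mapping.keys (restrict_vars V f * restrict_vars V g)"
    then obtain a b where "m = a + b" "a \<in> Poly_Mapping.keys (restrict_vars V f)" "b \<in> Poly_Mapping.keys (restrict_vars V g)"
      using keys_mult[of "restrict_vars V f" "restrict_vars V g"] by blast
    then show "Poly_Mapping.keys m \<subseteq> V" by (auto simp: keys_add_nat keys_filter_keys)
  qed
qed

lemma restrict_vars_id: "\<forall>m\<in>Poly_Mapping.keys f. Poly_Mapping.keys m \<subseteq> V \<Longrightarrow> restrict_vars V f = f"
  by (rule restrict_vars_unique) (simp_all add: nonface_ideal_def)

lemma keys_face_monomial:
  assumes "finite F"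
  shows "Poly_Mapping.keys (\<Sum>v\<in>F. Poly_Mapping.single v (1::nat)) = F"
  using assms by (induction F) (auto simp: keys_add_nat)

lemma lookup_face_monomial:
  assumes "finite F"
  shows "Poly_Mapping.lookup (\<Sum>v\<in>F. Poly_Mapping.single v (1::nat)) x = (if x \<in> F then 1 else 0)"
  using assms by (induction F) (auto simp: lookup_add lookup_single when_def)

lemma monomial_face_split:
  "(m - (\<Sum>v\<in>Poly_Mapping.keys m. Poly_Mapping.single v 1)) + (\<Sum>v\<in>Poly_Mapping.keys m. Poly_Mapping.single v 1)
    = (m :: 'v \<Rightarrow>\<^sub>0 nat)"
  by (rule poly_mapping_eqI)
    (use lookup_face_monomial[of "Poly_Mapping.keys m"] in \<open>auto simp: lookup_add lookup_minus in_keys_iff\<close>)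

text \<open>A monomial whose support F is not a face is a multiple of the generator
  \<open>face_monomial F\<close>. Membership thus depends on the supports of the monomials
  alone.\<close>

lemma stanley_reisner_ideal_eq:
  assumes "simplicial_complex V \<Delta>"
  shows "stanley_reisner_ideal (K :: 'k::field itself) V \<Delta> = carrier (poly_ring K V) \<inter> nonface_ideal \<Delta>"
proof
  interpret S: cring "poly_ring K V" by (rule poly_ring_cring)
  have fin: "finite V" and down: "\<forall>F\<in>\<Delta>. \<forall>G. G \<subseteq> F \<longrightarrow> G \<in> \<Delta>"
    using assms by (auto simp: simplicial_complex_def)
  note idl = is_ideal_nonface_ideal[OF down]
  have id: "ideal (carrier (poly_ring K V) \<inter> nonface_ideal \<Delta>) (poly_ring K V)"
  proof (rule idealI_closed[OF poly_ring_cring])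
    fix a b assume "a \<in> carrier (poly_ring K V) \<inter> nonface_ideal \<Delta>" "b \<in> carrier (poly_ring K V) \<inter> nonface_ideal \<Delta>"
    then show "a \<oplus>\<^bsub>poly_ring K V\<^esub> b \<in> carrier (poly_ring K V) \<inter> nonface_ideal \<Delta>"
      using S.a_closed[of a b] is_ideal_add[OF idl] by (auto simp: poly_ring_def)
  next
    fix a x assume "a \<in> carrier (poly_ring K V) \<inter> nonface_ideal \<Delta>" "x \<in> carrier (poly_ring K V)"
    then show "x \<otimes>\<^bsub>poly_ring K V\<^esub> a \<in> carrier (poly_ring K V) \<inter> nonface_ideal \<Delta>"
      using S.m_closed[of x a] is_ideal_mult[OF idl] by (auto simp: poly_ring_def)
  qed (use is_ideal_zero[OF idl] in \<open>auto simp: poly_ring_def\<close>)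
  show "stanley_reisner_ideal K V \<Delta> \<subseteq> carrier (poly_ring K V) \<inter> nonface_ideal \<Delta>"
    unfolding stanley_reisner_ideal_def
  proof (rule S.genideal_minimal[OF id], clarify)
    fix F assume F: "F \<subseteq> V" "F \<notin> \<Delta>"
    then have "Poly_Mapping.keys (\<Sum>v\<in>F. Poly_Mapping.single v (1::nat)) = F"
      using fin by (intro keys_face_monomial) (rule finite_subset)
    then show "face_monomial F \<in> carrier (poly_ring K V) \<inter> nonface_ideal \<Delta>"
      using face_monomial_carrier[OF F(1)] F(2) by (auto simp: nonface_ideal_def face_monomial_def)
  qed
  interpret I: ideal "stanley_reisner_ideal K V \<Delta>" "poly_ring K V" by (rule stanley_reisner_ideal_ideal)
  show "carrier (poly_ring K V) \<inter> nonface_ideal \<Delta> \<subseteq> stanley_reisner_ideal K V \<Delta>"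
  proof
    fix f assume f: "f \<in> carrier (poly_ring K V) \<inter> nonface_ideal \<Delta>"
    have "Poly_Mapping.single m (Poly_Mapping.lookup f m) \<in> stanley_reisner_ideal K V \<Delta>"
      if m: "m \<in> Poly_Mapping.keys f" for m
    proof -
      define F where "F = Poly_Mapping.keys m"
      have F: "F \<subseteq> V" "F \<notin> \<Delta>" using f m by (auto simp: nonface_ideal_def poly_ring_def F_def)
      let ?e = "\<Sum>v\<in>F. Poly_Mapping.single v (1::nat)"
      have "face_monomial F \<in> stanley_reisner_ideal K V \<Delta>"
        unfolding stanley_reisner_ideal_def
        using S.genideal_self[of "face_monomial ` {F. F \<subseteq> V \<and> F \<notin> \<Delta>}"] F face_monomial_carrier by blast
      moreover have "Poly_Mapping.single (m - ?e) (Poly_Mapping.lookup f m) \<in> carrier (poly_ring K V)"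
        using F(1) by (auto simp: poly_ring_def F_def in_keys_iff lookup_minus)
      ultimately have "Poly_Mapping.single (m - ?e) (Poly_Mapping.lookup f m) \<otimes>\<^bsub>poly_ring K V\<^esub> face_monomial F
          \<in> stanley_reisner_ideal K V \<Delta>" by (rule I.I_l_closed)
      then show ?thesis using monomial_face_split[of m]
        by (simp add: poly_ring_def face_monomial_def mult_single F_def)
    qed
    note mono = this
    have "(\<Sum>m\<in>A. Poly_Mapping.single m (Poly_Mapping.lookup f m)) \<in> stanley_reisner_ideal K V \<Delta>"
      if "A \<subseteq> Poly_Mapping.keys f" for A
      using finite_subset[OF that finite_keys] that
    proof (induction A rule: finite_induct)
      case empty
      show ?case using I.zero_closed by (simp add: poly_ring_def)
    next
      case (insert m A)
      then show ?case using mono[of m] I.a_closed[of "Poly_Mapping.single m (Poly_Mapping.lookup f m)"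
            "\<Sum>m\<in>A. Poly_Mapping.single m (Poly_Mapping.lookup f m)"]
        by (simp add: poly_ring_def)
    qed
    from this[OF order_refl] show "f \<in> stanley_reisner_ideal K V \<Delta>" unfolding sum_monomials .
  qed
qed

text \<open>Restricting first gives a map defined on the full polynomial type, as
  \<open>localization_map_fraction\<close> needs; the variables outside V go to zero.\<close>

definition sr_hom :: "'k::field itself \<Rightarrow> 'v set \<Rightarrow> 'v set set \<Rightarrow> (('v \<Rightarrow>\<^sub>0 nat) \<Rightarrow>\<^sub>0 'k) \<Rightarrow> (('v \<Rightarrow>\<^sub>0 nat) \<Rightarrow>\<^sub>0 'k) set" where
  "sr_hom K V \<Delta> f = stanley_reisner_ideal K V \<Delta> +>\<^bsub>poly_ring K V\<^esub> restrict_vars V f"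

lemma sr_hom:
  fixes K :: "'k::field itself"
  assumes "simplicial_complex V \<Delta>"
  shows "carrier (stanley_reisner_ring K V \<Delta>) = range (sr_hom K V \<Delta>)"
    and "sr_hom K V \<Delta> (f + g) = sr_hom K V \<Delta> f \<oplus>\<^bsub>stanley_reisner_ring K V \<Delta>\<^esub> sr_hom K V \<Delta> g"
    and "sr_hom K V \<Delta> (f * g) = sr_hom K V \<Delta> f \<otimes>\<^bsub>stanley_reisner_ring K V \<Delta>\<^esub> sr_hom K V \<Delta> g"
    and "sr_hom K V \<Delta> 1 = \<one>\<^bsub>stanley_reisner_ring K V \<Delta>\<^esub>"
    and "sr_hom K V \<Delta> f = \<zero>\<^bsub>stanley_reisner_ring K V \<Delta>\<^esub> \<longleftrightarrow> f \<in> nonface_ideal \<Delta>"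
proof -
  interpret S: cring "poly_ring K V" by (rule poly_ring_cring)
  interpret I: ideal "stanley_reisner_ideal K V \<Delta>" "poly_ring K V" by (rule stanley_reisner_ideal_ideal)
  note c = restrict_vars_carrier[of V _ K]
  have "x \<in> range (restrict_vars V)" if "x \<in> carrier (poly_ring K V)" for x
    using that restrict_vars_id[of x V] by (metis (mono_tags, lifting) mem_Collect_eq partial_object.select_convs(1) poly_ring_def rangeI)
  then show "carrier (stanley_reisner_ring K V \<Delta>) = range (sr_hom K V \<Delta>)"
    unfolding stanley_reisner_ring_def FactRing_def A_RCOSETS_def' sr_hom_def using c by auto
  show "sr_hom K V \<Delta> (f + g) = sr_hom K V \<Delta> f \<oplus>\<^bsub>stanley_reisner_ring K V \<Delta>\<^esub> sr_hom K V \<Delta> g"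
    using I.a_rcos_sum[OF c c, of f g]
    by (simp add: stanley_reisner_ring_def FactRing_def sr_hom_def filter_keys_add) (simp add: poly_ring_def)
  show "sr_hom K V \<Delta> (f * g) = sr_hom K V \<Delta> f \<otimes>\<^bsub>stanley_reisner_ring K V \<Delta>\<^esub> sr_hom K V \<Delta> g"
    using I.rcoset_mult_add[OF c c, of f g]
    by (simp add: stanley_reisner_ring_def FactRing_def sr_hom_def restrict_vars_mult) (simp add: poly_ring_def)
  show "sr_hom K V \<Delta> 1 = \<one>\<^bsub>stanley_reisner_ring K V \<Delta>\<^esub>"
  proof -
    have "restrict_vars V 1 = \<one>\<^bsub>poly_ring K V\<^esub>" using restrict_vars_id[of 1 V] by (simp add: poly_ring_def)
    then show ?thesis by (simp add: stanley_reisner_ring_def FactRing_def sr_hom_def)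
  qed
  have "sr_hom K V \<Delta> f = \<zero>\<^bsub>stanley_reisner_ring K V \<Delta>\<^esub> \<longleftrightarrow> restrict_vars V f \<in> stanley_reisner_ideal K V \<Delta>"
    using I.rcos_const_imp_mem[OF c, of f] S.a_rcos_zero[OF I.is_ideal, of "restrict_vars V f"]
    by (simp add: stanley_reisner_ring_def FactRing_def sr_hom_def) blast
  also have "\<dots> \<longleftrightarrow> restrict_vars V f \<in> nonface_ideal \<Delta>"
    using stanley_reisner_ideal_eq[OF assms, of K] c by auto
  also have "\<dots> \<longleftrightarrow> f \<in> nonface_ideal \<Delta>"
  proof -
    have "\<Delta> \<subseteq> Pow V" using assms by (simp add: simplicial_complex_def)
    then show ?thesis by (auto simp: nonface_ideal_def keys_filter_keys)
  qed
  finally show "sr_hom K V \<Delta> f = \<zero>\<^bsub>stanley_reisner_ring K V \<Delta>\<^esub> \<longleftrightarrow> f \<in> nonface_ideal \<Delta>" .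
qed


section \<open>Hilbert's basis theorem\<close>

text \<open>\<open>nonface_ideal (Pow {})\<close> consists of the polynomials without constant term,
  a maximal ideal with residue field \<open>'k\<close>. This starts the induction of Hilbert's
  theorem.\<close>

lemma not_in_nonface_ideal_empty:
  fixes f :: "('v \<Rightarrow>\<^sub>0 nat) \<Rightarrow>\<^sub>0 'k::field"
  assumes "is_ideal I" "nonface_ideal (Pow {}) \<subseteq> I" "f \<in> I" "f \<notin> nonface_ideal (Pow {})"
  shows "I = UNIV"
proof -
  define c where "c = Poly_Mapping.lookup f 0"
  have c: "c \<noteq> 0" using assms(4) by (auto simp: nonface_ideal_def c_def in_keys_iff)
  have "f - Poly_Mapping.single 0 c \<in> nonface_ideal (Pow {})"
    by (auto simp: nonface_ideal_def in_keys_iff lookup_minus lookup_single when_def c_def split: if_splits)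
  then have "f - (f - Poly_Mapping.single 0 c) \<in> I"
    by (rule is_ideal_diff[OF assms(1,3) subsetD[OF assms(2)]])
  then have "Poly_Mapping.single 0 c \<in> I" by simp
  then have "Poly_Mapping.single 0 (1 / c) * Poly_Mapping.single 0 c \<in> I"
    by (rule is_ideal_mult[OF assms(1)])
  then have "1 \<in> I" using c by (simp add: mult_single)
  then show ?thesis using is_ideal_mult[OF assms(1), of 1] by auto
qed

lemma noetherian_above_nonface_ideal_empty:
  "noetherian_above (nonface_ideal (Pow {}) :: (('v \<Rightarrow>\<^sub>0 nat) \<Rightarrow>\<^sub>0 'k::field) set)"
  unfolding noetherian_above_def
proof (intro allI impI)
  fix I :: "nat \<Rightarrow> (('v \<Rightarrow>\<^sub>0 nat) \<Rightarrow>\<^sub>0 'k) set"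
  assume *: "\<forall>n. is_ideal (I n) \<and> nonface_ideal (Pow {}) \<subseteq> I n \<and> I n \<subseteq> I (Suc n)"
  have dich: "I n = nonface_ideal (Pow {}) \<or> I n = UNIV" for n
    using not_in_nonface_ideal_empty[of "I n"] * by blast
  show "\<exists>n. \<forall>m\<ge>n. I m = I n"
  proof (cases "\<exists>n. I n = UNIV")
    case True
    then obtain n where n: "I n = UNIV" by blast
    have "I n \<subseteq> I m" if "n \<le> m" for m
      by (rule lift_Suc_mono_le[of I, OF _ that]) (use * in blast)
    then show ?thesis using n by blast
  next
    case False
    then show ?thesis using dich by metis
  qed
qed

text \<open>The ideal of leading coefficients from Hilbert's proof. Adding
  \<open>nonface_ideal (Pow V)\<close> makes it an ideal of the full type to which the induction
  hypothesis for V applies.\<close>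

definition lead_ideal :: "'v \<Rightarrow> 'v set \<Rightarrow> nat \<Rightarrow> (('v \<Rightarrow>\<^sub>0 nat) \<Rightarrow>\<^sub>0 'k::comm_ring_1) set \<Rightarrow>
    (('v \<Rightarrow>\<^sub>0 nat) \<Rightarrow>\<^sub>0 'k) set" where
  "lead_ideal v V n I = {coef v n g + e | g e. g \<in> I \<and> (\<forall>i>n. coef v i g = 0) \<and> e \<in> nonface_ideal (Pow V)}"

lemma is_ideal_lead_ideal:
  fixes I :: "(('v \<Rightarrow>\<^sub>0 nat) \<Rightarrow>\<^sub>0 'k::comm_ring_1) set"
  assumes "is_ideal I" "v \<notin> V"
  shows "is_ideal (lead_ideal v V n I)"
  unfolding is_ideal_def
proof (intro conjI ballI allI)
  note S = is_ideal_nonface_ideal_Pow[of V]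
  have "0 = coef v n 0 + (0 :: ('v \<Rightarrow>\<^sub>0 nat) \<Rightarrow>\<^sub>0 'k)" by simp
  then show "0 \<in> lead_ideal v V n I"
    unfolding lead_ideal_def using is_ideal_zero[OF assms(1)] is_ideal_zero[OF S] by (smt (verit) coef_zero mem_Collect_eq)
next
  note S = is_ideal_nonface_ideal_Pow[of V]
  fix a b assume "a \<in> lead_ideal v V n I" "b \<in> lead_ideal v V n I"
  then obtain g e h d where *: "a = coef v n g + e" "b = coef v n h + d" "g \<in> I" "h \<in> I"
    "\<forall>i>n. coef v i g = 0" "\<forall>i>n. coef v i h = 0" "e \<in> nonface_ideal (Pow V)" "d \<in> nonface_ideal (Pow V)"
    unfolding lead_ideal_def by blast
  have "a + b = coef v n (g + h) + (e + d)" by (simp add: * coef_add)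
  moreover have "\<forall>i>n. coef v i (g + h) = 0" using * by (simp add: coef_add)
  ultimately show "a + b \<in> lead_ideal v V n I"
    unfolding lead_ideal_def using is_ideal_add[OF assms(1) *(3,4)] is_ideal_add[OF S *(7,8)] by blast
next
  note S = is_ideal_nonface_ideal_Pow[of V]
  fix a r :: "('v \<Rightarrow>\<^sub>0 nat) \<Rightarrow>\<^sub>0 'k"
  assume "a \<in> lead_ideal v V n I"
  then obtain g e where *: "a = coef v n g + e" "g \<in> I" "\<forall>i>n. coef v i g = 0" "e \<in> nonface_ideal (Pow V)"
    unfolding lead_ideal_def by blast
  have vf: "vfree v (restrict_vars V r)"
    using assms(2) by (auto simp: vfree_def keys_filter_keys in_keys_iff)
  \<comment> \<open>Only a v-free factor can be moved into \<open>coef\<close>; the rest of r goes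
    into the summand from \<open>nonface_ideal (Pow V)\<close>.\<close>
  have "r * a = coef v n (restrict_vars V r * g) + ((r - restrict_vars V r) * coef v n g + r * e)"
    unfolding coef_mult_vfree[OF vf] by (simp add: * algebra_simps)
  moreover have "\<forall>i>n. coef v i (restrict_vars V r * g) = 0" using * by (simp add: coef_mult_vfree[OF vf])
  moreover have "(r - restrict_vars V r) * coef v n g + r * e \<in> nonface_ideal (Pow V)"
    by (intro is_ideal_add[OF S] is_ideal_mult[OF S *(4)] is_ideal_mult2[OF S diff_restrict_vars])
  moreover have "restrict_vars V r * g \<in> I" using is_ideal_mult[OF assms(1) *(2)] .
  ultimately show "r * a \<in> lead_ideal v V n I" unfolding lead_ideal_def by blast
qed

lemma nonface_ideal_subset_lead_ideal: "is_ideal I \<Longrightarrow> nonface_ideal (Pow V) \<subseteq> lead_ideal v V n I"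
proof
  fix e :: "('a \<Rightarrow>\<^sub>0 nat) \<Rightarrow>\<^sub>0 'b" assume "is_ideal I" "e \<in> nonface_ideal (Pow V)"
  moreover have "e = coef v n 0 + e" by simp
  ultimately show "e \<in> lead_ideal v V n I"
    unfolding lead_ideal_def
    by (intro CollectI exI[of _ 0] exI[of _ e]) (simp add: is_ideal_zero)
qed

lemma lead_ideal_mono: "I \<subseteq> J \<Longrightarrow> lead_ideal v V n I \<subseteq> lead_ideal v V n J"
  unfolding lead_ideal_def by blast

lemma lead_ideal_Suc: assumes "is_ideal I" shows "lead_ideal v V n I \<subseteq> lead_ideal v V (Suc n) I"
proof
  fix a assume "a \<in> lead_ideal v V n I"
  then obtain g e where *: "a = coef v n g + e" "g \<in> I" "\<forall>i>n. coef v i g = 0" "e \<in> nonface_ideal (Pow V)"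
    unfolding lead_ideal_def by blast
  have "a = coef v (Suc n) (var v * g) + e" by (simp add: * coef_var_mult)
  moreover have "\<forall>i>Suc n. coef v i (var v * g) = 0" using * by (simp add: coef_var_mult)
  moreover have "var v * g \<in> I" using is_ideal_mult[OF assms *(2)] .
  ultimately show "a \<in> lead_ideal v V (Suc n) I" unfolding lead_ideal_def using *(4) by blast
qed

text \<open>Descent on the degree in v: an element of J loses its leading coefficient when a
  suitable element of I is subtracted.\<close>

lemma lead_ideal_determines:
  fixes I J :: "(('v \<Rightarrow>\<^sub>0 nat) \<Rightarrow>\<^sub>0 'k::comm_ring_1) set"
  assumes "is_ideal I" "is_ideal J" "nonface_ideal (Pow (insert v V)) \<subseteq> I" "I \<subseteq> J"
    and "\<And>n. lead_ideal v V n J \<subseteq> lead_ideal v V n I"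
  shows "J \<subseteq> I"
proof -
  have "g \<in> I" if "g \<in> J" "\<forall>i\<ge>n. coef v i g = 0" for n g
    using that
  proof (induction n arbitrary: g)
    case 0
    then have "g = 0" by (intro coef_all_zero) auto
    then show ?case using is_ideal_zero[OF assms(1)] by simp
  next
    case (Suc n)
    have "coef v n g \<in> lead_ideal v V n J"
      unfolding lead_ideal_def using Suc.prems is_ideal_zero[OF is_ideal_nonface_ideal_Pow]
      by (intro CollectI exI[of _ g] exI[of _ 0]) auto
    then obtain h e where h: "coef v n g = coef v n h + e" "h \<in> I" "\<forall>i>n. coef v i h = 0" "e \<in> nonface_ideal (Pow V)"
      using assms(5) unfolding lead_ideal_def by blast
    have e: "e = coef v n (g - h)" using h(1) by (simp add: coef_diff)
    then have vf: "vfree v e" using vfree_coef by metis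
    \<comment> \<open>\<open>e\<close> does not involve v, so a support not contained in V is not
      contained in \<open>insert v V\<close> either.\<close>
    have "e \<in> nonface_ideal (Pow (insert v V))"
      using h(4) vf unfolding nonface_ideal_def vfree_def by (auto simp: in_keys_iff)
    then have eI: "var v ^ n * e \<in> I" using assms(1,3) is_ideal_mult by blast
    have "g - h - var v ^ n * e \<in> I"
    proof (rule Suc.IH)
      show "g - h - var v ^ n * e \<in> J" using assms(4) Suc.prems(1) h(2) eI
        by (intro is_ideal_diff[OF assms(2)]) auto
      show "\<forall>i\<ge>n. coef v i (g - h - var v ^ n * e) = 0"
      proof (intro allI impI)
        fix i assume "n \<le> i"
        then show "coef v i (g - h - var v ^ n * e) = 0"
          using Suc.prems(2) h(1,3) by (cases "i = n") (auto simp: coef_diff coef_var_power_vfree[OF vf])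
      qed
    qed
    then have "(g - h - var v ^ n * e) + (h + var v ^ n * e) \<in> I"
      using h(2) eI by (intro is_ideal_add[OF assms(1)])
    then show ?case by simp
  qed
  then show ?thesis using coef_eventually_zero[of v] by (meson subsetI)
qed

theorem hilbert_basis:
  assumes "finite V"
  shows "noetherian_above (nonface_ideal (Pow V) :: (('v \<Rightarrow>\<^sub>0 nat) \<Rightarrow>\<^sub>0 'k::field) set)"
  using assms
proof (induction V rule: finite_induct)
  case empty
  show ?case by (rule noetherian_above_nonface_ideal_empty)
next
  case (insert v V)
  show ?case
    unfolding noetherian_above_def
  proof (intro allI impI)
    fix I :: "nat \<Rightarrow> (('v \<Rightarrow>\<^sub>0 nat) \<Rightarrow>\<^sub>0 'k) set"
    assume *: "\<forall>n. is_ideal (I n) \<and> nonface_ideal (Pow (insert v V)) \<subseteq> I n \<and> I n \<subseteq> I (Suc n)"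
    have I: "is_ideal (I n)" "nonface_ideal (Pow (insert v V)) \<subseteq> I n" for n using * by auto
    have Imono: "I n \<subseteq> I m" if "n \<le> m" for n m
      by (rule lift_Suc_mono_le[of I, OF _ that]) (use * in blast)
    define L where "L n k = lead_ideal v V n (I k)" for n k
    have L: "is_ideal (L n k)" "nonface_ideal (Pow V) \<subseteq> L n k" for n k
      unfolding L_def using is_ideal_lead_ideal[OF I(1) insert.hyps(2)] nonface_ideal_subset_lead_ideal[OF I(1)] by auto
    have L1: "L n k \<subseteq> L m k" if "n \<le> m" for n m k
      by (rule lift_Suc_mono_le[of "\<lambda>n. L n k", OF _ that])
        (unfold L_def, rule lead_ideal_Suc[OF I(1)])
    have L2: "L n k \<subseteq> L n m" if "k \<le> m" for n m k
      unfolding L_def by (rule lead_ideal_mono[OF Imono[OF that]])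
    have stab: "\<exists>n. \<forall>m\<ge>n. D m = D n"
      if "\<And>n. is_ideal (D n)" "\<And>n. nonface_ideal (Pow V) \<subseteq> D n" "\<And>n. D n \<subseteq> D (Suc n)"
      for D :: "nat \<Rightarrow> (('v \<Rightarrow>\<^sub>0 nat) \<Rightarrow>\<^sub>0 'k) set"
      using insert.IH that unfolding noetherian_above_def by blast
    have "L n n \<subseteq> L (Suc n) (Suc n)" for n using L1[of n "Suc n" n] L2[of n "Suc n" "Suc n"] by auto
    \<comment> \<open>The diagonal settles all degrees from N on at once. The finitely many smaller
      degrees have their own bounds \<open>K n\<close>, so a common \<open>M\<close> exists.\<close>
    from stab[of "\<lambda>n. L n n", OF L this] obtain N where N: "\<And>m. m \<ge> N \<Longrightarrow> L m m = L N N" by blast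
    have "\<exists>K. \<forall>m\<ge>K. L n m = L n K" for n by (rule stab) (use L L2 in auto)
    then obtain K where K: "\<And>n m. m \<ge> K n \<Longrightarrow> L n m = L n (K n)" by metis
    define M where "M = Max (insert N (K ` {..<N}))"
    have M: "N \<le> M" "\<And>n. n < N \<Longrightarrow> K n \<le> M" unfolding M_def by (auto intro: Max_ge)
    have "L n m \<subseteq> L n M" if m: "M \<le> m" for n m
    proof (cases "n < N")
      case True
      then have "K n \<le> M" "K n \<le> m" using M(2)[of n] m by auto
      then have "L n m = L n M" using K[of n m] K[of n M] by (simp only:)
      then show ?thesis by (simp only: order_refl)
    next
      case False
      have "L n m \<subseteq> L (max n m) m" by (rule L1) simp
      also have "\<dots> \<subseteq> L (max n m) (max n m)" by (rule L2) simp
      also have "\<dots> = L N N" by (rule N) (use False in simp)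
      also have "\<dots> \<subseteq> L n N" by (rule L1) (use False in simp)
      also have "\<dots> \<subseteq> L n M" by (rule L2[OF M(1)])
      finally show ?thesis .
    qed
    then have "I m \<subseteq> I M" if "M \<le> m" for m
      using lead_ideal_determines[OF I(1) I(1) I(2) Imono[OF that]] that unfolding L_def by blast
    then show "\<exists>n. \<forall>m\<ge>n. I m = I n" using Imono by blast
  qed
qed


section \<open>Regular sequences in polynomial rings\<close>

text \<open>Stronger than homogeneity in v: \<open>coef\<close> strips off the power of v, so an
  ideal with this property is generated by its v-free elements.\<close>

definition graded :: "'v \<Rightarrow> (('v \<Rightarrow>\<^sub>0 nat) \<Rightarrow>\<^sub>0 'k::zero) set \<Rightarrow> bool" where
  "graded v J \<longleftrightarrow> (\<forall>f\<in>J. \<forall>k. coef v k f \<in> J)"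

lemma graded_nonface_ideal_Pow: "v \<in> F \<Longrightarrow> graded v (nonface_ideal (Pow F))"
  unfolding graded_def
proof (intro ballI allI)
  fix f :: "('a \<Rightarrow>\<^sub>0 nat) \<Rightarrow>\<^sub>0 'b" and k assume v: "v \<in> F" and f: "f \<in> nonface_ideal (Pow F)"
  show "coef v k f \<in> nonface_ideal (Pow F)"
    unfolding nonface_ideal_def
  proof (intro CollectI ballI)
    fix m assume "m \<in> Poly_Mapping.keys (coef v k f)"
    then have "m + Poly_Mapping.single v k \<in> Poly_Mapping.keys f"
      by (auto simp: in_keys_iff lookup_coef when_def split: if_splits)
    then have "\<not> Poly_Mapping.keys (m + Poly_Mapping.single v k) \<subseteq> F" using f by (auto simp: nonface_ideal_def)
    then show "Poly_Mapping.keys m \<notin> Pow F" using v by (auto simp: keys_add_nat split: if_splits)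
  qed
qed

lemma graded_adjoin:
  fixes J :: "(('v \<Rightarrow>\<^sub>0 nat) \<Rightarrow>\<^sub>0 'k::comm_ring_1) set"
  assumes "graded v J" "vfree v a"
  shows "graded v (adjoin J a UNIV)"
  unfolding graded_def
proof (intro ballI allI)
  fix f k assume "f \<in> adjoin J a UNIV"
  then obtain j i where f: "f = j + a * i" "j \<in> J" unfolding adjoin_def by blast
  have "coef v k f = coef v k j + a * coef v k i" by (simp add: f coef_add coef_mult_vfree[OF assms(2)])
  then show "coef v k f \<in> adjoin J a UNIV" using assms(1) f(2) unfolding adjoin_def graded_def by blast
qed

lemma coef_lead_mult:
  fixes f g :: "('v \<Rightarrow>\<^sub>0 nat) \<Rightarrow>\<^sub>0 'k::comm_ring_1"
  assumes "\<forall>i>d. coef v i f = 0" "\<forall>i>n. coef v i g = 0"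
  shows "coef v (d + n) (f * g) = coef v d f * coef v n g"
proof -
  have "\<forall>i\<ge>Suc d. coef v i f = 0" using assms(1) Suc_le_eq by blast
  from coef_expansion[OF this]
  have "f * g = (\<Sum>k<Suc d. coef v k f * var v ^ k) * g" by (rule arg_cong)
  also have "\<dots> = (\<Sum>k<Suc d. coef v k f * (var v ^ k * g))"
    by (simp add: sum_distrib_right mult.assoc del: sum.lessThan_Suc)
  finally have "coef v (d + n) (f * g) = (\<Sum>k<Suc d. coef v (d + n) (coef v k f * (var v ^ k * g)))"
    by (simp only: coef_sum)
  also have "\<dots> = (\<Sum>k<Suc d. coef v k f * coef v (d + n - k) g)"
    by (intro sum.cong refl) (auto simp: coef_mult_vfree[OF vfree_coef] coef_var_power_mult)
  also have "\<dots> = (\<Sum>k<Suc d. if k = d then coef v d f * coef v n g else 0)"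
    using assms(2) by (intro sum.cong refl) auto
  also have "\<dots> = coef v d f * coef v n g" by simp
  finally show ?thesis .
qed

locale polynomial_prime = prime_ideal_at p for p :: "(('v \<Rightarrow>\<^sub>0 nat) \<Rightarrow>\<^sub>0 'k::field) set"
begin

text \<open>Since \<open>J\<close> is graded in \<open>v\<close>, the leading coefficient of \<open>g\<close> is killed modulo \<open>J\<close> by that of \<open>f\<close>,
  which is a unit at \<open>p\<close>.\<close>

lemma regular_on_lead_coef:
  assumes J: "is_ideal J" "graded v J" and f: "coef v d f \<notin> p" "\<forall>i>d. coef v i f = 0"
  shows "regular_on f UNIV J"
  unfolding regular_on_def
proof (intro ballI impI)
  fix a assume "f * a \<in> sat J"
  then obtain u where u: "u \<notin> p" "u * (f * a) \<in> J" unfolding sat_def by blast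
  define c where "c = coef v d f"
  have cfree: "vfree v c" unfolding c_def by (rule vfree_coef)
  \<comment> \<open>Each induction step spends one factor \<open>c\<close>: the top term
    \<open>var v ^ n * h\<close> of \<open>c * g\<close> lies in J, and removing it lowers the
    degree in v.\<close>
  have "c ^ n * g \<in> J" if "\<forall>i\<ge>n. coef v i g = 0" "f * g \<in> J" for n g
    using that
  proof (induction n arbitrary: g)
    case 0
    then have "g = 0" by (intro coef_all_zero) auto
    then show ?case using is_ideal_zero[OF J(1)] by simp
  next
    case (Suc n)
    define h where "h = c * coef v n g"
    have hfree: "vfree v h"
      using vfree_coef[of v 0 h] coef_mult_vfree[OF cfree, of 0 "coef v n g"] coef_vfree[OF vfree_coef, of v 0 n g]
      by (simp add: h_def)
    have "\<forall>i>n. coef v i g = 0" using Suc.prems(1) Suc_le_eq by blast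
    then have "h = coef v (d + n) (f * g)" unfolding h_def c_def using coef_lead_mult f(2) by metis
    then have h: "h \<in> J" using J(2) Suc.prems(2) unfolding graded_def by blast
    have "c ^ n * (c * g - var v ^ n * h) \<in> J"
    proof (rule Suc.IH)
      have "f * (c * g - var v ^ n * h) = c * (f * g) - (f * var v ^ n) * h" by (simp add: algebra_simps)
      also have "\<dots> \<in> J" by (rule is_ideal_lincomb_diff[OF J(1) Suc.prems(2) h])
      finally show "f * (c * g - var v ^ n * h) \<in> J" .
      show "\<forall>i\<ge>n. coef v i (c * g - var v ^ n * h) = 0"
      proof (intro allI impI)
        fix i assume "n \<le> i"
        then show "coef v i (c * g - var v ^ n * h) = 0"
          using Suc.prems(1) by (cases "i = n")
            (auto simp: coef_diff coef_mult_vfree[OF cfree] coef_var_power_vfree[OF hfree] simp flip: h_def)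
      qed
    qed
    then have "1 * (c ^ n * (c * g - var v ^ n * h)) + (c ^ n * var v ^ n) * h \<in> J"
      using h by (rule is_ideal_lincomb[OF J(1)])
    then show ?case by (simp add: algebra_simps)
  qed
  moreover obtain n where "\<forall>i\<ge>n. coef v i (u * a) = 0" using coef_eventually_zero[of v "u * a"] ..
  moreover have "f * (u * a) \<in> J" using u(2) by (simp add: mult.left_commute)
  ultimately have "c ^ n * (u * a) \<in> J" by blast
  moreover have "c ^ n \<notin> p" using f(1) one_p mult_p by (induction n) (auto simp: c_def)
  ultimately show "a \<in> sat J" unfolding sat_def using mult_p u(1) by (auto simp: mult.assoc[symmetric])
qed

text \<open>\<open>f v\<close> involves no other variable of the list, so adjoining it keeps the
  ideal graded in the remaining variables and the argument with leading coefficients can be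
  repeated.\<close>

lemma grade_ge_triangular:
  assumes "distinct vs" "is_ideal J" "\<forall>v\<in>set vs. graded v J"
    and "\<forall>v\<in>set vs. f v \<in> p \<and> (\<exists>d. coef v d (f v) \<notin> p \<and> (\<forall>i>d. coef v i (f v) = 0))"
    and "\<forall>v\<in>set vs. \<forall>w\<in>set vs. w \<noteq> v \<longrightarrow> vfree w (f v)"
  shows "grade_ge (length vs) UNIV J"
  using assms
proof (induction vs arbitrary: J)
  case (Cons v vs)
  have "regular_on (f v) UNIV J" using regular_on_lead_coef Cons.prems by auto
  moreover have "grade_ge (length vs) UNIV (adjoin J (f v) UNIV)"
  proof (rule Cons.IH)
    show "is_ideal (adjoin J (f v) UNIV)" using Cons.prems(2) is_ideal_UNIV by (rule is_ideal_adjoin)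
    show "\<forall>w\<in>set vs. graded w (adjoin J (f v) UNIV)"
    proof
      fix w assume w: "w \<in> set vs"
      then have "w \<noteq> v" using Cons.prems(1) by auto
      then show "graded w (adjoin J (f v) UNIV)" using Cons.prems w by (intro graded_adjoin) auto
    qed
  qed (use Cons.prems in auto)
  ultimately show ?case using Cons.prems(4) by auto
qed simp

text \<open>Algebraic independence over \<open>'k\<close> of the images of T in the residue field at
  p.\<close>

definition indep_vars :: "'v set \<Rightarrow> bool" where
  "indep_vars T \<longleftrightarrow> (\<forall>f\<in>p. (\<forall>m\<in>Poly_Mapping.keys f. Poly_Mapping.keys m \<subseteq> T) \<longrightarrow> f = 0)"

lemma exists_maximal_indep_vars:
  assumes "finite V"
  obtains T where "T \<subseteq> V" "indep_vars T" "\<And>v. v \<in> V \<Longrightarrow> indep_vars (insert v T) \<Longrightarrow> v \<in> T"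
proof -
  have "indep_vars {}"
    unfolding indep_vars_def
  proof (intro ballI impI, rule ccontr)
    fix f assume f: "f \<in> p" "\<forall>m\<in>Poly_Mapping.keys f. Poly_Mapping.keys m \<subseteq> {}" "f \<noteq> 0"
    define c where "c = Poly_Mapping.lookup f 0"
    have fc: "f = Poly_Mapping.single 0 c"
      using f(2) by (intro poly_mapping_eqI) (auto simp: c_def lookup_single when_def in_keys_iff)
    then have "c \<noteq> 0" using f(3) by auto
    then have "Poly_Mapping.single 0 (1 / c) * f = 1" by (simp add: fc mult_single)
    then show False using is_ideal_mult[OF ideal_p f(1)] one_p by metis
  qed
  then have "{} \<in> {T. T \<subseteq> V \<and> indep_vars T}" by simp
  moreover have "finite {T. T \<subseteq> V \<and> indep_vars T}" using assms by simp
  ultimately obtain T where T: "T \<in> {T. T \<subseteq> V \<and> indep_vars T}"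
    "\<forall>T'\<in>{T. T \<subseteq> V \<and> indep_vars T}. T \<subseteq> T' \<longrightarrow> T = T'"
    using finite_has_maximal[of "{T. T \<subseteq> V \<and> indep_vars T}"] by auto
  show thesis
  proof (rule that[of T])
    fix v assume "v \<in> V" "indep_vars (insert v T)"
    then have "insert v T \<in> {T. T \<subseteq> V \<and> indep_vars T}" using T(1) by blast
    then show "v \<in> T" using T(2) by blast
  qed (use T in auto)
qed

text \<open>Every variable outside \<open>T\<close> satisfies an algebraic equation over \<open>T\<close> modulo \<open>p\<close>; these equations form
  the regular sequence.\<close>

lemma grade_ge_polynomial_ring:
  assumes "finite F" "T \<subseteq> F" "indep_vars T" "\<And>v. v \<in> F \<Longrightarrow> indep_vars (insert v T) \<Longrightarrow> v \<in> T"
  shows "grade_ge (card F - card T) UNIV (nonface_ideal (Pow F))"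
proof -
  have "\<forall>v\<in>F - T. \<exists>f. f \<in> p \<and> f \<noteq> 0 \<and> (\<forall>m\<in>Poly_Mapping.keys f. Poly_Mapping.keys m \<subseteq> insert v T)"
  proof
    fix v assume "v \<in> F - T"
    then have "\<not> indep_vars (insert v T)" using assms(4) by blast
    then show "\<exists>f. f \<in> p \<and> f \<noteq> 0 \<and> (\<forall>m\<in>Poly_Mapping.keys f. Poly_Mapping.keys m \<subseteq> insert v T)" unfolding indep_vars_def by meson
  qed
  then obtain f where f: "\<forall>v\<in>F - T. f v \<in> p \<and> f v \<noteq> 0 \<and>
      (\<forall>m\<in>Poly_Mapping.keys (f v). Poly_Mapping.keys m \<subseteq> insert v T)"
    by (rule bchoice[THEN exE])
  obtain vs where vs: "set vs = F - T" "distinct vs"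
    using finite_distinct_list[of "F - T"] assms(1) by blast
  have "grade_ge (length vs) UNIV (nonface_ideal (Pow F))"
  proof (rule grade_ge_triangular[OF vs(2) is_ideal_nonface_ideal_Pow])
    show "\<forall>v\<in>set vs. graded v (nonface_ideal (Pow F))"
      unfolding vs(1) by (intro ballI graded_nonface_ideal_Pow) simp
    show "\<forall>v\<in>set vs. f v \<in> p \<and> (\<exists>d. coef v d (f v) \<notin> p \<and> (\<forall>i>d. coef v i (f v) = 0))"
    proof
      fix v assume "v \<in> set vs"
      then have fv: "f v \<in> p" "f v \<noteq> 0" "\<forall>m\<in>Poly_Mapping.keys (f v). Poly_Mapping.keys m \<subseteq> insert v T"
        using f vs(1) by auto
      obtain n where n: "\<forall>k\<ge>n. coef v k (f v) = 0" using coef_eventually_zero[of v "f v"] ..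
      \<comment> \<open>The leading coefficient in v is a nonzero polynomial in the variables of T,
        hence outside p by independence, as \<open>regular_on_lead_coef\<close> requires.\<close>
      define D where "D = {d. coef v d (f v) \<noteq> 0}"
      have "D \<subseteq> {..<n}" using n unfolding D_def by (auto simp: not_less[symmetric])
      then have fin: "finite D" by (rule finite_subset) simp
      have ne: "D \<noteq> {}" using coef_all_zero[of v "f v"] fv(2) unfolding D_def by blast
      have "coef v (Max D) (f v) \<noteq> 0" using Max_in[OF fin ne] by (simp add: D_def)
      moreover have "\<forall>m\<in>Poly_Mapping.keys (coef v (Max D) (f v)). Poly_Mapping.keys m \<subseteq> T"
        using keys_coef_subset[OF fv(3)] by blast
      ultimately have "coef v (Max D) (f v) \<notin> p" using assms(3) unfolding indep_vars_def by blast
      moreover have "\<forall>i>Max D. coef v i (f v) = 0"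
      proof (intro allI impI, rule ccontr)
        fix i assume "Max D < i" "coef v i (f v) \<noteq> 0"
        then show False using Max_ge[OF fin, of i] by (auto simp: D_def)
      qed
      ultimately show "f v \<in> p \<and> (\<exists>d. coef v d (f v) \<notin> p \<and> (\<forall>i>d. coef v i (f v) = 0))"
        using fv(1) by blast
    qed
    show "\<forall>v\<in>set vs. \<forall>w\<in>set vs. w \<noteq> v \<longrightarrow> vfree w (f v)"
    proof (intro ballI impI)
      fix v w assume *: "v \<in> set vs" "w \<in> set vs" "w \<noteq> v"
      then have w: "w \<notin> insert v T" using vs(1) by blast
      have "\<forall>m\<in>Poly_Mapping.keys (f v). Poly_Mapping.keys m \<subseteq> insert v T" using f vs(1) *(1) by blast
      then show "vfree w (f v)" unfolding vfree_def using w by (meson in_keys_iff subsetD)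
    qed
  qed
  moreover have "length vs = card F - card T"
    using distinct_card[OF vs(2)] vs(1) card_Diff_subset[OF finite_subset[OF assms(2,1)] assms(2)] by simp
  ultimately show ?thesis by simp
qed

end


section \<open>Lengths of chains of primes\<close>

lemma homogeneous_system_solvable:
  fixes a :: "'i \<Rightarrow> 'b \<Rightarrow> 'k::field"
  assumes "finite B" "finite A" "card B < card A"
  shows "\<exists>c. (\<exists>i\<in>A. c i \<noteq> 0) \<and> (\<forall>b\<in>B. (\<Sum>i\<in>A. c i * a i b) = 0)"
  using assms
proof (induction B arbitrary: A a rule: finite_induct)
  case empty
  then have "A \<noteq> {}" by auto
  then show ?case by (intro exI[of _ "\<lambda>_. 1"]) auto
next
  case (insert b B)
  show ?case
  proof (cases "\<forall>i\<in>A. a i b = 0")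
    case True
    then have "(\<Sum>i\<in>A. c i * a i b) = 0" for c by (intro sum.neutral) auto
    moreover obtain c where "(\<exists>i\<in>A. c i \<noteq> 0) \<and> (\<forall>b\<in>B. (\<Sum>i\<in>A. c i * a i b) = 0)"
      using insert.IH[of A a] insert.prems insert.hyps by auto
    ultimately show ?thesis by blast
  next
    case False
    then obtain i0 where i0: "i0 \<in> A" "a i0 b \<noteq> 0" by blast
    define A' where "A' = A - {i0}"
    define a' where "a' i x = a i x - a i b / a i0 b * a i0 x" for i x
    have "card B < card A'" "finite A'"
      using insert.prems insert.hyps i0 by (auto simp: A'_def)
    then obtain c where c: "\<exists>i\<in>A'. c i \<noteq> 0" "\<forall>x\<in>B. (\<Sum>i\<in>A'. c i * a' i x) = 0"
      using insert.IH[of A' a'] by blast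
    \<comment> \<open>The coefficient \<open>- s\<close> of \<open>i0\<close> solves equation b;
      eliminating \<open>i0\<close> from the other equations gives the matrix
      \<open>a'\<close>.\<close>
    define s where "s = (\<Sum>i\<in>A'. c i * a i b) / a i0 b"
    define d where "d i = (if i = i0 then - s else c i)" for i
    have split: "(\<Sum>i\<in>A. d i * a i x) = - s * a i0 x + (\<Sum>i\<in>A'. c i * a i x)" for x
    proof -
      have "(\<Sum>i\<in>A. d i * a i x) = d i0 * a i0 x + (\<Sum>i\<in>A'. d i * a i x)"
        unfolding A'_def by (rule sum.remove) (use insert.prems i0 in auto)
      also have "(\<Sum>i\<in>A'. d i * a i x) = (\<Sum>i\<in>A'. c i * a i x)"
        by (intro sum.cong refl) (auto simp: d_def A'_def)
      finally show ?thesis by (simp add: d_def)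
    qed
    have "(\<Sum>i\<in>A. d i * a i x) = 0" if "x \<in> insert b B" for x
    proof (cases "x = b")
      case True
      then show ?thesis using i0 by (simp add: split s_def)
    next
      case False
      then have "0 = (\<Sum>i\<in>A'. c i * a' i x)" using c(2) that by auto
      also have "\<dots> = (\<Sum>i\<in>A'. c i * a i x) - (\<Sum>i\<in>A'. (a i0 x / a i0 b) * (c i * a i b))"
        unfolding a'_def by (simp add: sum_subtractf[symmetric] algebra_simps)
      also have "(\<Sum>i\<in>A'. (a i0 x / a i0 b) * (c i * a i b)) = s * a i0 x"
        unfolding sum_distrib_left[symmetric] s_def by simp
      finally show ?thesis by (simp add: split)
    qed
    moreover have "\<exists>i\<in>A. d i \<noteq> 0" using c(1) by (auto simp: d_def A'_def)
    ultimately show ?thesis by blast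
  qed
qed

abbreviation const :: "'k::comm_ring_1 \<Rightarrow> (('v \<Rightarrow>\<^sub>0 nat) \<Rightarrow>\<^sub>0 'k)" where
  "const c \<equiv> Poly_Mapping.single 0 c"

definition lin_indep_mod :: "nat \<Rightarrow> (nat \<Rightarrow> (('v \<Rightarrow>\<^sub>0 nat) \<Rightarrow>\<^sub>0 'k::field)) \<Rightarrow> (('v \<Rightarrow>\<^sub>0 nat) \<Rightarrow>\<^sub>0 'k) set \<Rightarrow> bool" where
  "lin_indep_mod N g P \<longleftrightarrow> (\<forall>c. (\<Sum>i<N. const (c i) * g i) \<in> P \<longrightarrow> (\<forall>i<N. c i = 0))"

text \<open>Modulo Q only the terms without f survive in a relation, so their coefficients vanish.
  What remains is divisible by f, which is nonzero modulo the prime P. The index i encodes a member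
  of g together with an exponent below D.\<close>

lemma lin_indep_mod_powers:
  fixes P Q :: "(('v \<Rightarrow>\<^sub>0 nat) \<Rightarrow>\<^sub>0 'k::field) set"
  assumes "is_prime P" "is_prime Q" "P \<subseteq> Q" "f \<in> Q" "f \<notin> P" "lin_indep_mod N g Q"
  shows "lin_indep_mod (N * D) (\<lambda>i. g (i mod N) * f ^ (i div N)) P"
proof (induction D)
  case 0
  then show ?case by (simp add: lin_indep_mod_def)
next
  case (Suc D)
  have Q: "is_ideal Q" using assms(2) by (simp add: is_prime_def)
  let ?g = "\<lambda>i. g (i mod N) * f ^ (i div N)"
  show ?case
    unfolding lin_indep_mod_def
  proof (intro allI impI)
    fix c i assume c: "(\<Sum>i<N * Suc D. const (c i) * ?g i) \<in> P" and i: "i < N * Suc D"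
    have "{..<N * Suc D} = {..<N} \<union> {N..<N + N * D}" by auto
    then have "(\<Sum>i<N * Suc D. const (c i) * ?g i)
        = (\<Sum>i<N. const (c i) * ?g i) + (\<Sum>i\<in>{N..<N + N * D}. const (c i) * ?g i)"
      by (simp add: sum.union_disjoint ivl_disj_int)
    also have "(\<Sum>i<N. const (c i) * ?g i) = (\<Sum>i<N. const (c i) * g i)"
      by (intro sum.cong refl) auto
    also have "(\<Sum>i\<in>{N..<N + N * D}. const (c i) * ?g i) = (\<Sum>i<N * D. const (c (i + N)) * ?g (i + N))"
      using sum.shift_bounds_nat_ivl[of "\<lambda>i. const (c i) * ?g i" 0 N "N * D"]
      by (simp add: add.commute atLeast0LessThan)
    also have "\<dots> = f * (\<Sum>i<N * D. const (c (i + N)) * ?g i)"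
      unfolding sum_distrib_left
    proof (intro sum.cong refl)
      fix i assume "i \<in> {..<N * D}"
      then have "N > 0" by (cases N) auto
      then show "const (c (i + N)) * ?g (i + N) = f * (const (c (i + N)) * ?g i)"
        by (simp add: algebra_simps)
    qed
    finally have eq: "(\<Sum>i<N * Suc D. const (c i) * ?g i)
        = (\<Sum>i<N. const (c i) * g i) + f * (\<Sum>i<N * D. const (c (i + N)) * ?g i)" .
    have "(\<Sum>i<N. const (c i) * g i) \<in> Q"
    proof -
      have "(\<Sum>i<N. const (c i) * g i) + f * (\<Sum>i<N * D. const (c (i + N)) * ?g i)
          - f * (\<Sum>i<N * D. const (c (i + N)) * ?g i) \<in> Q"
        using c assms(3,4) unfolding eq by (intro is_ideal_diff[OF Q] is_ideal_mult2[OF Q]) auto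
      then show ?thesis by simp
    qed
    then have c0: "\<forall>i<N. c i = 0" using assms(6) unfolding lin_indep_mod_def by blast
    then have "(\<Sum>i<N. const (c i) * g i) = 0" by (intro sum.neutral) auto
    then have "f * (\<Sum>i<N * D. const (c (i + N)) * ?g i) \<in> P" using c unfolding eq by simp
    then have "(\<Sum>i<N * D. const (c (i + N)) * ?g i) \<in> P" using assms(1,5) unfolding is_prime_def by blast
    then have c1: "\<forall>i<N * D. c (i + N) = 0"
      using Suc.IH[unfolded lin_indep_mod_def, rule_format, of "\<lambda>i. c (i + N)"] by simp
    show "c i = 0"
    proof (cases "i < N")
      case True
      then show ?thesis using c0 by blast
    next
      case False
      then have "i - N < N * D" using i by auto
      then have "c (i - N + N) = 0" using c1 by blast
      then show ?thesis using False by simp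
    qed
  qed
qed

section \<open>Counting monomials\<close>

definition exp_bounded :: "nat \<Rightarrow> (('v \<Rightarrow>\<^sub>0 nat) \<Rightarrow>\<^sub>0 'k::comm_ring_1) \<Rightarrow> bool" where
  "exp_bounded e f \<longleftrightarrow> (\<forall>m\<in>Poly_Mapping.keys f. \<forall>v. Poly_Mapping.lookup m v \<le> e)"

lemma exp_bounded_mono: "exp_bounded d f \<Longrightarrow> d \<le> e \<Longrightarrow> exp_bounded e f"
  unfolding exp_bounded_def by (meson order_trans)

lemma exp_bounded_mult:
  assumes "exp_bounded d f" "exp_bounded e g"
  shows "exp_bounded (d + e) (f * g)"
  unfolding exp_bounded_def
proof (intro ballI allI)
  fix m v assume "m \<in> Poly_Mapping.keys (f * g)"
  then obtain a b where "m = a + b" "a \<in> Poly_Mapping.keys f" "b \<in> Poly_Mapping.keys g"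
    using keys_mult[of f g] by blast
  then show "Poly_Mapping.lookup m v \<le> d + e"
    using assms unfolding exp_bounded_def by (auto simp: lookup_add intro!: add_mono)
qed

lemma exp_bounded_power: "exp_bounded e f \<Longrightarrow> exp_bounded (k * e) (f ^ k)"
proof (induction k)
  case (Suc k)
  then show ?case using exp_bounded_mult[of e f "k * e" "f ^ k"] by simp
qed (simp add: exp_bounded_def)

lemma exp_bounded_exists: "\<exists>e. exp_bounded e f"
proof -
  define S where "S = (\<Union>m\<in>Poly_Mapping.keys f. Poly_Mapping.lookup m ` Poly_Mapping.keys m)"
  have "finite S" by (simp add: S_def)
  then obtain e where e: "\<forall>s\<in>S. s < e" by (meson finite_nat_set_iff_bounded)
  have "exp_bounded e f"
    unfolding exp_bounded_def
  proof (intro ballI allI)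
    fix m v assume m: "m \<in> Poly_Mapping.keys f"
    show "Poly_Mapping.lookup m v \<le> e"
    proof (cases "v \<in> Poly_Mapping.keys m")
      case True
      then have "Poly_Mapping.lookup m v \<in> S" using m by (auto simp: S_def)
      then show ?thesis using e by (simp add: less_imp_le)
    qed (simp add: in_keys_iff)
  qed
  then show ?thesis ..
qed

text \<open>Bounding each exponent separately instead of the total degree gives exactly
  \<open>D ^ card S\<close> monomials for finite S.\<close>

definition box :: "'v set \<Rightarrow> nat \<Rightarrow> ('v \<Rightarrow>\<^sub>0 nat) set" where
  "box S D = {m. Poly_Mapping.keys m \<subseteq> S \<and> (\<forall>v\<in>S. Poly_Mapping.lookup m v < D)}"

lemma card_box:
  assumes "finite S"
  shows "finite (box S D)" "card (box S D) = D ^ card S"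
proof -
  have "bij_betw (\<lambda>m. restrict (Poly_Mapping.lookup m) S) (box S D) (PiE S (\<lambda>_. {..<D}))"
  proof (rule bij_betw_imageI)
    show "inj_on (\<lambda>m. restrict (Poly_Mapping.lookup m) S) (box S D)"
    proof (rule inj_onI)
      fix a b assume *: "a \<in> box S D" "b \<in> box S D"
        "restrict (Poly_Mapping.lookup a) S = restrict (Poly_Mapping.lookup b) S"
      show "a = b"
      proof (rule poly_mapping_eqI)
        fix v
        show "Poly_Mapping.lookup a v = Poly_Mapping.lookup b v"
        proof (cases "v \<in> S")
          case True
          then show ?thesis using fun_cong[OF *(3), of v] by simp
        next
          case False
          then have "v \<notin> Poly_Mapping.keys a" "v \<notin> Poly_Mapping.keys b"
            using *(1,2) unfolding box_def by auto
          then show ?thesis by (simp add: in_keys_iff)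
        qed
      qed
    qed
    show "(\<lambda>m. restrict (Poly_Mapping.lookup m) S) ` box S D = PiE S (\<lambda>_. {..<D})"
    proof (intro equalityI subsetI)
      fix h assume "h \<in> (\<lambda>m. restrict (Poly_Mapping.lookup m) S) ` box S D"
      then show "h \<in> PiE S (\<lambda>_. {..<D})" by (auto simp: box_def)
    next
      fix h assume h: "h \<in> PiE S (\<lambda>_. {..<D})"
      define h' where "h' v = (if v \<in> S then h v else 0)" for v
      have "finite {v. h' v \<noteq> 0}" by (rule finite_subset[OF _ assms]) (auto simp: h'_def)
      then have look: "Poly_Mapping.lookup (Abs_poly_mapping h') = h'" by simp
      then have "Abs_poly_mapping h' \<in> box S D"
        using h by (auto simp: box_def in_keys_iff h'_def PiE_iff split: if_splits)
      moreover have "h = restrict (Poly_Mapping.lookup (Abs_poly_mapping h')) S"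
        unfolding look using h by (auto simp: h'_def restrict_def PiE_iff extensional_def)
      ultimately show "h \<in> (\<lambda>m. restrict (Poly_Mapping.lookup m) S) ` box S D" by blast
    qed
  qed
  from bij_betw_finite[OF this] bij_betw_same_card[OF this] show "finite (box S D)" "card (box S D) = D ^ card S"
    using assms by (auto simp: card_PiE finite_PiE)
qed

text \<open>Modulo P only monomials supported in G count, and those that occur lie in
  \<open>box G (Suc E)\<close>. More elements than such monomials would admit a nontrivial
  combination without any monomial supported in G, which therefore lies in P.\<close>

lemma lin_indep_mod_card_bound:
  fixes P :: "(('v \<Rightarrow>\<^sub>0 nat) \<Rightarrow>\<^sub>0 'k::field) set"
  assumes "finite G" "nonface_ideal (Pow G) \<subseteq> P" "lin_indep_mod N g P" "\<forall>i<N. exp_bounded E (g i)"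
  shows "N \<le> Suc E ^ card G"
proof (rule ccontr)
  assume "\<not> ?thesis"
  then have "card (box G (Suc E)) < card {..<N}" using card_box[OF assms(1)] by simp
  then obtain c where c: "\<exists>i\<in>{..<N}. c i \<noteq> 0"
    "\<forall>m\<in>box G (Suc E). (\<Sum>i\<in>{..<N}. c i * Poly_Mapping.lookup (g i) m) = 0"
    using homogeneous_system_solvable[of "box G (Suc E)" "{..<N}" "\<lambda>i. Poly_Mapping.lookup (g i)"]
      card_box[OF assms(1)] by auto
  have scale: "Poly_Mapping.lookup (const (x :: 'k) * f) m = x * Poly_Mapping.lookup f m"
    for x f and m :: "'v \<Rightarrow>\<^sub>0 nat"
    by (induction f rule: monomial_induct)
      (auto simp: mult_single lookup_single when_def distrib_left lookup_add)
  define s where "s = (\<Sum>i<N. const (c i) * g i)"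
  have ls: "Poly_Mapping.lookup s m = (\<Sum>i<N. c i * Poly_Mapping.lookup (g i) m)" for m
    unfolding s_def lookup_sum scale ..
  have "s \<in> nonface_ideal (Pow G)"
    unfolding nonface_ideal_def
  proof (intro CollectI ballI)
    fix m assume m: "m \<in> Poly_Mapping.keys s"
    show "Poly_Mapping.keys m \<notin> Pow G"
    proof
      assume mG: "Poly_Mapping.keys m \<in> Pow G"
      have "\<exists>i<N. m \<in> Poly_Mapping.keys (g i)"
      proof (rule ccontr)
        assume "\<not> ?thesis"
        then have "Poly_Mapping.lookup s m = 0" unfolding ls by (intro sum.neutral) (auto simp: in_keys_iff)
        then show False using m by (simp add: in_keys_iff)
      qed
      then have "m \<in> box G (Suc E)"
        using mG assms(4) unfolding box_def exp_bounded_def by (auto simp: less_Suc_eq_le)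
      then have "Poly_Mapping.lookup s m = 0" using c(2) unfolding ls by blast
      then show False using m by (simp add: in_keys_iff)
    qed
  qed
  then have "\<forall>i<N. c i = 0" using assms(2,3) unfolding lin_indep_mod_def s_def by blast
  then show False using c(1) by blast
qed

text \<open>\<open>e\<close> adds up exponent bounds of the elements chosen from the differences of
  the chain. It must not depend on D, because D is taken arbitrarily large in the final
  comparison.\<close>

lemma lin_indep_mod_chain:
  fixes Q :: "nat \<Rightarrow> (('v \<Rightarrow>\<^sub>0 nat) \<Rightarrow>\<^sub>0 'k::field) set"
  assumes "\<forall>k\<le>n. is_prime (Q k)" "\<forall>k<n. Q k \<subset> Q (Suc k)"
  shows "\<exists>e. \<forall>D N b g. lin_indep_mod N g (Q n) \<longrightarrow> (\<forall>i. exp_bounded b (g i)) \<longrightarrow>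
    (\<exists>h. lin_indep_mod (N * D ^ n) h (Q 0) \<and> (\<forall>i<N * D ^ n. exp_bounded (b + e * D) (h i)))"
  using assms
proof (induction n)
  case 0
  have "lin_indep_mod N g (Q 0) \<longrightarrow> (\<forall>i. exp_bounded b (g i)) \<longrightarrow>
    (\<exists>h. lin_indep_mod (N * D ^ 0) h (Q 0) \<and> (\<forall>i<N * D ^ 0. exp_bounded (b + 0 * D) (h i)))" for N b g D
    by auto
  then show ?case by blast
next
  case (Suc n)
  obtain e where e: "\<And>D N b g. lin_indep_mod N g (Q n) \<Longrightarrow> (\<forall>i. exp_bounded b (g i)) \<Longrightarrow>
    (\<exists>h. lin_indep_mod (N * D ^ n) h (Q 0) \<and> (\<forall>i<N * D ^ n. exp_bounded (b + e * D) (h i)))"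
    using Suc by auto
  have Q: "is_prime (Q n)" "is_prime (Q (Suc n))" "Q n \<subset> Q (Suc n)" using Suc.prems by auto
  then obtain f where f: "f \<in> Q (Suc n)" "f \<notin> Q n" by blast
  obtain d where d: "exp_bounded d f" using exp_bounded_exists by blast
  have "\<exists>h. lin_indep_mod (N * D ^ Suc n) h (Q 0) \<and>
      (\<forall>i<N * D ^ Suc n. exp_bounded (b + (d + e) * D) (h i))"
    if g: "lin_indep_mod N g (Q (Suc n))" "\<forall>i. exp_bounded b (g i)" for D N b g
  proof -
    \<comment> \<open>The induction hypothesis asks for an exponent bound at every index, which the
      powers \<open>f ^ (i div N)\<close> need not satisfy; hence the cut-off.\<close>
    define g' where "g' i = (if i < N * D then g (i mod N) * f ^ (i div N) else 0)" for i
    have 0: "lin_indep_mod (N * D) (\<lambda>i. g (i mod N) * f ^ (i div N)) (Q n)"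
      using lin_indep_mod_powers[OF Q(1,2) psubset_imp_subset[OF Q(3)] f g(1)] .
    have 1: "lin_indep_mod (N * D) g' (Q n)"
    proof -
      have "(\<Sum>i<N * D. const (c i) * g' i) = (\<Sum>i<N * D. const (c i) * (g (i mod N) * f ^ (i div N)))"
        for c by (intro sum.cong refl) (simp add: g'_def)
      then show ?thesis using 0 unfolding lin_indep_mod_def by simp
    qed
    have "exp_bounded (b + d * D) (g' i)" for i
    proof (cases "i < N * D")
      case True
      then have "i div N < D" by (simp add: less_mult_imp_div_less mult.commute)
      then have "exp_bounded (D * d) (f ^ (i div N))"
        using exp_bounded_power[OF d, of "i div N"] by (elim exp_bounded_mono) simp
      from exp_bounded_mult[OF g(2)[rule_format] this, of "i mod N"] show ?thesis
        using True by (simp add: g'_def mult.commute[of d])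
    qed (simp add: g'_def exp_bounded_def)
    from e[OF 1, of "b + d * D" D] this show ?thesis
      by (simp add: algebra_simps)
  qed
  then show ?case by blast
qed

lemma power_bound_exponent:
  fixes C :: nat
  assumes "\<And>D. D \<ge> 1 \<Longrightarrow> D ^ a \<le> (C * D) ^ b"
  shows "a \<le> b"
proof (rule ccontr)
  assume "\<not> a \<le> b"
  then have ab: "Suc b \<le> a" by simp
  \<comment> \<open>Dividing by \<open>D ^ b\<close> would bound D by \<open>C ^ b\<close>, so one
    more is enough.\<close>
  define D where "D = Suc (C ^ b)"
  have "D * D ^ b \<le> D ^ a" using power_increasing[OF ab, of D] by (simp add: D_def)
  also have "\<dots> \<le> C ^ b * D ^ b" using assms[of D] unfolding power_mult_distrib by (simp add: D_def)
  finally have "D \<le> C ^ b" by (simp add: D_def)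
  then show False by (simp add: D_def)
qed

text \<open>Monomials in \<open>T\<close> and in elements chosen from successive differences of the chain are linearly
  independent modulo \<open>Q 0\<close>. With all exponents below \<open>D\<close> there are \<open>D ^ (card T + n)\<close> of them, inside a
  space whose dimension is \<open>O(D ^ card G)\<close>.\<close>

theorem prime_chain_length_bound:
  fixes Q :: "nat \<Rightarrow> (('v \<Rightarrow>\<^sub>0 nat) \<Rightarrow>\<^sub>0 'k::field) set"
  assumes "\<forall>k\<le>n. is_prime (Q k)" "\<forall>k<n. Q k \<subset> Q (Suc k)"
    and "finite G" "nonface_ideal (Pow G) \<subseteq> Q 0" "finite T"
    and "\<forall>f\<in>Q n. (\<forall>m\<in>Poly_Mapping.keys f. Poly_Mapping.keys m \<subseteq> T) \<longrightarrow> f = 0"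
  shows "card T + n \<le> card G"
proof -
  obtain e where e: "\<And>D N b g. lin_indep_mod N g (Q n) \<Longrightarrow> (\<forall>i. exp_bounded b (g i)) \<Longrightarrow>
    (\<exists>h. lin_indep_mod (N * D ^ n) h (Q 0) \<and> (\<forall>i<N * D ^ n. exp_bounded (b + e * D) (h i)))"
    using lin_indep_mod_chain[OF assms(1,2)] by blast
  have "D ^ (card T + n) \<le> ((2 + e) * D) ^ card G" if D: "D \<ge> 1" for D
  proof -
    have card: "card (box T D) = D ^ card T" "finite (box T D)" using card_box[OF assms(5)] by auto
    obtain q where q: "bij_betw q {..<D ^ card T} (box T D)"
      using ex_bij_betw_nat_finite[OF card(2)] card(1) by (auto simp: atLeast0LessThan)
    define g where "g i = (if i < D ^ card T then Poly_Mapping.single (q i) (1::'k) else 0)" for i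
    have qb: "q i \<in> box T D" if "i < D ^ card T" for i using q that by (auto simp: bij_betw_def)
    have 1: "lin_indep_mod (D ^ card T) g (Q n)"
      unfolding lin_indep_mod_def
    proof (intro allI impI)
      fix c i assume c: "(\<Sum>i<D ^ card T. const (c i) * g i) \<in> Q n" and i: "i < D ^ card T"
      let ?s = "\<Sum>i<D ^ card T. Poly_Mapping.single (q i) (c i)"
      have eq: "(\<Sum>i<D ^ card T. const (c i) * g i) = ?s"
        by (intro sum.cong refl) (simp add: g_def mult_single)
      have "\<forall>m\<in>Poly_Mapping.keys ?s. Poly_Mapping.keys m \<subseteq> T"
      proof
        fix m assume "m \<in> Poly_Mapping.keys ?s"
        then have "(\<Sum>i<D ^ card T. Poly_Mapping.lookup (Poly_Mapping.single (q i) (c i)) m) \<noteq> 0"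
          by (simp add: in_keys_iff lookup_sum)
        then obtain k where "k < D ^ card T" "Poly_Mapping.lookup (Poly_Mapping.single (q k) (c k)) m \<noteq> 0"
          by (meson lessThan_iff sum.neutral)
        then show "Poly_Mapping.keys m \<subseteq> T"
          using qb[of k] by (auto simp: lookup_single when_def box_def split: if_splits)
      qed
      then have "?s = 0" using assms(6) c unfolding eq by blast
      then have "0 = Poly_Mapping.lookup ?s (q i)" by simp
      also have "\<dots> = (\<Sum>k<D ^ card T. if k = i then c i else 0)"
        unfolding lookup_sum
      proof (intro sum.cong refl)
        fix k assume "k \<in> {..<D ^ card T}"
        then have "q k = q i \<longleftrightarrow> k = i" using q i unfolding bij_betw_def inj_on_def by auto
        then show "Poly_Mapping.lookup (Poly_Mapping.single (q k) (c k)) (q i) = (if k = i then c i else 0)"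
          by (simp add: lookup_single when_def)
      qed
      also have "\<dots> = c i" using i by simp
      finally show "c i = 0" by simp
    qed
    have 2: "\<forall>i. exp_bounded D (g i)"
    proof
      fix i
      show "exp_bounded D (g i)"
      proof (cases "i < D ^ card T")
        case True
        have "Poly_Mapping.lookup (q i) v \<le> D" for v
        proof (cases "v \<in> T")
          case True
          then show ?thesis using qb[OF \<open>i < _\<close>] by (simp add: box_def less_imp_le)
        next
          case False
          then have "v \<notin> Poly_Mapping.keys (q i)" using qb[OF \<open>i < _\<close>] by (auto simp: box_def)
          then show ?thesis by (simp add: in_keys_iff)
        qed
        then show ?thesis using True by (simp add: g_def exp_bounded_def)
      qed (simp add: g_def exp_bounded_def)
    qed
    obtain h where h: "lin_indep_mod (D ^ card T * D ^ n) h (Q 0)"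
      "\<forall>i<D ^ card T * D ^ n. exp_bounded (D + e * D) (h i)" using e[OF 1 2, of D] by blast
    have "D ^ card T * D ^ n \<le> Suc (D + e * D) ^ card G"
      by (rule lin_indep_mod_card_bound[OF assms(3,4) h])
    \<comment> \<open>Since D \<ge> 1, 1 + D + e D \<le> (2 + e) D; this is the form that
      \<open>power_bound_exponent\<close> needs.\<close>
    also have "\<dots> \<le> ((2 + e) * D) ^ card G" using D by (intro power_mono) (auto simp: algebra_simps)
    finally show ?thesis by (simp add: power_add)
  qed
  then show ?thesis by (rule power_bound_exponent)
qed


section \<open>Removing facets\<close>

lemma lookup_monomial_mult:
  fixes f :: "('v \<Rightarrow>\<^sub>0 nat) \<Rightarrow>\<^sub>0 'k::comm_ring_1"
  shows "Poly_Mapping.lookup (Poly_Mapping.single e 1 * f) (e + m) = Poly_Mapping.lookup f m"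
  by (induction f rule: monomial_induct)
    (auto simp: mult_single lookup_single when_def distrib_left lookup_add)

lemma keys_monomial_mult:
  fixes f :: "('v \<Rightarrow>\<^sub>0 nat) \<Rightarrow>\<^sub>0 'k::comm_ring_1"
  shows "Poly_Mapping.keys (Poly_Mapping.single e 1 * f) = (\<lambda>m. e + m) ` Poly_Mapping.keys f"
proof (intro equalityI subsetI)
  fix x assume x: "x \<in> Poly_Mapping.keys (Poly_Mapping.single e 1 * f)"
  then obtain a b where "x = a + b" "a \<in> Poly_Mapping.keys (Poly_Mapping.single e (1::'k))" "b \<in> Poly_Mapping.keys f"
    using keys_mult[of "Poly_Mapping.single e 1" f] by blast
  then show "x \<in> (\<lambda>m. e + m) ` Poly_Mapping.keys f" by (auto split: if_splits)
next
  fix x assume "x \<in> (\<lambda>m. e + m) ` Poly_Mapping.keys f"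
  then show "x \<in> Poly_Mapping.keys (Poly_Mapping.single e 1 * f)"
    by (auto simp: in_keys_iff lookup_monomial_mult)
qed

lemma face_monomial_mult_keys:
  fixes f :: "('v \<Rightarrow>\<^sub>0 nat) \<Rightarrow>\<^sub>0 'k::field"
  assumes "finite F"
  shows "Poly_Mapping.keys ` Poly_Mapping.keys (face_monomial F * f)
    = (\<lambda>m. F \<union> Poly_Mapping.keys m) ` Poly_Mapping.keys f"
  unfolding face_monomial_def keys_monomial_mult
  by (simp add: image_image keys_add_nat keys_face_monomial[OF assms, simplified])

lemma nonface_ideal_iff: "f \<in> nonface_ideal \<Delta> \<longleftrightarrow> (\<forall>F\<in>Poly_Mapping.keys ` Poly_Mapping.keys f. F \<notin> \<Delta>)"
  by (simp add: nonface_ideal_def)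

text \<open>This is injectivity of K[F] \<rightarrow> K[\<Delta>]: the union of a facet F with A is
  a face only if A is contained in F.\<close>

lemma face_monomial_mult_nonface_ideal_iff:
  fixes f :: "('v \<Rightarrow>\<^sub>0 nat) \<Rightarrow>\<^sub>0 'k::field"
  assumes "finite F" "F \<in> \<Delta>" "\<forall>G\<in>\<Delta>. F \<subseteq> G \<longrightarrow> G = F"
  shows "face_monomial F * f \<in> nonface_ideal \<Delta> \<longleftrightarrow> f \<in> nonface_ideal (Pow F)"
proof -
  have "F \<union> A \<in> \<Delta> \<longleftrightarrow> A \<subseteq> F" for A using assms(2,3) by (auto simp: Un_absorb2)
  then show ?thesis unfolding nonface_ideal_iff face_monomial_mult_keys[OF assms(1)] by simp
qed

lemma face_monomial_quotient:
  fixes b :: "('v \<Rightarrow>\<^sub>0 nat) \<Rightarrow>\<^sub>0 'k::field"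
  assumes "finite F" "b \<in> nonface_ideal (\<Delta> - {F})"
  shows "\<exists>a. b - face_monomial F * a \<in> nonface_ideal \<Delta>"
proof -
  define e where "e = (\<Sum>v\<in>F. Poly_Mapping.single v (1::nat))"
  \<comment> \<open>The only face of \<Delta> that can be the support of a monomial of b is F, and a
    monomial with support F is divisible by that of F; \<open>a\<close> collects the
    quotients.\<close>
  define a where "a = Poly_Mapping.map_key (\<lambda>m. e + m) (filter_keys (\<lambda>m. Poly_Mapping.keys m = F) b)"
  have look: "Poly_Mapping.lookup a m = (Poly_Mapping.lookup b (e + m) when Poly_Mapping.keys (e + m) = F)" for m
    by (simp add: a_def map_key.rep_eq inj_def lookup_filter_keys)
  have fm: "face_monomial F = Poly_Mapping.single e 1" by (simp add: face_monomial_def e_def)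
  have "b - face_monomial F * a \<in> nonface_ideal \<Delta>"
    unfolding nonface_ideal_def
  proof (intro CollectI ballI notI)
    fix x assume x: "x \<in> Poly_Mapping.keys (b - face_monomial F * a)" "Poly_Mapping.keys x \<in> \<Delta>"
    show False
    proof (cases "Poly_Mapping.keys x = F")
      case True
      then have "x = e + (x - e)" using monomial_face_split[of x] by (simp add: e_def add.commute)
      then obtain m where m: "x = e + m" by blast
      then have "Poly_Mapping.lookup (b - face_monomial F * a) x = 0"
        using True by (simp add: fm lookup_minus lookup_monomial_mult look)
      then show False using x(1) by (simp add: in_keys_iff)
    next
      case False
      then have "x \<notin> Poly_Mapping.keys b" using assms(2) x(2) by (auto simp: nonface_ideal_def)
      then have "x \<in> Poly_Mapping.keys (face_monomial F * a)"
        using x(1) by (simp add: in_keys_iff lookup_minus)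
      then obtain m where "x = e + m" "m \<in> Poly_Mapping.keys a" unfolding fm keys_monomial_mult by blast
      then show False using False by (simp add: in_keys_iff look)
    qed
  qed
  then show ?thesis ..
qed

lemma is_ideal_nonface_ideal_complex: "simplicial_complex V \<Delta> \<Longrightarrow> is_ideal (nonface_ideal \<Delta>)"
  by (rule is_ideal_nonface_ideal) (simp add: simplicial_complex_def)

lemma simplicial_complex_remove_facet:
  assumes "simplicial_complex V \<Delta>" "\<forall>G\<in>\<Delta>. F \<subseteq> G \<longrightarrow> G = F"
  shows "simplicial_complex V (\<Delta> - {F})"
  using assms unfolding simplicial_complex_def by blast

lemma simplicial_complex_skeleton:
  assumes "simplicial_complex V \<Delta>"
  shows "simplicial_complex V (skeleton i \<Delta>)"
proof -
  have "card G \<le> card F" if "F \<in> \<Delta>" "G \<subseteq> F" for F G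
    using that assms by (intro card_mono) (auto simp: simplicial_complex_def intro: finite_subset)
  then have "face_dim G \<le> i" if "F \<in> \<Delta>" "G \<subseteq> F" "face_dim F \<le> i" for F G
    using that unfolding face_dim_def by (meson diff_right_mono of_nat_le_iff order_trans)
  then show ?thesis using assms unfolding simplicial_complex_def skeleton_def by blast
qed

lemma face_monomial_notin_prime:
  fixes Q :: "(('v \<Rightarrow>\<^sub>0 nat) \<Rightarrow>\<^sub>0 'k::field) set"
  assumes "is_prime Q" "finite G" "\<forall>v\<in>G. var v \<notin> Q"
  shows "face_monomial G \<notin> Q"
  using assms(2,3)
proof (induction G rule: finite_induct)
  case empty
  then show ?case using assms(1) by (simp add: face_monomial_def is_prime_def)
next
  case (insert v G)
  have "face_monomial (insert v G) = (var v * face_monomial G :: ('v \<Rightarrow>\<^sub>0 nat) \<Rightarrow>\<^sub>0 'k)"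
    using insert by (simp add: face_monomial_def var_def mult_single)
  then show ?case using insert assms(1) by (auto simp: is_prime_def)
qed

lemma nonface_ideal_Pow_subset_prime:
  fixes Q :: "(('v \<Rightarrow>\<^sub>0 nat) \<Rightarrow>\<^sub>0 'k::field) set"
  assumes "is_ideal Q" "\<And>v. v \<notin> G \<Longrightarrow> var v \<in> Q"
  shows "nonface_ideal (Pow G) \<subseteq> Q"
proof
  fix f :: "('v \<Rightarrow>\<^sub>0 nat) \<Rightarrow>\<^sub>0 'k" assume f: "f \<in> nonface_ideal (Pow G)"
  have "Poly_Mapping.single m (Poly_Mapping.lookup f m) \<in> Q" if m: "m \<in> Poly_Mapping.keys f" for m
  proof -
    obtain v where v: "v \<in> Poly_Mapping.keys m" "v \<notin> G" using f m unfolding nonface_ideal_def by blast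
    have "(m - Poly_Mapping.single v 1) + Poly_Mapping.single v 1 = m"
      using v(1) by (intro poly_mapping_eqI) (auto simp: lookup_add lookup_minus lookup_single when_def in_keys_iff)
    then have "Poly_Mapping.single m (Poly_Mapping.lookup f m)
        = Poly_Mapping.single (m - Poly_Mapping.single v 1) (Poly_Mapping.lookup f m) * var v"
      by (simp add: var_def mult_single)
    then show ?thesis using is_ideal_mult[OF assms(1) assms(2)[OF v(2)]] by simp
  qed
  then have "(\<Sum>m\<in>Poly_Mapping.keys f. Poly_Mapping.single m (Poly_Mapping.lookup f m)) \<in> Q"
    by (rule is_ideal_sum[OF assms(1)])
  then show "f \<in> Q" by (simp add: sum_monomials)
qed

section \<open>Grade under removal of facets and chains over a complex\<close>

context polynomial_prime
begin

lemma grade_ge_remove_facet: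
  assumes \<Delta>: "simplicial_complex V \<Delta>" and F: "F \<in> \<Delta>" "\<forall>G\<in>\<Delta>. F \<subseteq> G \<longrightarrow> G = F"
    and grade_ge: "grade_ge r UNIV (nonface_ideal \<Delta>)"
    and facet: "(\<forall>w. var w \<notin> p \<longrightarrow> w \<in> F) \<Longrightarrow> grade_ge (Suc r) UNIV (nonface_ideal (Pow F))"
  shows "grade_ge r UNIV (nonface_ideal (\<Delta> - {F}))"
proof -
  have fin: "finite F" "finite V" "F \<subseteq> V" "\<Delta> \<subseteq> Pow V"
    using \<Delta> F(1) finite_subset[of F V] by (auto simp: simplicial_complex_def)
  have down: "G \<in> \<Delta>" if "H \<in> \<Delta>" "G \<subseteq> H" for G H using \<Delta> that unfolding simplicial_complex_def by blast
  note id = is_ideal_nonface_ideal_complex[OF \<Delta>] is_ideal_nonface_ideal_complex[OF simplicial_complex_remove_facet[OF \<Delta> F(2)]]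
  have sub: "nonface_ideal \<Delta> \<subseteq> nonface_ideal (\<Delta> - {F})" by (rule nonface_ideal_antimono) blast
  show ?thesis
  proof (cases "\<forall>w. var w \<notin> p \<longrightarrow> w \<in> F")
    case False
    then obtain w where w: "var w \<notin> p" "w \<notin> F" by blast
    \<comment> \<open>For w outside the facet F, adding w to F gives a nonface, so
      \<open>var w\<close> kills the monomials with support F in K[\<Delta>]. As it is a unit at p,
      the term K[F] vanishes there and both rings have the same localization.\<close>
    have mult: "var w * f \<in> nonface_ideal \<Delta>" if f: "f \<in> nonface_ideal (\<Delta> - {F})" for f
      unfolding nonface_ideal_def
    proof (intro CollectI ballI notI)
      fix x assume x: "x \<in> Poly_Mapping.keys (var w * f)" "Poly_Mapping.keys x \<in> \<Delta>"
      then obtain m where m: "x = Poly_Mapping.single w 1 + m" "m \<in> Poly_Mapping.keys f"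
        unfolding var_def keys_monomial_mult by blast
      then have "Poly_Mapping.keys m \<in> \<Delta>" "w \<in> Poly_Mapping.keys x" "Poly_Mapping.keys m \<subseteq> Poly_Mapping.keys x"
        using x(2) down[of "Poly_Mapping.keys x" "Poly_Mapping.keys m"] by (auto simp: keys_add_nat)
      moreover have "Poly_Mapping.keys m \<notin> \<Delta> - {F}" using f m(2) by (auto simp: nonface_ideal_def)
      ultimately show False using F(2) x(2) w(2) by blast
    qed
    show ?thesis
    proof (rule grade_ge_iso[OF grade_ge is_ideal_UNIV id(1) is_ideal_UNIV id(2), of 1])
      fix a :: "('v \<Rightarrow>\<^sub>0 nat) \<Rightarrow>\<^sub>0 'k" assume "1 * a \<in> sat (nonface_ideal (\<Delta> - {F}))"
      then obtain u where u: "u \<notin> p" "u * a \<in> nonface_ideal (\<Delta> - {F})" unfolding sat_def by auto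
      then have "(var w * u) * a \<in> nonface_ideal \<Delta>" using mult by (simp add: mult.assoc)
      then show "a \<in> sat (nonface_ideal \<Delta>)" using mult_p[OF w(1) u(1)] unfolding sat_def by blast
    next
      fix a :: "('v \<Rightarrow>\<^sub>0 nat) \<Rightarrow>\<^sub>0 'k" assume "a \<in> nonface_ideal \<Delta>"
      then show "1 * a \<in> sat (nonface_ideal (\<Delta> - {F}))" using sub sat_superset[of "nonface_ideal (\<Delta> - {F})"] by auto
    next
      fix b :: "('v \<Rightarrow>\<^sub>0 nat) \<Rightarrow>\<^sub>0 'k"
      have "1 * b - 1 * b \<in> sat (nonface_ideal (\<Delta> - {F}))" using is_ideal_zero[OF is_ideal_sat[OF id(2)]] by simp
      then show "\<exists>u a. u \<notin> p \<and> a \<in> UNIV \<and> u * b - 1 * a \<in> sat (nonface_ideal (\<Delta> - {F}))" using one_p by blast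
    qed simp
  next
    case True
    note iff = face_monomial_mult_nonface_ideal_iff[OF fin(1) F]
    \<comment> \<open>Multiplication by the monomial of F identifies K[F] with the kernel of
      K[\<Delta>] \<rightarrow> K[\<Delta> - F], so the grade passes to that kernel.\<close>
    have "grade_ge (Suc r) (nonface_ideal (\<Delta> - {F})) (nonface_ideal \<Delta>)"
    proof (rule grade_ge_iso[OF facet[OF True] is_ideal_UNIV is_ideal_nonface_ideal_Pow id(2) id(1), of "face_monomial F"])
      fix a :: "('v \<Rightarrow>\<^sub>0 nat) \<Rightarrow>\<^sub>0 'k" assume "face_monomial F * a \<in> sat (nonface_ideal \<Delta>)"
      then obtain u where u: "u \<notin> p" "u * (face_monomial F * a) \<in> nonface_ideal \<Delta>" unfolding sat_def by blast
      then have "face_monomial F * (u * a) \<in> nonface_ideal \<Delta>" by (simp add: mult.left_commute)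
      then show "a \<in> sat (nonface_ideal (Pow F))" using u(1) iff unfolding sat_def by blast
    next
      fix a :: "('v \<Rightarrow>\<^sub>0 nat) \<Rightarrow>\<^sub>0 'k" assume "a \<in> nonface_ideal (Pow F)"
      then show "face_monomial F * a \<in> sat (nonface_ideal \<Delta>)" using iff sat_superset by blast
    next
      fix b :: "('v \<Rightarrow>\<^sub>0 nat) \<Rightarrow>\<^sub>0 'k" assume "b \<in> nonface_ideal (\<Delta> - {F})"
      then obtain a where "1 * b - face_monomial F * a \<in> nonface_ideal \<Delta>"
        using face_monomial_quotient[OF fin(1)] by (metis mult_1)
      then show "\<exists>u a. u \<notin> p \<and> a \<in> UNIV \<and> u * b - face_monomial F * a \<in> sat (nonface_ideal \<Delta>)"
        using one_p sat_superset by blast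
    next
      fix a :: "('v \<Rightarrow>\<^sub>0 nat) \<Rightarrow>\<^sub>0 'k"
      show "face_monomial F * a \<in> nonface_ideal (\<Delta> - {F})"
        unfolding nonface_ideal_iff face_monomial_mult_keys[OF fin(1)] using F(2) by blast
    qed
    then show ?thesis
      using grade_ge_quotient[OF hilbert_basis[OF fin(2)] is_ideal_UNIV id(2) id(1) nonface_ideal_antimono[OF fin(4)] sub _ grade_ge]
      by simp
  qed
qed

lemma grade_ge_skeleton:
  assumes "simplicial_complex V \<Delta>" "grade_ge r UNIV (nonface_ideal \<Delta>)"
    and "\<And>F. F \<in> \<Delta> \<Longrightarrow> i < face_dim F \<Longrightarrow> \<forall>w. var w \<notin> p \<longrightarrow> w \<in> F \<Longrightarrow> grade_ge (Suc r) UNIV (nonface_ideal (Pow F))"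
  shows "grade_ge r UNIV (nonface_ideal (skeleton i \<Delta>))"
  using assms
proof (induction "card (\<Delta> - skeleton i \<Delta>)" arbitrary: \<Delta>)
  case 0
  have "finite \<Delta>" using 0(2) by (auto simp: simplicial_complex_def intro: finite_subset)
  then have "skeleton i \<Delta> = \<Delta>" using 0(1) by (auto simp: skeleton_def)
  then show ?case using 0(3) by simp
next
  case (Suc n)
  have fin: "finite \<Delta>" "\<And>F. F \<in> \<Delta> \<Longrightarrow> finite F"
    using Suc.prems(1) by (auto simp: simplicial_complex_def intro: finite_subset)
  have ne: "\<Delta> - skeleton i \<Delta> \<noteq> {}" using Suc(2) by (metis card.empty nat.distinct(1))
  \<comment> \<open>A face outside the skeleton with the most vertices is a facet of all of
    \<Delta>, since any face containing it is outside the skeleton too.\<close>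
  have "Max (card ` (\<Delta> - skeleton i \<Delta>)) \<in> card ` (\<Delta> - skeleton i \<Delta>)"
    using ne fin(1) by (intro Max_in) auto
  then obtain F where F: "F \<in> \<Delta> - skeleton i \<Delta>" "card F = Max (card ` (\<Delta> - skeleton i \<Delta>))" by auto
  have Fi: "F \<in> \<Delta>" "i < face_dim F" using F(1) by (auto simp: skeleton_def)
  have facet: "\<forall>G\<in>\<Delta>. F \<subseteq> G \<longrightarrow> G = F"
  proof (intro ballI impI)
    fix G assume G: "G \<in> \<Delta>" "F \<subseteq> G"
    then have le: "card F \<le> card G" using fin(2) by (intro card_mono) auto
    then have "G \<in> \<Delta> - skeleton i \<Delta>" using Fi G by (auto simp: skeleton_def face_dim_def)
    then have "card G \<le> card F" unfolding F(2) using fin(1) by (intro Max_ge) auto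
    then have "card F = card G" by (rule order_antisym[OF le])
    then show "G = F" by (rule card_subset_eq[OF fin(2)[OF G(1)] G(2), symmetric])
  qed
  have sk: "skeleton i (\<Delta> - {F}) = skeleton i \<Delta>" using F(1) by (auto simp: skeleton_def)
  have "grade_ge r UNIV (nonface_ideal (\<Delta> - {F}))"
    using grade_ge_remove_facet[OF Suc.prems(1) Fi(1) facet Suc.prems(2)] Suc.prems(3)[OF Fi] by blast
  moreover have "n = card (\<Delta> - {F} - skeleton i (\<Delta> - {F}))"
  proof -
    have "\<Delta> - {F} - skeleton i (\<Delta> - {F}) = (\<Delta> - skeleton i \<Delta>) - {F}" unfolding sk by blast
    then show ?thesis using Suc(2) F(1) fin(1) by simp
  qed
  ultimately have "grade_ge r UNIV (nonface_ideal (skeleton i (\<Delta> - {F})))"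
    by (intro Suc(1) simplicial_complex_remove_facet[OF Suc.prems(1) facet] Suc.prems(3)) auto
  then show ?case unfolding sk .
qed

text \<open>The vertices whose variables lie outside \<open>Q 0\<close> form a face G, since
  otherwise the monomial of G would lie in this prime. The chain then lies above the ideal of K[G],
  where \<open>prime_chain_length_bound\<close> applies; T stays independent modulo
  \<open>Q n\<close> because \<open>Q n\<close> is contained in p.\<close>

lemma chain_face_bound:
  assumes \<Delta>: "simplicial_complex V \<Delta>"
    and Q: "\<forall>k\<le>n. is_prime (Q k) \<and> nonface_ideal \<Delta> \<subseteq> Q k \<and> Q k \<subseteq> p" "\<forall>k<n. Q k \<subset> Q (Suc k)"
    and T: "T \<subseteq> V" "indep_vars T"
  obtains G where "G \<in> \<Delta>" "card T + n \<le> card G"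
proof -
  define G where "G = {v \<in> V. var v \<notin> Q 0}"
  have Q0: "is_prime (Q 0)" "nonface_ideal \<Delta> \<subseteq> Q 0" using Q(1) by auto
  have finV: "finite V" "finite T" using \<Delta> T(1) by (auto simp: simplicial_complex_def intro: finite_subset)
  have finG: "finite G" using finV by (simp add: G_def)
  have "G \<in> \<Delta>"
  proof (rule ccontr)
    assume "G \<notin> \<Delta>"
    then have "face_monomial G \<in> nonface_ideal \<Delta>"
      using keys_face_monomial[OF finG] by (simp add: nonface_ideal_def face_monomial_def)
    then show False using face_monomial_notin_prime[OF Q0(1) finG] Q0(2) by (auto simp: G_def)
  qed
  moreover have "card T + n \<le> card G"
  proof (rule prime_chain_length_bound[OF _ Q(2) finG _ finV(2)])
    show "\<forall>k\<le>n. is_prime (Q k)" using Q(1) by blast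
    show "nonface_ideal (Pow G) \<subseteq> Q 0"
    proof (rule nonface_ideal_Pow_subset_prime)
      show "is_ideal (Q 0)" using Q0(1) by (simp add: is_prime_def)
      fix v assume v: "v \<notin> G"
      show "var v \<in> Q 0"
      proof (cases "v \<in> V")
        case False
        then have "var v \<in> nonface_ideal \<Delta>" using \<Delta> by (auto simp: nonface_ideal_def var_def simplicial_complex_def)
        then show ?thesis using Q0(2) by blast
      qed (use v in \<open>simp add: G_def\<close>)
    qed
    have "Q n \<subseteq> p" using Q(1) by simp
    then show "\<forall>f\<in>Q n. (\<forall>m\<in>Poly_Mapping.keys f. Poly_Mapping.keys m \<subseteq> T) \<longrightarrow> f = 0"
      using T(2) unfolding indep_vars_def by blast
  qed
  ultimately show thesis by (rule that)
qed

lemma grade_ge_skeleton_of_chain: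
  assumes \<Delta>: "simplicial_complex V \<Delta>" and grade_ge: "grade_ge r UNIV (nonface_ideal \<Delta>)"
    and Q: "\<forall>k\<le>n. is_prime (Q k) \<and> nonface_ideal (skeleton i \<Delta>) \<subseteq> Q k \<and> Q k \<subseteq> p" "\<forall>k<n. Q k \<subset> Q (Suc k)"
    and r: "r \<le> n"
  shows "grade_ge r UNIV (nonface_ideal (skeleton i \<Delta>))"
proof (rule grade_ge_skeleton[OF \<Delta> grade_ge])
  have finV: "finite V" using \<Delta> by (simp add: simplicial_complex_def)
  obtain T where T: "T \<subseteq> V" "indep_vars T" "\<And>v. v \<in> V \<Longrightarrow> indep_vars (insert v T) \<Longrightarrow> v \<in> T"
    using exists_maximal_indep_vars[OF finV] by blast
  obtain G where G: "G \<in> skeleton i \<Delta>" "card T + n \<le> card G"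
    by (rule chain_face_bound[OF simplicial_complex_skeleton[OF \<Delta>] Q T(1,2)])
  fix F assume F: "F \<in> \<Delta>" "i < face_dim F" "\<forall>w. var w \<notin> p \<longrightarrow> w \<in> F"
  have FV: "F \<subseteq> V" "finite F" using \<Delta> F(1) finV finite_subset[of F V] by (auto simp: simplicial_complex_def)
  \<comment> \<open>A variable of T is a nonzero polynomial in T, hence outside p; the condition on
    F puts its vertex into F.\<close>
  have TF: "T \<subseteq> F"
  proof
    fix t assume t: "t \<in> T"
    have "var t \<notin> p"
    proof
      assume "var t \<in> p"
      moreover have "\<forall>m\<in>Poly_Mapping.keys (var t :: ('v \<Rightarrow>\<^sub>0 nat) \<Rightarrow>\<^sub>0 'k). Poly_Mapping.keys m \<subseteq> T"
        using t by (simp add: var_def)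
      ultimately have "(var t :: ('v \<Rightarrow>\<^sub>0 nat) \<Rightarrow>\<^sub>0 'k) = 0" using T(2) unfolding indep_vars_def by blast
      then have "Poly_Mapping.lookup (var t :: ('v \<Rightarrow>\<^sub>0 nat) \<Rightarrow>\<^sub>0 'k) (Poly_Mapping.single t 1) = 0" by simp
      then show False by (simp add: var_def)
    qed
    then show "t \<in> F" using F(3) by blast
  qed
  have "grade_ge (card F - card T) UNIV (nonface_ideal (Pow F))"
    using T(3) FV(1) by (intro grade_ge_polynomial_ring[OF FV(2) TF T(2)]) blast
  \<comment> \<open>G has at most i + 1 vertices and F at least i + 2, so |F| - |T| \<ge> |G| + 1 -
    |T| \<ge> n + 1.\<close>
  moreover have "Suc r \<le> card F - card T" using G F(2) r by (auto simp: skeleton_def face_dim_def)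
  ultimately show "grade_ge (Suc r) UNIV (nonface_ideal (Pow F))" by (rule grade_ge_mono)
qed

end

section \<open>Transfer to the Stanley-Reisner rings\<close>

lemma primeideal_image:
  fixes R :: "('b, 'm) ring_scheme" and \<psi> :: "'a::comm_ring_1 \<Rightarrow> 'b"
  assumes R: "cring R" and p: "is_prime p" and ker: "{f. \<psi> f = \<zero>\<^bsub>R\<^esub>} \<subseteq> p"
    and range: "carrier R = range \<psi>" and add: "\<And>f g. \<psi> (f + g) = \<psi> f \<oplus>\<^bsub>R\<^esub> \<psi> g"
    and mult: "\<And>f g. \<psi> (f * g) = \<psi> f \<otimes>\<^bsub>R\<^esub> \<psi> g" and one: "\<psi> 1 = \<one>\<^bsub>R\<^esub>"
  shows "primeideal (\<psi> ` p) R" "{f. \<psi> f \<in> \<psi> ` p} = p"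
proof -
  interpret cring R by fact
  have c[simp]: "\<psi> f \<in> carrier R" for f using range by blast
  have zero: "\<psi> 0 = \<zero>\<^bsub>R\<^esub>" using add[of 0 0] by simp
  have pi: "is_ideal p" using p by (simp add: is_prime_def)
  have mem: "\<psi> f \<in> \<psi> ` p \<longleftrightarrow> f \<in> p" for f
  proof
    assume "\<psi> f \<in> \<psi> ` p"
    then obtain g where g: "g \<in> p" "\<psi> f = \<psi> g" by blast
    have "\<psi> (f - g) \<oplus>\<^bsub>R\<^esub> \<psi> g = \<psi> g" using add[of "f - g" g] g(2) by simp
    then have "\<psi> (f - g) = \<zero>\<^bsub>R\<^esub>" by simp
    then have "f - g \<in> p" using ker by blast
    then have "f - g + g \<in> p" using g(1) by (rule is_ideal_add[OF pi])
    then show "f \<in> p" by simp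
  qed simp
  then show "{f. \<psi> f \<in> \<psi> ` p} = p" by blast
  show "primeideal (\<psi> ` p) R"
  proof (rule primeidealI[OF idealI_closed R])
    show "cring R" by fact
    show "\<psi> ` p \<subseteq> carrier R" by auto
    show "\<zero>\<^bsub>R\<^esub> \<in> \<psi> ` p" using is_ideal_zero[OF pi] zero by (metis imageI)
    show "a \<oplus>\<^bsub>R\<^esub> b \<in> \<psi> ` p" if "a \<in> \<psi> ` p" "b \<in> \<psi> ` p" for a b
      using that is_ideal_add[OF pi] by (auto simp flip: add)
    show "x \<otimes>\<^bsub>R\<^esub> a \<in> \<psi> ` p" if "a \<in> \<psi> ` p" "x \<in> carrier R" for a x
      using that is_ideal_mult[OF pi] unfolding range by (auto simp flip: mult)
    show "carrier R \<noteq> \<psi> ` p"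
      using mem[of 1] p c[of 1] by (auto simp: is_prime_def)
    show "a \<in> \<psi> ` p \<or> b \<in> \<psi> ` p" if "a \<in> carrier R" "b \<in> carrier R" "a \<otimes>\<^bsub>R\<^esub> b \<in> \<psi> ` p" for a b
    proof -
      from that obtain f g where "a = \<psi> f" "b = \<psi> g" unfolding range by blast
      then show ?thesis using that(3) p by (simp add: mem is_prime_def flip: mult)
    qed
  qed
qed

theorem theorem8p4:
  fixes V :: "'v set" and \<Delta> :: "'v set set" and i j l :: int
  assumes "simplicial_complex V \<Delta>"
    and "i \<ge> 0" and "j \<ge> 0" and "2 \<le> l" and "l \<le> i + 1"
    and "serre_condition l j (stanley_reisner_ring TYPE('k::field) V \<Delta>)"
  shows "serre_condition l j (stanley_reisner_ring TYPE('k) V (skeleton i \<Delta>))"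
  unfolding serre_condition_def
proof (intro allI impI)
  let ?K = "TYPE('k)" and ?S = "skeleton i \<Delta>"
  let ?R = "stanley_reisner_ring ?K V \<Delta>" and ?R' = "stanley_reisner_ring ?K V ?S"
  have S: "simplicial_complex V ?S" by (rule simplicial_complex_skeleton[OF assms(1)])
  note hom = sr_hom[OF assms(1), of ?K] and hom' = sr_hom[OF S, of ?K]
  fix P' assume P': "primeideal P' ?R'"
  \<comment> \<open>\<open>P'\<close> is pulled back to the polynomial ring and pushed forward to
    K[\<Delta>], so that both localizations are described by the same p.\<close>
  define p where "p = {f. sr_hom ?K V ?S f \<in> P'}"
  define P where "P = sr_hom ?K V \<Delta> ` p"
  have ker: "{f. sr_hom ?K V \<Delta> f = \<zero>\<^bsub>?R\<^esub>} = nonface_ideal \<Delta>" "{f. sr_hom ?K V ?S f = \<zero>\<^bsub>?R'\<^esub>} = nonface_ideal ?S"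
    using hom(5) hom'(5) by auto
  have loc: "localization_map p (localization_at ?R' P')
    (\<lambda>f. fraction ?R' (carrier ?R' - P') (sr_hom ?K V ?S f) \<one>\<^bsub>?R'\<^esub>) (nonface_ideal ?S)"
    using localization_map_fraction[OF P' hom'(1-4)] unfolding ker p_def[symmetric] .
  interpret polynomial_prime p
    using localization_map.axioms(1)[OF loc] by (rule polynomial_prime.intro)
  interpret L': localization_map p "localization_at ?R' P'"
    "\<lambda>f. fraction ?R' (carrier ?R' - P') (sr_hom ?K V ?S f) \<one>\<^bsub>?R'\<^esub>" "nonface_ideal ?S"
    by (rule loc)
  have nonface_ideal_le: "nonface_ideal \<Delta> \<subseteq> (nonface_ideal ?S :: (('v \<Rightarrow>\<^sub>0 nat) \<Rightarrow>\<^sub>0 'k) set)"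
    by (rule nonface_ideal_antimono) (auto simp: skeleton_def)
  have kerp: "{f. sr_hom ?K V \<Delta> f = \<zero>\<^bsub>?R\<^esub>} \<subseteq> p" using nonface_ideal_le L'.K_p unfolding ker by blast
  note img = primeideal_image[OF stanley_reisner_ring_cring prime kerp hom(1-4)]
  have P: "primeideal P ?R" "{f. sr_hom ?K V \<Delta> f \<in> P} = p" unfolding P_def by (rule img)+
  interpret L: localization_map p "localization_at ?R P"
    "\<lambda>f. fraction ?R (carrier ?R - P) (sr_hom ?K V \<Delta> f) \<one>\<^bsub>?R\<^esub>" "nonface_ideal \<Delta>"
    using localization_map_fraction[OF P(1) hom(1-4)] unfolding ker P(2) .
  let ?L = "localization_at ?R P" and ?L' = "localization_at ?R' P'"
  have finV: "finite V" using assms(1) by (simp add: simplicial_complex_def)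
  obtain T where T: "T \<subseteq> V" "indep_vars T" by (rule exists_maximal_indep_vars[OF finV])
  \<comment> \<open>This rules out infinite dimension, so that a chain of length exactly the
    dimension can be fixed.\<close>
  have bound: "n \<le> card V" if "enat n \<le> krull_dim ?L'" for n
  proof -
    obtain Q where Q: "\<forall>k\<le>n. is_prime (Q k) \<and> nonface_ideal ?S \<subseteq> Q k \<and> Q k \<subseteq> p" "\<forall>k<n. Q k \<subset> Q (Suc k)"
      using \<open>enat n \<le> krull_dim ?L'\<close> unfolding L'.enat_le_krull_dim_iff by blast
    obtain G where G: "G \<in> ?S" "card T + n \<le> card G" by (rule chain_face_bound[OF S Q T])
    then have "card G \<le> card V" using S finV by (intro card_mono) (auto simp: simplicial_complex_def)
    then show ?thesis using G(2) by simp
  qed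
  obtain n where n: "krull_dim ?L' = enat n"
  proof (cases "krull_dim ?L'")
    case infinity
    then show thesis using bound[of "Suc (card V)"] by simp
  qed
  then obtain Q where Q: "\<forall>k\<le>n. is_prime (Q k) \<and> nonface_ideal ?S \<subseteq> Q k \<and> Q k \<subseteq> p" "\<forall>k<n. Q k \<subset> Q (Suc k)"
    using L'.enat_le_krull_dim_iff[of n] by auto
  \<comment> \<open>Primes above the ideal of the skeleton also lie above the smaller ideal of
    \<Delta>.\<close>
  have "enat n \<le> krull_dim ?L"
    unfolding L.enat_le_krull_dim_iff using Q nonface_ideal_le by (intro exI[of _ Q]) blast
  then have dim: "ereal_of_enat (enat n) \<le> ereal_of_enat (krull_dim ?L)"
    by (simp only: ereal_of_enat_le_iff)
  \<comment> \<open>The depth that the Serre condition demands at dimension \<open>n\<close>;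
    \<open>nat\<close> replaces a negative demand by 0, which every depth meets. Nonnegative j gives
    \<open>r \<le> n\<close>, so the chain of length \<open>n\<close> suffices for
    \<open>grade_ge_skeleton_of_chain\<close>.\<close>
  define r where "r = nat (min l (int n - j))"
  have r: "r \<le> n" using assms(3) by (simp add: r_def)
  have "enat r \<le> depth ?L"
  proof (cases "min l (int n - j) \<ge> 0")
    case True
    have "ereal_of_enat (enat r) = min (ereal (of_int l)) (ereal_of_enat (enat n) - ereal (of_int j))"
      using True by (auto simp: r_def min_def)
    also have "\<dots> \<le> min (ereal (of_int l)) (ereal_of_enat (krull_dim ?L) - ereal (of_int j))"
      by (intro min.mono order_refl ereal_minus_mono dim)
    also have "\<dots> \<le> ereal_of_enat (depth ?L)" using assms(6) P(1) unfolding serre_condition_def by blast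
    finally show ?thesis by (simp only: ereal_of_enat_le_iff)
  next
    case False
    then have "r = 0" unfolding r_def by (intro nat_le_0) linarith
    then show ?thesis by (simp flip: zero_enat_def)
  qed
  then have "grade_ge r UNIV (nonface_ideal \<Delta>)" unfolding L.enat_le_depth_iff .
  then have "grade_ge r UNIV (nonface_ideal ?S)" by (rule grade_ge_skeleton_of_chain[OF assms(1) _ Q r])
  then have "enat r \<le> depth ?L'" unfolding L'.enat_le_depth_iff .
  then have "ereal_of_enat (enat r) \<le> ereal_of_enat (depth ?L')" by (simp only: ereal_of_enat_le_iff)
  moreover have "min (ereal (of_int l)) (ereal_of_enat (krull_dim ?L') - ereal (of_int j)) \<le> ereal_of_enat (enat r)"
    unfolding n r_def by (auto simp: min_def)
  ultimately show "min (ereal (of_int l)) (ereal_of_enat (krull_dim ?L') - ereal (of_int j))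
      \<le> ereal_of_enat (depth ?L')" by (rule order_trans[rotated])
qed

end
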